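(* Let $\mathbf{A}=(A^{(i)}_j)_{0\le i\le r,\ \delta_{i,0}\le j\le m_i}$ be a tuple of linear endomorphisms of $V=\mathbb{C}^n$ such that $m_i\le1$ for all $i=0,\dots,r$, the matrices $A^{(i)}_1$ are semi-simple for all $i$ (with $m_i=1$), and $V$ is irreducible as an $\langle\mathbf{A}\rangle$-module. Then the index of rigidity is preserved by middle convolution: for all $\mu\in\mathbb{C}$, $$\mathrm{idx}(mc_\mu(\mathbf{A}))=\mathrm{idx}(\mathbf{A}).$$
   Context: Here $r\ge1$ and $m_0,\dots,m_r\ge0$ are integers, $\delta$ is the Kronecker delta (so $A^{(0)}_0$ is not an entry of the tuple); one sets $A^{(0)}_0:=-(A^{(1)}_0+\dots+A^{(r)}_0)$, for every tuple of this kind. Let $M=r+\sum_{i=0}^rm_i$. $V$ is irreducible as an $\langle\mathbf{A}\rangle$-module if there is no nonzero proper subspace $W\subset V$ with $A^{(i)}_jW\subset W$ for all entries. The case $m_i=0$ is regarded as included in the case $m_i=1$ by setting $A^{(i)}_1=0$. Index of rigidity: for $i=0,\dots,r$ let $A^{(i)}\in\mathrm{End}(V^{\oplus(m_i+1)})$ be the block upper triangular Toeplitz matrix with first block row $(A^{(i)}_{m_i},A^{(i)}_{m_i-1},\dots,A^{(i)}_0)$ (so $A^{(i)}=\begin{pmatrix}A^{(i)}_1&A^{(i)}_0\\0&A^{(i)}_1\end{pmatrix}$ if $m_i=1$, and $A^{(i)}=A^{(i)}_0$ if $m_i=0$). Let $\mathcal{C}^{(i)}$ be the space of block upper triangular Toeplitz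 matrices $C^{(i)}$ with first block row $(C^{(i)}_{m_i},\dots,C^{(i)}_0)$, $C^{(i)}_j\in\mathrm{End}(V)$, such that $A^{(i)}C^{(i)}=C^{(i)}A^{(i)}$. Then $\mathrm{idx}(\mathbf{A})=\sum_{i=0}^r\dim\mathcal{C}^{(i)}-(M-1)(\dim V)^2$. Middle convolution: let $V'=\bigoplus_{i=0}^rV^{(i)}$ with $V^{(0)}=V^{\oplus m_0}$, $V^{(i)}=V^{\oplus(m_i+1)}$ for $i\ge1$; elements are $v=(v^{(i)}_j)$ with $v^{(i)}_j\in V$, $0\le i\le r$, $\delta_{i,0}\le j\le m_i$. Put $S(v)=\sum_{i=0}^r\sum_{j=\delta_{i,0}}^{m_i}A^{(i)}_jv^{(i)}_j$. For $\mu\in\mathbb{C}$ define $\tilde A^{(i)}_j\in\mathrm{End}(V')$ by $u=\tilde A^{(i)}_jv$, where $u^{(i)}_{j'}=\mu v^{(i)}_{j'-j}$ for $j'>j$; $u^{(0)}_j=S(v)$ if $i=0$; $u^{(i)}_j=\mu v^{(i)}_0+S(v)$ if $i\ne0$; all other components of $u$ are $0$. Define subspaces of $V'$: - $\mathcal{K}=\bigoplus_{i=0}^r\mathcal{K}^{(i)}$, $\mathcal{K}^{(0)}=\{0\}$, and for $i\ge1$, $\mathcal{K}^{(i)}=\{(v^{(i)}_{m_i},\dots,v^{(i)}_0)^T\in V^{(i)}: A^{(i)}(v^{(i)}_{m_i},\dots,v^{(i)}_0)^T=0\}$; - for $\mu\ne0$, $\mathcal{L}(\mu)$ is the set of $v\in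 V'$ for which there is $\ell\in V$ with $v^{(i)}_j=0$ for all $i\ne0,j\ne0$, $v^{(1)}_0=\dots=v^{(r)}_0=-\ell$, and $(v^{(0)}_{m_0},\dots,v^{(0)}_1,\ell)^T$ is annihilated by the matrix obtained from $A^{(0)}$ by replacing its upper right block $A^{(0)}_0$ by $A^{(0)}_0-\mu I_n$; - $\mathcal{L}(0)=\{v\in V':S(v)=0\}$. The subspaces $\mathcal{K}$ and $\mathcal{L}(\mu)$ are invariant under all $\tilde A^{(i)}_j$. The middle convolution $mc_\mu(\mathbf{A})$ is the tuple (with the same $r,m_0,\dots,m_r$) of endomorphisms of $mc_\mu(V)=V'/(\mathcal{K}+\mathcal{L}(\mu))$ induced by the $\tilde A^{(i)}_j$.
   Formalization: It is assumed in addition that mc_μ(V) is not the zero space (so n ≥ 1); without this the claim fails, e.g. for n = 1 with all entries 0, where idx(A) = 2 but mc_μ(V) = 0 and idx(mc_μ(A)) = 0. *)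

theory Defs
  imports "Jordan_Normal_Form.VS_Connect" "HOL-Algebra.AbelCoset"
begin

section \<open>Complex vector spaces with explicit carriers\<close>

text \<open>
  Vector spaces are module records over the field \<open>class_ring :: complex ring\<close>, so that
  subspaces, cosets and dimensions are those of the library.  As in \<open>module_vec\<close>, the
  multiplicative fields of the records are irrelevant and left undefined.
\<close>

abbreviation vdim :: "(complex, 'v) module \<Rightarrow> nat" where
  "vdim V \<equiv> vectorspace.dim class_ring V"

abbreviation C_space :: "nat \<Rightarrow> (complex, complex vec) module" where
  "C_space n \<equiv> module_vec TYPE(complex) n"

abbreviation is_subspace :: "'v set \<Rightarrow> (complex, 'v) module \<Rightarrow> bool" where
  "is_subspace W V \<equiv> VectorSpace.subspace class_ring W V"

abbreviation is_endo :: "(complex, 'v) module \<Rightarrow> ('v \<Rightarrow> 'v) \<Rightarrow> bool" where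
  "is_endo V f \<equiv> f \<in> LinearCombinations.module_hom class_ring V V"

definition direct_power :: "'i set \<Rightarrow> (complex, 'v) module \<Rightarrow> (complex, 'i \<Rightarrow> 'v) module" where
  "direct_power I V = \<lparr>
     carrier = I \<rightarrow>\<^sub>E carrier V,
     mult = undefined,
     one = undefined,
     zero = (\<lambda>k\<in>I. \<zero>\<^bsub>V\<^esub>),
     add = (\<lambda>v w. \<lambda>k\<in>I. v k \<oplus>\<^bsub>V\<^esub> w k),
     smult = (\<lambda>c v. \<lambda>k\<in>I. c \<odot>\<^bsub>V\<^esub> v k)\<rparr>"

text \<open>Endomorphisms are made extensional here, so that equality in \<open>End(V)\<close> is equality of
  maps on the carrier.\<close>

definition End_space :: "(complex, 'v) module \<Rightarrow> (complex, 'v \<Rightarrow> 'v) module" where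
  "End_space V = \<lparr>
     carrier = {f \<in> extensional (carrier V). is_endo V f},
     mult = undefined,
     one = undefined,
     zero = (\<lambda>x\<in>carrier V. \<zero>\<^bsub>V\<^esub>),
     add = (\<lambda>f g. \<lambda>x\<in>carrier V. f x \<oplus>\<^bsub>V\<^esub> g x),
     smult = (\<lambda>c f. \<lambda>x\<in>carrier V. c \<odot>\<^bsub>V\<^esub> f x)\<rparr>"

text \<open>The quotient by a subspace is the set of cosets; scalar multiplication and induced maps
  follow the pattern of \<open>rcoset_mult\<close>, i.e. they send the coset of \<open>x\<close> to the coset of
  \<open>c x\<close> and of \<open>f x\<close> (the latter when \<open>f\<close> leaves the subspace invariant).\<close>

definition quotient_space :: "(complex, 'v) module \<Rightarrow> 'v set \<Rightarrow> (complex, 'v set) module" where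
  "quotient_space V W = \<lparr>
     carrier = A_RCOSETS V W,
     mult = undefined,
     one = undefined,
     zero = W,
     add = set_add V,
     smult = (\<lambda>c X. \<Union>x\<in>X. a_r_coset V W (c \<odot>\<^bsub>V\<^esub> x))\<rparr>"

definition quotient_map :: "(complex, 'v) module \<Rightarrow> 'v set \<Rightarrow> ('v \<Rightarrow> 'v) \<Rightarrow> 'v set \<Rightarrow> 'v set" where
  "quotient_map V W f = (\<lambda>X\<in>A_RCOSETS V W. \<Union>x\<in>X. a_r_coset V W (f x))"

definition semisimple_endo :: "(complex, 'v) module \<Rightarrow> ('v \<Rightarrow> 'v) \<Rightarrow> bool" where
  "semisimple_endo V f \<longleftrightarrow>
     (\<forall>W. is_subspace W V \<and> f ` W \<subseteq> W \<longrightarrow>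
        (\<exists>W'. is_subspace W' V \<and> f ` W' \<subseteq> W' \<and>
              W \<inter> W' = {\<zero>\<^bsub>V\<^esub>} \<and> set_add V W W' = carrier V))"

section \<open>Tuples of endomorphisms\<close>

text \<open>A tuple is a function \<open>A\<close> with \<open>A i j\<close> standing for $A^{(i)}_j$.  Only the values at
  \<open>entries r m\<close> are part of the tuple; \<open>complete\<close> sets the value at \<open>(0, 0)\<close> to
  $-(A^{(1)}_0 + \dots + A^{(r)}_0)$, whatever it was before.\<close>

definition entries :: "nat \<Rightarrow> (nat \<Rightarrow> nat) \<Rightarrow> (nat \<times> nat) set" where
  "entries r m = {(i, j). i \<le> r \<and> (if i = 0 then 1 else 0) \<le> j \<and> j \<le> m i}"

definition complete ::
    "(complex, 'v) module \<Rightarrow> nat \<Rightarrow> (nat \<Rightarrow> nat \<Rightarrow> 'v \<Rightarrow> 'v) \<Rightarrow> nat \<Rightarrow> nat \<Rightarrow> 'v \<Rightarrow> 'v" where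
  "complete V r A i j =
     (if i = 0 \<and> j = 0 then \<lambda>x. \<ominus>\<^bsub>V\<^esub> (\<Oplus>\<^bsub>V\<^esub>k\<in>{1..r}. A k 0 x) else A i j)"

definition irreducible_tuple ::
    "(complex, 'v) module \<Rightarrow> nat \<Rightarrow> (nat \<Rightarrow> nat) \<Rightarrow> (nat \<Rightarrow> nat \<Rightarrow> 'v \<Rightarrow> 'v) \<Rightarrow> bool" where
  "irreducible_tuple V r m A \<longleftrightarrow>
     \<not> (\<exists>W. is_subspace W V \<and> W \<noteq> {\<zero>\<^bsub>V\<^esub>} \<and> W \<noteq> carrier V \<and>
            (\<forall>(i, j)\<in>entries r m. A i j ` W \<subseteq> W))"

section \<open>Index of rigidity\<close>

text \<open>
  The block upper triangular Toeplitz matrix with first block row $(B_m, B_{m-1}, \dots, B_0)$,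
  acting on columns $(v_m, \dots, v_0)^T$.  Columns are indexed by the subscripts, so position
  \<open>p\<close> from the top (counted from 0) has index \<open>m - p\<close>; the block in the row of index \<open>j\<close> and the
  column of index \<open>k \<le> j\<close> is $B_{m-(j-k)}$.
\<close>

definition toeplitz ::
    "(complex, 'v) module \<Rightarrow> nat \<Rightarrow> (nat \<Rightarrow> 'v \<Rightarrow> 'v) \<Rightarrow> (nat \<Rightarrow> 'v) \<Rightarrow> (nat \<Rightarrow> 'v)" where
  "toeplitz V m B =
     (\<lambda>v\<in>carrier (direct_power {..m} V). \<lambda>j\<in>{..m}. \<Oplus>\<^bsub>V\<^esub>k\<in>{..j}. B (m - (j - k)) (v k))"

definition toeplitz_commutant ::
    "(complex, 'v) module \<Rightarrow> nat \<Rightarrow> (nat \<Rightarrow> 'v \<Rightarrow> 'v) \<Rightarrow> ((nat \<Rightarrow> 'v) \<Rightarrow> (nat \<Rightarrow> 'v)) set" where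
  "toeplitz_commutant V m B =
     {toeplitz V m C | C.
        (\<forall>j\<le>m. is_endo V (C j)) \<and>
        (\<forall>v\<in>carrier (direct_power {..m} V).
           toeplitz V m B (toeplitz V m C v) = toeplitz V m C (toeplitz V m B v))}"

definition idx ::
    "(complex, 'v) module \<Rightarrow> nat \<Rightarrow> (nat \<Rightarrow> nat) \<Rightarrow> (nat \<Rightarrow> nat \<Rightarrow> 'v \<Rightarrow> 'v) \<Rightarrow> int" where
  "idx V r m A =
     (\<Sum>i\<le>r. int (vdim ((End_space (direct_power {..m i} V))
                    \<lparr>carrier := toeplitz_commutant V (m i) (complete V r A i)\<rparr>)))
     - (int (r + (\<Sum>i\<le>r. m i)) - 1) * (int (vdim V))\<^sup>2"

section \<open>Middle convolution\<close>

definition conv_space ::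
    "(complex, 'v) module \<Rightarrow> nat \<Rightarrow> (nat \<Rightarrow> nat) \<Rightarrow> (complex, nat \<times> nat \<Rightarrow> 'v) module" where
  "conv_space V r m = direct_power (entries r m) V"

definition conv_sum ::
    "(complex, 'v) module \<Rightarrow> nat \<Rightarrow> (nat \<Rightarrow> nat) \<Rightarrow> (nat \<Rightarrow> nat \<Rightarrow> 'v \<Rightarrow> 'v) \<Rightarrow>
     (nat \<times> nat \<Rightarrow> 'v) \<Rightarrow> 'v" where
  "conv_sum V r m A v = (\<Oplus>\<^bsub>V\<^esub>k\<in>entries r m. A (fst k) (snd k) (v k))"

definition conv_tuple ::
    "(complex, 'v) module \<Rightarrow> nat \<Rightarrow> (nat \<Rightarrow> nat) \<Rightarrow> (nat \<Rightarrow> nat \<Rightarrow> 'v \<Rightarrow> 'v) \<Rightarrow> complex \<Rightarrow>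
     nat \<Rightarrow> nat \<Rightarrow> (nat \<times> nat \<Rightarrow> 'v) \<Rightarrow> (nat \<times> nat \<Rightarrow> 'v)" where
  "conv_tuple V r m A \<mu> i j =
     (\<lambda>v\<in>carrier (conv_space V r m). \<lambda>(i', j')\<in>entries r m.
        if i' \<noteq> i \<or> j' < j then \<zero>\<^bsub>V\<^esub>
        else if j < j' then \<mu> \<odot>\<^bsub>V\<^esub> v (i, j' - j)
        else if i = 0 then conv_sum V r m A v
        else \<mu> \<odot>\<^bsub>V\<^esub> v (i, 0) \<oplus>\<^bsub>V\<^esub> conv_sum V r m A v)"

definition conv_K ::
    "(complex, 'v) module \<Rightarrow> nat \<Rightarrow> (nat \<Rightarrow> nat) \<Rightarrow> (nat \<Rightarrow> nat \<Rightarrow> 'v \<Rightarrow> 'v) \<Rightarrow>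
     (nat \<times> nat \<Rightarrow> 'v) set" where
  "conv_K V r m A =
     {v \<in> carrier (conv_space V r m).
        (\<forall>j\<in>{1..m 0}. v (0, j) = \<zero>\<^bsub>V\<^esub>) \<and>
        (\<forall>i\<in>{1..r}. toeplitz V (m i) (A i) (\<lambda>j\<in>{..m i}. v (i, j))
                       = \<zero>\<^bsub>direct_power {..m i} V\<^esub>)}"

text \<open>In the case \<open>\<mu> \<noteq> 0\<close>, the matrix annihilating $(v^{(0)}_{m_0}, \dots, v^{(0)}_1, \ell)^T$
  has $A^{(0)}_0 - \mu$ in place of its upper right block $A^{(0)}_0$; this is the only block with
  subscript 0, so the matrix is again of Toeplitz form.\<close>

definition conv_L ::
    "(complex, 'v) module \<Rightarrow> nat \<Rightarrow> (nat \<Rightarrow> nat) \<Rightarrow> (nat \<Rightarrow> nat \<Rightarrow> 'v \<Rightarrow> 'v) \<Rightarrow> complex \<Rightarrow>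
     (nat \<times> nat \<Rightarrow> 'v) set" where
  "conv_L V r m A \<mu> =
     (if \<mu> = 0 then {v \<in> carrier (conv_space V r m). conv_sum V r m A v = \<zero>\<^bsub>V\<^esub>}
      else {v \<in> carrier (conv_space V r m). \<exists>l\<in>carrier V.
        (\<forall>(i, j)\<in>entries r m. i \<noteq> 0 \<and> j \<noteq> 0 \<longrightarrow> v (i, j) = \<zero>\<^bsub>V\<^esub>) \<and>
        (\<forall>i\<in>{1..r}. v (i, 0) = \<ominus>\<^bsub>V\<^esub> l) \<and>
        toeplitz V (m 0)
          ((complete V r A 0)(0 := \<lambda>x. complete V r A 0 0 x \<ominus>\<^bsub>V\<^esub> \<mu> \<odot>\<^bsub>V\<^esub> x))
          (\<lambda>j\<in>{..m 0}. if j = 0 then l else v (0, j))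
        = \<zero>\<^bsub>direct_power {..m 0} V\<^esub>})"

definition conv_KL ::
    "(complex, 'v) module \<Rightarrow> nat \<Rightarrow> (nat \<Rightarrow> nat) \<Rightarrow> (nat \<Rightarrow> nat \<Rightarrow> 'v \<Rightarrow> 'v) \<Rightarrow> complex \<Rightarrow>
     (nat \<times> nat \<Rightarrow> 'v) set" where
  "conv_KL V r m A \<mu> = set_add (conv_space V r m) (conv_K V r m A) (conv_L V r m A \<mu>)"

definition mc_space ::
    "(complex, 'v) module \<Rightarrow> nat \<Rightarrow> (nat \<Rightarrow> nat) \<Rightarrow> (nat \<Rightarrow> nat \<Rightarrow> 'v \<Rightarrow> 'v) \<Rightarrow> complex \<Rightarrow>
     (complex, (nat \<times> nat \<Rightarrow> 'v) set) module" where
  "mc_space V r m A \<mu> = quotient_space (conv_space V r m) (conv_KL V r m A \<mu>)"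

text \<open>
  \<open>mc_space\<close> can be zero although \<open>V\<close> is irreducible and nonzero: if \<open>V\<close> has dimension 1 and all
  entries of the tuple vanish, then $V' = \mathcal{K} + \mathcal{L}(\mu)$ for every \<open>\<mu>\<close>.  In that
  example \<open>idx\<close> is 2 for the tuple and 0 for its middle convolution, so preservation of \<open>idx\<close>
  has to be stated for nonzero \<open>mc_space\<close>.
\<close>

definition mc_tuple ::
    "(complex, 'v) module \<Rightarrow> nat \<Rightarrow> (nat \<Rightarrow> nat) \<Rightarrow> (nat \<Rightarrow> nat \<Rightarrow> 'v \<Rightarrow> 'v) \<Rightarrow> complex \<Rightarrow>
     nat \<Rightarrow> nat \<Rightarrow> (nat \<times> nat \<Rightarrow> 'v) set \<Rightarrow> (nat \<times> nat \<Rightarrow> 'v) set" where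
  "mc_tuple V r m A \<mu> i j =
     quotient_map (conv_space V r m) (conv_KL V r m A \<mu>) (conv_tuple V r m A \<mu> i j)"

end

theory Submission
  imports Defs "HOL-Library.Function_Algebras" "HOL-Library.Product_Plus"
begin

text \<open>
  Let $e = \dim mc_\mu(V) - \dim V$.  For each $i$ the commutant $\mathcal{C}^{(i)}$ grows by
  $(m_i + 1) e^2 + 2 e k_i$, where $k_i = \dim \mathcal{K}^{(i)}$ for $i \ge 1$ and
  $k_0 = \dim \mathcal{L}(\mu)$.  Since $\sum_i k_i = M \dim V - \dim mc_\mu(V)$ for $\mu \ne 0$, and
  $e = 0$ for $\mu = 0$, summation over $i$ gives the claim.

  The local formula rests on a factorisation.  Over $\mathbf{C}[\epsilon]/\epsilon^{m_i+1}$ put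
  $\mathbf{A} = A^{(i)}_1 + \epsilon A^{(i)}_0$ (or $A^{(i)}_0$ if $m_i = 0$).  The convolved operator is
  $\iota \Phi$ with $\Phi$ onto, while $\Phi \iota$ equals $\mathbf{A}$ up to a scalar shift and $\iota$,
  read modulo $\mathcal{K} + \mathcal{L}(\mu)$, has the kernel of $\mathbf{A}$.  Hence $\mathbf{A}$ and the
  convolved operator have isomorphic images.  For $i = 0$ this holds after subtracting $\mu$ from
  $A^{(0)}_0$, which does not affect commutants.  What remains is to express the commutant of an
  operator through its image: for a single operator $T$ on $V$ one has
  $\dim Z(T) = \dim Z(T|_{\mathrm{im}\, T}) + (\dim \ker T)^2$, and for a pair with $A_1$ semisimple the
  splitting $V = \ker A_1 \oplus \mathrm{im}\, A_1$ reduces to this case.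

  Irreducibility and $mc_\mu(V) \ne 0$ enter only to exclude common eigenvectors, which makes
  $\Phi$ onto and the kernel of $\iota$ as small as stated.
\<close>

section \<open>Subspaces of complex vector spaces\<close>

text \<open>Over C[\<epsilon>]/\<epsilon>^2 the two parts of the splitting behave differently. On im
  A_1 the constant term is invertible, and the isomorphism of images carries this block over, up to
  a shift by 2 \<mu> \<epsilon>: it contributes no growth. On ker A_1 the operator reduces to
  \<epsilon> D, with D the compression of A_0, and its commutant is Z(D) + \<epsilon> End(ker A_1).
  These two summands are the source of the coefficient m_i + 1 = 2 of e^2 and of the two parts dim
  ker A_1 and dim ker D of k_i. The case \<mu> = 0 has to be handled apart: L(0) is the kernel of a
  surjection V' -> V, and the k_i need not add up to its dimension. The formula for each i still
  holds there, with k_0 the nullity at i = 0, but every k_i is multiplied by e = 0. The dimension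
  counts take place in subspaces of types whose function spaces and products are again vector
  spaces, so that V', Hom spaces and commutants share one notion of dimension. The quotient is
  replaced by a complement of K + L(\<mu>); cosets appear when the result is transported to the
  given spaces.\<close>

class cvs = ab_group_add +
  fixes cscale :: "complex \<Rightarrow> 'a \<Rightarrow> 'a"  (infixr "*\<^sub>C" 75)
  assumes cscale_add_right: "a *\<^sub>C (x + y) = a *\<^sub>C x + a *\<^sub>C y"
    and cscale_add_left: "(a + b) *\<^sub>C x = a *\<^sub>C x + b *\<^sub>C x"
    and cscale_cscale: "a *\<^sub>C b *\<^sub>C x = (a * b) *\<^sub>C x"
    and cscale_one: "1 *\<^sub>C x = x"

instantiation complex :: cvs
begin
definition "a *\<^sub>C (x :: complex) = a * x"
instance by standard (simp_all add: cscale_complex_def algebra_simps)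
end

instantiation "fun" :: (type, cvs) cvs
begin
definition "a *\<^sub>C f = (\<lambda>x. a *\<^sub>C f x)"
instance by standard
  (simp_all add: cscale_fun_def fun_eq_iff cscale_add_right cscale_add_left cscale_cscale cscale_one)
end

instantiation prod :: (cvs, cvs) cvs
begin
definition "a *\<^sub>C p = (a *\<^sub>C fst p, a *\<^sub>C snd p)"
instance by standard
  (simp_all add: cscale_prod_def prod_eq_iff cscale_add_right cscale_add_left cscale_cscale cscale_one)
end

lemma cscale_fun_apply [simp]: "(a *\<^sub>C f) x = a *\<^sub>C f x"
  by (simp add: cscale_fun_def)

lemma fst_cscale [simp]: "fst (a *\<^sub>C p) = a *\<^sub>C fst p" and snd_cscale [simp]: "snd (a *\<^sub>C p) = a *\<^sub>C snd p"
  by (simp_all add: cscale_prod_def)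

global_interpretation cv: vector_space "cscale :: complex \<Rightarrow> 'a::cvs \<Rightarrow> 'a"
  defines cspan = cv.span and csubspace = cv.subspace and cindep = cv.independent and cdim = cv.dim
  by standard (simp_all add: cscale_add_right cscale_add_left cscale_cscale cscale_one)

global_interpretation cp: vector_space_pair "cscale :: complex \<Rightarrow> 'a::cvs \<Rightarrow> 'a"
   "cscale :: complex \<Rightarrow> 'b::cvs \<Rightarrow> 'b"
  by standard

lemmas csub_0 = cv.subspace_0
  and csub_add = cv.subspace_add
  and csub_scale = cv.subspace_scale
  and csub_diff = cv.subspace_diff
  and csub_neg = cv.subspace_neg

lemma csubspaceI:
  assumes "0 \<in> S" "\<And>x y. x \<in> S \<Longrightarrow> y \<in> S \<Longrightarrow> x + y \<in> S" "\<And>c x. x \<in> S \<Longrightarrow> c *\<^sub>C x \<in> S"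
  shows "csubspace S"
  using assms unfolding cv.subspace_def by blast

section \<open>Maps that are linear on a subspace\<close>

definition lin :: "'a::cvs set \<Rightarrow> ('a \<Rightarrow> 'b::cvs) \<Rightarrow> bool" where
  "lin S f \<longleftrightarrow> (\<forall>x\<in>S. \<forall>y\<in>S. f (x + y) = f x + f y) \<and> (\<forall>c. \<forall>x\<in>S. f (c *\<^sub>C x) = c *\<^sub>C f x)"

lemma linI:
  assumes "\<And>x y. x \<in> S \<Longrightarrow> y \<in> S \<Longrightarrow> f (x + y) = f x + f y"
    and "\<And>c x. x \<in> S \<Longrightarrow> f (c *\<^sub>C x) = c *\<^sub>C f x"
  shows "lin S f"
  using assms by (simp add: lin_def)

lemma lin_add: "lin S f \<Longrightarrow> x \<in> S \<Longrightarrow> y \<in> S \<Longrightarrow> f (x + y) = f x + f y"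
  by (simp add: lin_def)

lemma lin_scale: "lin S f \<Longrightarrow> x \<in> S \<Longrightarrow> f (c *\<^sub>C x) = c *\<^sub>C f x"
  by (simp add: lin_def)

lemma lin_0: "lin S f \<Longrightarrow> csubspace S \<Longrightarrow> f 0 = 0"
  by (metis cv.scale_zero_left csub_0 lin_scale)

lemma lin_neg: "lin S f \<Longrightarrow> csubspace S \<Longrightarrow> x \<in> S \<Longrightarrow> f (- x) = - f x"
  by (metis cv.scale_minus_left cv.scale_one lin_scale)

lemma lin_diff: "lin S f \<Longrightarrow> csubspace S \<Longrightarrow> x \<in> S \<Longrightarrow> y \<in> S \<Longrightarrow> f (x - y) = f x - f y"
  using lin_add[of S f x "- y"] by (simp add: csub_neg lin_neg)

lemma lin_sum:
  assumes "lin S f" "csubspace S" "\<And>k. k \<in> E \<Longrightarrow> x k \<in> S"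
  shows "f (\<Sum>k\<in>E. x k) = (\<Sum>k\<in>E. f (x k))"
  using assms(3)
proof (induction E rule: infinite_finite_induct)
  case (insert k E)
  then have "(\<Sum>k\<in>E. x k) \<in> S" by (intro cv.subspace_sum) (auto simp: assms)
  with insert show ?case by (simp add: lin_add[OF assms(1)])
qed (simp_all add: lin_0[OF assms(1,2)])

lemma lin_subset: "lin S f \<Longrightarrow> T \<subseteq> S \<Longrightarrow> lin T f"
  unfolding lin_def by blast

lemma lin_cong: "lin S f \<Longrightarrow> csubspace S \<Longrightarrow> (\<And>x. x \<in> S \<Longrightarrow> g x = f x) \<Longrightarrow> lin S g"
  by (intro linI) (simp_all add: csub_add csub_scale lin_add lin_scale)

lemma lin_comp: "lin S f \<Longrightarrow> f ` S \<subseteq> T \<Longrightarrow> lin T g \<Longrightarrow> lin S (\<lambda>x. g (f x))"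
  by (intro linI) (auto simp: lin_add lin_scale image_subset_iff)

lemma lin_plus: "lin S f \<Longrightarrow> lin S g \<Longrightarrow> lin S (\<lambda>x. f x + g x)"
  by (intro linI) (auto simp: lin_add lin_scale cscale_add_right)

lemma lin_cscale: "lin S f \<Longrightarrow> lin S (\<lambda>x. c *\<^sub>C f x)"
  by (intro linI) (auto simp: lin_add lin_scale cscale_add_right cscale_cscale mult.commute)

lemma lin_uminus: "lin S f \<Longrightarrow> lin S (\<lambda>x. - f x)"
  by (intro linI) (auto simp: lin_add lin_scale)

lemma lin_minus: "lin S f \<Longrightarrow> lin S g \<Longrightarrow> lin S (\<lambda>x. f x - g x)"
  by (intro linI) (auto simp: lin_add lin_scale cv.scale_right_diff_distrib)

lemma lin_id: "lin S (\<lambda>x. x)"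
  by (intro linI) auto

lemma lin_zero: "lin S (\<lambda>x. 0)"
  by (intro linI) auto

lemma linear_lin: "Vector_Spaces.linear (*\<^sub>C) (*\<^sub>C) f \<Longrightarrow> lin S f"
  by (intro linI) (simp_all add: cp.linear_add cp.linear_scale)

lemma csubspace_kernel:
  assumes "csubspace S" "lin S f"
  shows "csubspace {x \<in> S. f x = 0}"
  using assms by (intro csubspaceI)
    (auto simp: csub_0 csub_add csub_scale lin_0 lin_add lin_scale)

lemma csubspace_image:
  assumes "csubspace S" "lin S f"
  shows "csubspace (f ` S)"
proof (rule csubspaceI)
  show "0 \<in> f ` S" using assms csub_0 lin_0 by (metis imageI)
  show "x + y \<in> f ` S" if xy: "x \<in> f ` S" "y \<in> f ` S" for x y
  proof -
    obtain u v where "u \<in> S" "v \<in> S" "x = f u" "y = f v" using xy by blast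
    then show ?thesis using assms csub_add by (intro image_eqI[of _ _ "u + v"]) (auto simp: lin_add)
  qed
  show "c *\<^sub>C x \<in> f ` S" if "x \<in> f ` S" for c x
  proof -
    obtain u where "u \<in> S" "x = f u" using \<open>x \<in> f ` S\<close> by blast
    then show ?thesis using assms csub_scale by (intro image_eqI[of _ _ "c *\<^sub>C u"]) (auto simp: lin_scale)
  qed
qed

text \<open>Bridge between maps that are linear only on \<open>S\<close> and facts about globally
  linear maps: the values on a basis of \<open>S\<close> determine a global extension.\<close>

lemma lin_extend:
  assumes "csubspace S" "lin S f"
  obtains g where "Vector_Spaces.linear (*\<^sub>C) (*\<^sub>C) g" "\<And>x. x \<in> S \<Longrightarrow> g x = f x"
proof -
  obtain B where B: "B \<subseteq> S" "cv.independent B" "S \<subseteq> cspan B"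
    by (rule cv.basis_exists[of S]) blast
  define g where "g = cp.construct B f"
  have lg: "Vector_Spaces.linear (*\<^sub>C) (*\<^sub>C) g"
    unfolding g_def by (rule cp.linear_construct[OF B(2)])
  have "csubspace {x \<in> S. (\<lambda>x. g x - f x) x = 0}"
    by (rule csubspace_kernel) (auto intro: assms lin_minus linear_lin lg)
  moreover have "B \<subseteq> {x \<in> S. (\<lambda>x. g x - f x) x = 0}"
    using B by (auto simp: g_def cp.construct_basis)
  ultimately have "cspan B \<subseteq> {x \<in> S. (\<lambda>x. g x - f x) x = 0}"
    by (intro cv.span_minimal)
  with B(3) show ?thesis by (intro that[OF lg]) auto
qed

lemma lin_right_inverse:
  assumes "csubspace S" "lin S f"
  obtains s where "lin (f ` S) s" "\<And>y. y \<in> f ` S \<Longrightarrow> s y \<in> S" "\<And>y. y \<in> f ` S \<Longrightarrow> f (s y) = y"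
proof -
  obtain g where g: "Vector_Spaces.linear (*\<^sub>C) (*\<^sub>C) g" "\<And>x. x \<in> S \<Longrightarrow> g x = f x"
    using lin_extend[OF assms] by blast
  obtain s where s: "s ` UNIV \<subseteq> S" "Vector_Spaces.linear (*\<^sub>C) (*\<^sub>C) s" "\<forall>v\<in>g ` S. g (s v) = v"
    using cp.linear_exists_right_inverse_on[OF g(1) assms(1)] by (elim exE conjE)
  have "g ` S = f ` S" using g by auto
  moreover have sS: "s y \<in> S" for y using s(1) by blast
  ultimately show ?thesis using s(3) g(2) by (intro that[of s] linear_lin s(2)) auto
qed

lemma lin_projection:
  assumes "csubspace I"
  obtains q where "lin UNIV q" "\<And>x. q x \<in> I" "\<And>x. x \<in> I \<Longrightarrow> q x = x"
proof -
  have "Vector_Spaces.linear (*\<^sub>C) (*\<^sub>C) (\<lambda>x::'a. x)" by (rule cv.linear_ident)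
  from cp.linear_exists_left_inverse_on[OF this assms]
  obtain q where "q ` UNIV \<subseteq> I" "Vector_Spaces.linear (*\<^sub>C) (*\<^sub>C) q" "\<forall>v\<in>I. q v = v"
    by (auto simp: inj_on_def)
  then show ?thesis by (intro that[of q]) (auto intro: linear_lin)
qed

section \<open>Finite dimension and rank-nullity\<close>

definition findim :: "'a::cvs set \<Rightarrow> bool" where
  "findim S \<longleftrightarrow> csubspace S \<and> (\<exists>B. finite B \<and> S \<subseteq> cspan B)"

lemma findim_sub: "findim S \<Longrightarrow> csubspace S"
  by (simp add: findim_def)

lemma findim_subset: "findim S \<Longrightarrow> csubspace T \<Longrightarrow> T \<subseteq> S \<Longrightarrow> findim T"
  unfolding findim_def by blast

lemma findim_basis:
  assumes "findim S"
  obtains B where "finite B" "B \<subseteq> S" "cv.independent B" "cspan B = S" "card B = cdim S"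
proof -
  obtain D where D: "finite D" "S \<subseteq> cspan D" and S: "csubspace S" using assms unfolding findim_def by blast
  obtain B where B: "B \<subseteq> S" "cv.independent B" "S \<subseteq> cspan B" "card B = cdim S"
    by (rule cv.basis_exists[of S]) blast
  have "finite B" using cv.independent_span_bound[OF D(1) B(2)] B(1) D(2) by auto
  moreover have "cspan B = S" using B S cv.span_minimal by blast
  ultimately show ?thesis using B that by blast
qed

lemma rank_nullity:
  assumes S: "findim S" and f: "lin S f"
  shows "findim {x \<in> S. f x = 0}" "findim (f ` S)" "cdim S = cdim {x \<in> S. f x = 0} + cdim (f ` S)"
proof -
  note subS = findim_sub[OF S]
  define K where "K = {x \<in> S. f x = 0}"
  have K: "findim K" unfolding K_def by (rule findim_subset[OF S csubspace_kernel[OF subS f]]) auto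
  then show "findim {x \<in> S. f x = 0}" by (simp add: K_def)
  obtain g where g: "Vector_Spaces.linear (*\<^sub>C) (*\<^sub>C) g" "\<And>x. x \<in> S \<Longrightarrow> g x = f x"
    using lin_extend[OF subS f] by blast
  obtain B0 where B0: "finite B0" "B0 \<subseteq> K" "cv.independent B0" "cspan B0 = K" "card B0 = cdim K"
    by (rule findim_basis[OF K]) blast
  have "B0 \<subseteq> S" using B0 K_def by blast
  then obtain B where B: "B0 \<subseteq> B" "B \<subseteq> S" "cv.independent B" "S \<subseteq> cspan B"
    using cv.maximal_independent_subset_extend[OF _ B0(3)] by metis
  have finB: "finite B"
    using S B cv.independent_span_bound unfolding findim_def by (meson subset_trans)
  define C where "C = B - B0"
  have indC: "cv.independent C" using B(3) C_def cv.independent_mono by blast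
  have spanS: "cspan B = S" using B(2,4) subS cv.span_minimal by blast
  have CS: "cspan C \<subseteq> S" using spanS C_def cv.span_mono[of C B] by blast
  \<comment> \<open>Such an \<open>x\<close> lies in the spans of the disjoint parts
    \<open>B0\<close> and \<open>C\<close> of a basis. Its coordinates are supported in both, hence
    nowhere.\<close>
  have ker0: "x = 0" if x: "x \<in> cspan C" "g x = 0" for x
  proof -
    have xB0: "x \<in> cspan B0" using x CS g B0(4) K_def by auto
    have *: "cv.representation B x = cv.representation B0 x" "cv.representation B x = cv.representation C x"
      using cv.representation_extend[OF B(3)] x(1) xB0 B(1) C_def by blast+
    have "cv.representation B x b = 0" for b
    proof (rule ccontr)
      assume "cv.representation B x b \<noteq> 0"
      then have "b \<in> B0" "b \<in> C" using * cv.representation_ne_zero by metis+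
      then show False by (simp add: C_def)
    qed
    then have "(\<Sum>b | cv.representation B x b \<noteq> 0. cv.representation B x b *\<^sub>C b) = 0" by simp
    moreover have "x \<in> cspan B" using x(1) CS spanS by auto
    ultimately show "x = 0" using cv.sum_nonzero_representation_eq[OF B(3)] by simp
  qed
  have inj: "inj_on g (cspan C)"
  proof (rule inj_onI)
    fix x y assume xy: "x \<in> cspan C" "y \<in> cspan C" "g x = g y"
    then have "g (x - y) = 0" by (simp add: cp.linear_diff[OF g(1)])
    with ker0[OF cv.span_diff[OF xy(1,2)]] show "x = y" by simp
  qed
  have ind: "cv.independent (g ` C)"
    by (rule cp.linear_independent_injective_image[OF g(1) indC inj])
  have im: "f ` S = cspan (g ` C)"
  proof -
    have "f ` S = g ` S" using g by auto
    also have "\<dots> = g ` cspan (B0 \<union> C)" using spanS B(1) by (simp add: C_def Un_absorb1)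
    also have "\<dots> = cspan (g ` (B0 \<union> C))" using cp.linear_span_image[OF g(1)] by metis
    also have "g ` (B0 \<union> C) = g ` B0 \<union> g ` C" by blast
    also have "cspan (g ` B0 \<union> g ` C) = cspan (g ` C)"
    proof -
      have "g b = 0" if "b \<in> B0" for b using that B0(2) K_def g(2) by auto
      then have "g ` B0 \<subseteq> cspan (g ` C)" using cv.span_zero by auto
      then have "g ` B0 \<union> g ` C \<subseteq> cspan (g ` C)" using cv.span_superset by blast
      then show ?thesis
        by (intro equalityI cv.span_minimal cv.span_mono cv.subspace_span) auto
    qed
    finally show ?thesis .
  qed
  then show "findim (f ` S)" unfolding findim_def using finB C_def by (metis cv.subspace_span finite_Diff finite_imageI order_refl)
  have "cdim (f ` S) = card (g ` C)" unfolding im by (rule cv.dim_span_eq_card_independent[OF ind])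
  also have "\<dots> = card C"
    using inj cv.span_superset inj_on_subset card_image by metis
  also have "\<dots> = card B - cdim K" using B0 B(1) C_def finB card_Diff_subset by metis
  finally show "cdim S = cdim {x \<in> S. f x = 0} + cdim (f ` S)"
    using B0(5) B(1) finB card_mono[of B B0] cv.dim_span_eq_card_independent[OF B(3)] spanS K_def
    by auto
qed

text \<open>A section lifts generators of the image; together with generators of the kernel they
  span \<open>S\<close>. This yields finite dimension of spaces that are not given inside a
  finite-dimensional one.\<close>

lemma findim_ker_im:
  assumes S: "csubspace S" and f: "lin S f" and K: "findim {x \<in> S. f x = 0}" and I: "findim (f ` S)"
  shows "findim S"
proof -
  obtain s where s: "lin (f ` S) s" "\<And>y. y \<in> f ` S \<Longrightarrow> s y \<in> S" "\<And>y. y \<in> f ` S \<Longrightarrow> f (s y) = y"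
    using lin_right_inverse[OF S f] by blast
  have subsI: "csubspace (f ` S)" by (rule findim_sub[OF I])
  have "findim (s ` f ` S)" by (rule rank_nullity(2)[OF I s(1)])
  then obtain B where B: "finite B" "s ` f ` S \<subseteq> cspan B" by (auto simp: findim_def)
  obtain D where D: "finite D" "{x \<in> S. f x = 0} \<subseteq> cspan D" using K by (auto simp: findim_def)
  have "x \<in> cspan (B \<union> D)" if "x \<in> S" for x
  proof -
    have sx: "s (f x) \<in> S" "f (s (f x)) = f x" using s that by auto
    then have "x - s (f x) \<in> cspan D"
      using that D(2) lin_diff[OF f S] csub_diff[OF S] by auto
    moreover have "s (f x) \<in> cspan B" using B that by auto
    ultimately have "s (f x) + (x - s (f x)) \<in> cspan (B \<union> D)"
      unfolding cv.span_Un by blast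
    then show ?thesis by simp
  qed
  then show ?thesis using S B D unfolding findim_def by blast
qed

lemma dim_zero_space [simp]: "findim {0}" "cdim {0} = 0"
proof -
  show "findim {0}" by (auto simp: findim_def intro!: exI[of _ "{}"])
  show "cdim {0} = 0" by (rule cv.dim_unique[of "{}"]) (auto simp: cv.independent_empty)
qed

lemma dim_bij:
  assumes S: "csubspace S" and f: "lin S f" and im: "f ` S = T" and inj: "\<And>x. x \<in> S \<Longrightarrow> f x = 0 \<Longrightarrow> x = 0"
  shows "findim S \<longleftrightarrow> findim T" "findim S \<Longrightarrow> cdim T = cdim S"
proof -
  have k: "{x \<in> S. f x = 0} = {0}" using inj lin_0[OF f S] csub_0[OF S] by auto
  show "findim S \<longleftrightarrow> findim T" using findim_ker_im[OF S f] rank_nullity(2)[OF _ f] k im by auto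
  show "cdim T = cdim S" if "findim S" using rank_nullity(3)[OF that f] k im by auto
qed

lemma dim_inverse:
  assumes S: "csubspace S" and T: "csubspace T" and f: "lin S f" and fS: "\<And>x. x \<in> S \<Longrightarrow> f x \<in> T"
    and gT: "\<And>y. y \<in> T \<Longrightarrow> g y \<in> S" and gf: "\<And>x. x \<in> S \<Longrightarrow> g (f x) = x" and fg: "\<And>y. y \<in> T \<Longrightarrow> f (g y) = y"
  shows "findim S \<longleftrightarrow> findim T" "findim S \<Longrightarrow> cdim T = cdim S"
proof -
  have im: "f ` S = T" using fS gT fg by force
  have "x = 0" if "x \<in> S" "f x = 0" for x
    using gf[OF that(1)] that(2) gf[OF csub_0[OF S]] lin_0[OF f S] by simp
  from dim_bij[OF S f im this] show "findim S \<longleftrightarrow> findim T" "findim S \<Longrightarrow> cdim T = cdim S" by auto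
qed

lemma dim_eq_0: "findim S \<Longrightarrow> cdim S = 0 \<Longrightarrow> S = {0}"
  by (metis card_0_eq cv.span_empty findim_basis)

lemma dim_eqD:
  assumes S: "findim S" and T: "csubspace T" "T \<subseteq> S" and d: "cdim T = cdim S"
  shows "T = S"
proof -
  obtain q where q: "lin UNIV q" "\<And>x. q x \<in> T" "\<And>x. x \<in> T \<Longrightarrow> q x = x"
    using lin_projection[OF T(1)] by blast
  have im: "q ` S = T" using q T(2) by force
  have "cdim {x \<in> S. q x = 0} = 0" using rank_nullity(3)[OF S lin_subset[OF q(1)]] im d by simp
  moreover have "findim {x \<in> S. q x = 0}" using rank_nullity(1)[OF S lin_subset[OF q(1)]] by simp
  ultimately have k: "{x \<in> S. q x = 0} = {0}" using dim_eq_0 by blast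
  have "x \<in> T" if "x \<in> S" for x
  proof -
    have "q (x - q x) = 0" using q by (simp add: lin_diff[OF q(1)])
    then have "x - q x = 0" using k that q(2) T(2) csub_diff[OF findim_sub[OF S]] by blast
    then show ?thesis using q(2)[of x] by simp
  qed
  then show ?thesis using T(2) by blast
qed

section \<open>Dimensions of products, function spaces and Hom\<close>

lemma csubspace_Times: "csubspace S \<Longrightarrow> csubspace T \<Longrightarrow> csubspace (S \<times> T)"
  by (rule csubspaceI) (auto simp: csub_0 csub_add csub_scale zero_prod_def cscale_prod_def)

lemma dim_Times:
  assumes S: "findim S" and T: "findim T"
  shows "findim (S \<times> T)" "cdim (S \<times> T) = cdim S + cdim T"
proof -
  note sub = csubspace_Times[OF findim_sub[OF S] findim_sub[OF T]]
  have l: "lin (S \<times> T) fst" by (rule linI) auto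
  have im: "fst ` (S \<times> T) = S" using csub_0[OF findim_sub[OF T]] by force
  have k: "{p \<in> S \<times> T. fst p = 0} = Pair 0 ` T" using csub_0[OF findim_sub[OF S]] by force
  have lp: "lin T (Pair 0 :: _ \<Rightarrow> 'a \<times> 'b)" by (rule linI) (auto simp: cscale_prod_def)
  have d: "findim {p \<in> S \<times> T. fst p = 0}" "cdim {p \<in> S \<times> T. fst p = 0} = cdim T"
    using dim_bij[OF findim_sub[OF T] lp k[symmetric]] T by (auto simp: zero_prod_def)
  show "findim (S \<times> T)" using findim_ker_im[OF sub l d(1)] im S by simp
  then show "cdim (S \<times> T) = cdim S + cdim T" using rank_nullity(3)[OF _ l] d im by simp
qed

text \<open>The direct product of the \<open>T k\<close>. Vanishing outside \<open>E\<close> makes a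
  family determined by its components.\<close>

definition fun_space :: "'k set \<Rightarrow> ('k \<Rightarrow> 'a::cvs set) \<Rightarrow> ('k \<Rightarrow> 'a) set" where
  "fun_space E T = {v. (\<forall>k\<in>E. v k \<in> T k) \<and> (\<forall>k. k \<notin> E \<longrightarrow> v k = 0)}"

lemma csubspace_fun_space: "(\<And>k. k \<in> E \<Longrightarrow> csubspace (T k)) \<Longrightarrow> csubspace (fun_space E T)"
  by (rule csubspaceI) (auto simp: fun_space_def csub_0 csub_add csub_scale)

lemma dim_fun_space:
  assumes "finite E" "\<And>k. k \<in> E \<Longrightarrow> findim (T k)"
  shows "findim (fun_space E T) \<and> cdim (fun_space E T) = (\<Sum>k\<in>E. cdim (T k))"
  using assms
proof (induction E)
  case empty
  have "fun_space {} T = {0}" by (auto simp: fun_space_def fun_eq_iff)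
  then show ?case by simp
next
  case (insert a E)
  then have IH: "findim (fun_space E T)" "cdim (fun_space E T) = (\<Sum>k\<in>E. cdim (T k))" by auto
  have fdT: "findim (T k)" if "k \<in> insert a E" for k using insert that by blast
  have sub: "csubspace (fun_space (insert a E) T)" using fdT findim_sub by (intro csubspace_fun_space) blast
  have l: "lin (fun_space (insert a E) T) (\<lambda>v. v a)" by (rule linI) auto
  have k: "{v \<in> fun_space (insert a E) T. v a = 0} = fun_space E T"
  proof (intro equalityI subsetI)
    show "v \<in> fun_space E T" if "v \<in> {v \<in> fun_space (insert a E) T. v a = 0}" for v
      using that by (simp add: fun_space_def) (metis insert_iff)
    show "v \<in> {v \<in> fun_space (insert a E) T. v a = 0}" if "v \<in> fun_space E T" for v
      using that \<open>a \<notin> E\<close> csub_0[OF findim_sub[OF fdT]] by (auto simp: fun_space_def)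
  qed
  have "x \<in> (\<lambda>v. v a) ` fun_space (insert a E) T" if "x \<in> T a" for x
  proof (rule image_eqI[of _ _ "(\<lambda>k. 0)(a := x)"])
    show "(\<lambda>k. 0)(a := x) \<in> fun_space (insert a E) T"
      using that csub_0[OF findim_sub[OF fdT]] \<open>a \<notin> E\<close> by (auto simp: fun_space_def)
  qed simp
  then have im: "(\<lambda>v. v a) ` fun_space (insert a E) T = T a" by (auto simp: fun_space_def)
  have fdS: "findim (fun_space (insert a E) T)" using findim_ker_im[OF sub l] k im IH fdT by simp
  with rank_nullity(3)[OF this l] k im IH insert show ?case by simp
qed

text \<open>Extension by zero off \<open>S\<close> makes equality in \<open>Hom S T\<close> equality
  on \<open>S\<close>; arbitrary values outside would spoil the dimension.\<close>

definition Hom :: "'a::cvs set \<Rightarrow> 'b::cvs set \<Rightarrow> ('a \<Rightarrow> 'b) set" where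
  "Hom S T = {f. lin S f \<and> (\<forall>x\<in>S. f x \<in> T) \<and> (\<forall>x. x \<notin> S \<longrightarrow> f x = 0)}"

lemma HomD: "f \<in> Hom S T \<Longrightarrow> lin S f" "f \<in> Hom S T \<Longrightarrow> x \<in> S \<Longrightarrow> f x \<in> T"
    "f \<in> Hom S T \<Longrightarrow> x \<notin> S \<Longrightarrow> f x = 0"
  by (auto simp: Hom_def)

lemma Hom_restrict:
  assumes "csubspace S" "lin S f" "\<And>x. x \<in> S \<Longrightarrow> f x \<in> T"
  shows "(\<lambda>x. if x \<in> S then f x else 0) \<in> Hom S T"
  using assms lin_cong[OF assms(2,1)] by (auto simp: Hom_def)

lemma Hom_eqI:
  assumes "f \<in> Hom S T" "g \<in> Hom S T" "\<And>x. x \<in> S \<Longrightarrow> f x = g x"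
  shows "f = g"
proof
  show "f x = g x" for x
    using assms(3) HomD(3)[OF assms(1)] HomD(3)[OF assms(2)] by (cases "x \<in> S") simp_all
qed

lemma csubspace_Hom: "csubspace T \<Longrightarrow> csubspace (Hom S T)"
  by (rule csubspaceI)
    (auto simp: Hom_def csub_0 csub_add csub_scale lin_def cscale_add_right cscale_cscale mult.commute)

text \<open>Restriction to a basis of \<open>S\<close> is an isomorphism onto the functions from
  that basis to \<open>T\<close>.\<close>

lemma dim_Hom:
  assumes S: "findim S" and T: "findim T"
  shows "findim (Hom S T) \<and> cdim (Hom S T) = cdim S * cdim T"
proof -
  obtain B where B: "finite B" "B \<subseteq> S" "cv.independent B" "cspan B = S" "card B = cdim S"
    by (rule findim_basis[OF S])
  note subs = findim_sub[OF S] findim_sub[OF T]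
  define r where "r = (\<lambda>f::'a \<Rightarrow> 'b. \<lambda>b. if b \<in> B then f b else 0)"
  have l: "lin (Hom S T) r" by (rule linI) (auto simp: r_def fun_eq_iff)
  have inj: "f = 0" if "f \<in> Hom S T" "r f = 0" for f
  proof (rule Hom_eqI[OF that(1)])
    show "0 \<in> Hom S T" using subs csub_0 csubspace_Hom by blast
    have "B \<subseteq> {x \<in> S. f x = 0}" using that(2) B(2) by (auto simp: r_def fun_eq_iff) (metis)
    then have "cspan B \<subseteq> {x \<in> S. f x = 0}"
      using csubspace_kernel[OF subs(1) HomD(1)[OF that(1)]] by (intro cv.span_minimal)
    then show "f x = 0 x" if "x \<in> S" for x using that B(4) by auto
  qed
  have im: "r ` Hom S T = fun_space B (\<lambda>b. T)"
  proof (intro equalityI subsetI)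
    show "v \<in> fun_space B (\<lambda>b. T)" if "v \<in> r ` Hom S T" for v
      using that B(2) HomD(2) by (force simp: r_def fun_space_def)
    show "v \<in> r ` Hom S T" if v: "v \<in> fun_space B (\<lambda>b. T)" for v
    proof -
      define g where "g = cp.construct B v"
      have lg: "Vector_Spaces.linear (*\<^sub>C) (*\<^sub>C) g"
        unfolding g_def by (rule cp.linear_construct[OF B(3)])
      have gb: "g b = v b" if "b \<in> B" for b using that B(3) by (simp add: g_def cp.construct_basis)
      have "g ` S = cspan (g ` B)" using cp.linear_span_image[OF lg, of B] B(4) by simp
      also have "\<dots> \<subseteq> T" using gb v subs by (intro cv.span_minimal) (auto simp: fun_space_def)
      finally have gT: "g ` S \<subseteq> T" .
      have "(\<lambda>x. if x \<in> S then g x else 0) \<in> Hom S T"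
        using gT by (intro Hom_restrict) (auto intro: subs linear_lin lg)
      moreover have "r (\<lambda>x. if x \<in> S then g x else 0) = v"
        using B(2) gb v by (auto simp: r_def fun_eq_iff fun_space_def)
      ultimately show ?thesis by (metis imageI)
    qed
  qed
  have p: "findim (fun_space B (\<lambda>b. T))" "cdim (fun_space B (\<lambda>b. T)) = cdim S * cdim T"
    using dim_fun_space[OF B(1), of "\<lambda>b. T"] T B(5) by auto
  show ?thesis using dim_bij[OF csubspace_Hom[OF subs(2)] l im inj] p by auto
qed

section \<open>Commutants\<close>

definition endo :: "'a::cvs set \<Rightarrow> ('a \<Rightarrow> 'a) \<Rightarrow> bool" where
  "endo S T \<longleftrightarrow> lin S T \<and> (\<forall>x\<in>S. T x \<in> S)"

definition comm0 :: "'a::cvs set \<Rightarrow> ('a \<Rightarrow> 'a) \<Rightarrow> ('a \<Rightarrow> 'a) set" where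
  "comm0 S T = {C \<in> Hom S S. \<forall>x\<in>S. C (T x) = T (C x)}"

text \<open>The two coefficients of the equation saying that C1 + \<epsilon> C0 commutes with A1 +
  \<epsilon> A0 modulo \<epsilon>^2.\<close>

definition comm1 :: "'a::cvs set \<Rightarrow> ('a \<Rightarrow> 'a) \<Rightarrow> ('a \<Rightarrow> 'a) \<Rightarrow> (('a \<Rightarrow> 'a) \<times> ('a \<Rightarrow> 'a)) set" where
  "comm1 S A1 A0 = {(C1, C0). C1 \<in> Hom S S \<and> C0 \<in> Hom S S \<and>
     (\<forall>x\<in>S. C1 (A1 x) = A1 (C1 x) \<and> A0 (C1 x) + A1 (C0 x) = C0 (A1 x) + C1 (A0 x))}"

lemma endoD: "endo S T \<Longrightarrow> lin S T" "endo S T \<Longrightarrow> x \<in> S \<Longrightarrow> T x \<in> S"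
  by (auto simp: endo_def)

lemma csubspace_comm0:
  assumes S: "csubspace S" and T: "endo S T"
  shows "csubspace (comm0 S T)"
proof (rule csubspaceI)
  note H = csubspace_Hom[OF S, of S]
  show "0 \<in> comm0 S T" using csub_0[OF H] lin_0[OF endoD(1)[OF T] S] by (simp add: comm0_def)
  show "f + g \<in> comm0 S T" if "f \<in> comm0 S T" "g \<in> comm0 S T" for f g
    using that csub_add[OF H] HomD(2)[where S=S and T=S] lin_add[OF endoD(1)[OF T]] by (simp add: comm0_def)
  show "c *\<^sub>C f \<in> comm0 S T" if "f \<in> comm0 S T" for f c
    using that csub_scale[OF H] HomD(2)[where S=S and T=S] lin_scale[OF endoD(1)[OF T]] by (simp add: comm0_def)
qed

lemma csubspace_comm1:
  assumes S: "csubspace S" and A: "endo S A1" "endo S A0"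
  shows "csubspace (comm1 S A1 A0)"
proof (rule csubspaceI)
  note H = csubspace_Hom[OF S, of S] and h = HomD(2)[where S=S and T=S]
  note l = lin_0[OF endoD(1)[OF A(1)] S] lin_0[OF endoD(1)[OF A(2)] S]
    lin_add[OF endoD(1)[OF A(1)]] lin_add[OF endoD(1)[OF A(2)]]
    lin_scale[OF endoD(1)[OF A(1)]] lin_scale[OF endoD(1)[OF A(2)]]
  show "0 \<in> comm1 S A1 A0" using csub_0[OF H] l by (simp add: comm1_def zero_prod_def)
  show "f + g \<in> comm1 S A1 A0" if fg: "f \<in> comm1 S A1 A0" "g \<in> comm1 S A1 A0" for f g
  proof -
    obtain f1 f0 g1 g0 where [simp]: "f = (f1, f0)" "g = (g1, g0)" by (metis prod.collapse)
    have "A0 (f1 x + g1 x) + A1 (f0 x + g0 x) = f0 (A1 x) + g0 (A1 x) + (f1 (A0 x) + g1 (A0 x))" if "x \<in> S" for x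
    proof -
      have "A0 (f1 x + g1 x) + A1 (f0 x + g0 x) = (A0 (f1 x) + A1 (f0 x)) + (A0 (g1 x) + A1 (g0 x))"
        using fg that h l by (simp add: comm1_def algebra_simps)
      also have "\<dots> = (f0 (A1 x) + f1 (A0 x)) + (g0 (A1 x) + g1 (A0 x))"
        using fg that by (simp add: comm1_def)
      finally show ?thesis by (simp add: algebra_simps)
    qed
    then show ?thesis using fg csub_add[OF H] h l by (simp add: comm1_def)
  qed
  show "c *\<^sub>C f \<in> comm1 S A1 A0" if f: "f \<in> comm1 S A1 A0" for f c
  proof -
    obtain f1 f0 where [simp]: "f = (f1, f0)" by (metis prod.collapse)
    have "A0 (c *\<^sub>C f1 x) + A1 (c *\<^sub>C f0 x) = c *\<^sub>C f0 (A1 x) + c *\<^sub>C f1 (A0 x)" if "x \<in> S" for x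
    proof -
      have "A0 (c *\<^sub>C f1 x) + A1 (c *\<^sub>C f0 x) = c *\<^sub>C (A0 (f1 x) + A1 (f0 x))"
      proof -
        have "f1 x \<in> S" "f0 x \<in> S" using f that h by (auto simp: comm1_def)
        then show ?thesis using l by (simp add: cscale_add_right)
      qed
      also have "A0 (f1 x) + A1 (f0 x) = f0 (A1 x) + f1 (A0 x)" using f that by (simp add: comm1_def)
      finally show ?thesis by (simp add: cscale_add_right)
    qed
    then show ?thesis using f csub_scale[OF H] h l by (simp add: comm1_def cscale_prod_def)
  qed
qed

lemma findim_comm0:
  assumes "findim S" "endo S T"
  shows "findim (comm0 S T)"
  by (rule findim_subset[OF conjunct1[OF dim_Hom[OF assms(1) assms(1)]] csubspace_comm0[OF findim_sub[OF assms(1)] assms(2)]])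
    (auto simp: comm0_def)

lemma findim_comm1:
  assumes "findim S" "endo S A1" "endo S A0"
  shows "findim (comm1 S A1 A0)"
proof -
  note H = conjunct1[OF dim_Hom[OF assms(1) assms(1)]]
  show ?thesis
    by (rule findim_subset[OF dim_Times(1)[OF H H] csubspace_comm1[OF findim_sub[OF assms(1)] assms(2,3)]])
      (auto simp: comm1_def)
qed

lemma endo_shift: "csubspace S \<Longrightarrow> endo S T \<Longrightarrow> endo S (\<lambda>x. T x + c *\<^sub>C x)"
  by (auto simp: endo_def csub_add csub_scale intro!: lin_plus lin_cscale lin_id)

section \<open>Invariance of commutants under isomorphisms and scalar shifts\<close>

locale lin_iso =
  fixes S :: "'a::cvs set" and S' :: "'b::cvs set" and \<eta> \<zeta>
  assumes S: "csubspace S" and S': "csubspace S'"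
    and \<eta>: "lin S \<eta>" and \<eta>_in: "\<And>x. x \<in> S \<Longrightarrow> \<eta> x \<in> S'"
    and \<zeta>: "lin S' \<zeta>" and \<zeta>_in: "\<And>y. y \<in> S' \<Longrightarrow> \<zeta> y \<in> S"
    and \<zeta>\<eta>: "\<And>x. x \<in> S \<Longrightarrow> \<zeta> (\<eta> x) = x" and \<eta>\<zeta>: "\<And>y. y \<in> S' \<Longrightarrow> \<eta> (\<zeta> y) = y"
begin

definition cj :: "('a \<Rightarrow> 'a) \<Rightarrow> 'b \<Rightarrow> 'b" where
  "cj C = (\<lambda>y. if y \<in> S' then \<eta> (C (\<zeta> y)) else 0)"

lemma cj_apply: "y \<in> S' \<Longrightarrow> cj C y = \<eta> (C (\<zeta> y))"
  by (simp add: cj_def)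

lemma cj_Hom: "C \<in> Hom S S \<Longrightarrow> cj C \<in> Hom S' S'"
  unfolding cj_def using S' \<eta> \<eta>_in \<zeta> \<zeta>_in HomD[of C S S]
  by (intro Hom_restrict lin_comp[of S' _ S \<eta>] lin_comp[of S' \<zeta> S C]) auto

lemma lin_cj: "lin (Hom S S) cj"
  using \<eta> \<zeta>_in HomD(2)[of _ S S] by (intro linI) (auto simp: cj_def fun_eq_iff lin_add lin_scale)

end

lemma lin_iso_sym: "lin_iso S S' \<eta> \<zeta> \<Longrightarrow> lin_iso S' S \<zeta> \<eta>"
  by (simp add: lin_iso_def)

lemma (in lin_iso) cj_cj: "C \<in> Hom S S \<Longrightarrow> lin_iso.cj S \<zeta> \<eta> (cj C) = C"
proof -
  assume C: "C \<in> Hom S S"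
  interpret r: lin_iso S' S \<zeta> \<eta> by (rule lin_iso_sym) (rule lin_iso_axioms)
  show ?thesis
    by (rule Hom_eqI[OF r.cj_Hom[OF cj_Hom[OF C]] C])
      (use C \<eta>_in \<zeta>\<eta> HomD(2)[of C S S] in \<open>simp add: r.cj_apply cj_apply\<close>)
qed

lemma lin_isoI:
  assumes S: "csubspace S" and f: "lin S \<eta>" and im: "\<eta> ` S = S'" and inj: "\<And>x. x \<in> S \<Longrightarrow> \<eta> x = 0 \<Longrightarrow> x = 0"
  obtains \<zeta> where "lin_iso S S' \<eta> \<zeta>"
proof -
  obtain \<zeta> where s: "lin (\<eta> ` S) \<zeta>" "\<And>y. y \<in> \<eta> ` S \<Longrightarrow> \<zeta> y \<in> S" "\<And>y. y \<in> \<eta> ` S \<Longrightarrow> \<eta> (\<zeta> y) = y"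
    by (rule lin_right_inverse[OF S f]) blast
  have "\<zeta> (\<eta> x) = x" if "x \<in> S" for x
    using inj[of "\<zeta> (\<eta> x) - x"] that s csub_diff[OF S] lin_diff[OF f S] by simp
  then have "lin_iso S S' \<eta> \<zeta>"
    using s S csubspace_image[OF S f] im f unfolding lin_iso_def by blast
  then show ?thesis by (rule that)
qed

text \<open>Scalars commute with every \<open>C\<close>, so it is enough that \<open>\<eta>\<close>
  intertwines the operators up to the scalar \<open>c\<close>.\<close>

lemma (in lin_iso) cj_comm0:
  assumes T: "endo S T" and T': "\<And>x. x \<in> S \<Longrightarrow> T' (\<eta> x) = \<eta> (T x + c *\<^sub>C x)"
    and C: "C \<in> comm0 S T"
  shows "cj C \<in> comm0 S' T'"
  unfolding comm0_def mem_Collect_eq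
proof (intro conjI ballI)
  have CH: "C \<in> Hom S S" using C by (simp add: comm0_def)
  show "cj C \<in> Hom S' S'" by (rule cj_Hom[OF CH])
  fix y assume y: "y \<in> S'"
  define x where "x = \<zeta> y"
  have x: "x \<in> S" "y = \<eta> x" using y \<zeta>_in \<eta>\<zeta> by (auto simp: x_def)
  have Tx: "T x \<in> S" "c *\<^sub>C x \<in> S" "T x + c *\<^sub>C x \<in> S" "C x \<in> S"
    using x T S HomD(2)[OF CH] by (auto simp: endo_def csub_add csub_scale)
  have "cj C (T' y) = \<eta> (C (T x + c *\<^sub>C x))"
    using x Tx T' \<eta>_in by (simp add: cj_apply \<zeta>\<eta>)
  also have "C (T x + c *\<^sub>C x) = T (C x) + c *\<^sub>C C x"
    using C x Tx lin_add[OF HomD(1)[OF CH]] lin_scale[OF HomD(1)[OF CH]] by (simp add: comm0_def)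
  also have "\<eta> \<dots> = T' (cj C y)" using x Tx T' \<eta>_in by (simp add: cj_apply \<zeta>\<eta>)
  finally show "cj C (T' y) = T' (cj C y)" .
qed

text \<open>The same with the central element c \<epsilon>: only the coefficient \<open>A0\<close>
  is shifted.\<close>

lemma (in lin_iso) cj_comm1:
  assumes A: "endo S A1" "endo S A0" and B1: "\<And>x. x \<in> S \<Longrightarrow> B1 (\<eta> x) = \<eta> (A1 x)"
    and B0: "\<And>x. x \<in> S \<Longrightarrow> B0 (\<eta> x) = \<eta> (A0 x + c *\<^sub>C x)"
    and C: "(C1, C0) \<in> comm1 S A1 A0"
  shows "(cj C1, cj C0) \<in> comm1 S' B1 B0"
  unfolding comm1_def mem_Collect_eq prod.case
proof (intro conjI ballI)
  have CH: "C1 \<in> Hom S S" "C0 \<in> Hom S S" using C by (auto simp: comm1_def)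
  show "cj C1 \<in> Hom S' S'" "cj C0 \<in> Hom S' S'" using cj_Hom CH by auto
  fix y assume y: "y \<in> S'"
  define x where "x = \<zeta> y"
  have x: "x \<in> S" "y = \<eta> x" using y \<zeta>_in \<eta>\<zeta> by (auto simp: x_def)
  have i: "A1 x \<in> S" "A0 x \<in> S" "c *\<^sub>C x \<in> S" "A0 x + c *\<^sub>C x \<in> S" "C1 x \<in> S" "C0 x \<in> S"
    "A1 (C0 x) \<in> S" "A0 (C1 x) \<in> S" "C0 (A1 x) \<in> S" "C1 (A0 x) \<in> S" "c *\<^sub>C C1 x \<in> S"
    using x A S HomD(2)[OF CH(1)] HomD(2)[OF CH(2)] by (auto simp: endo_def csub_add csub_scale)
  have e: "C1 (A1 x) = A1 (C1 x)" "A0 (C1 x) + A1 (C0 x) = C0 (A1 x) + C1 (A0 x)"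
    using C x by (auto simp: comm1_def)
  show "cj C1 (B1 y) = B1 (cj C1 y)"
    using x i B1 \<eta>_in e by (simp add: cj_apply \<zeta>\<eta>)
  have "B0 (cj C1 y) + B1 (cj C0 y) = \<eta> ((A0 (C1 x) + A1 (C0 x)) + c *\<^sub>C C1 x)"
    using x i B1 B0 \<eta>_in lin_add[OF \<eta>] csub_add[OF S] by (simp add: cj_apply \<zeta>\<eta> algebra_simps)
  also have "\<dots> = \<eta> (C0 (A1 x) + (C1 (A0 x) + C1 (c *\<^sub>C x)))"
    using e x i lin_scale[OF HomD(1)[OF CH(1)]] by (simp add: add.assoc)
  also have "\<dots> = \<eta> (C0 (A1 x) + C1 (A0 x + c *\<^sub>C x))"
    using x i lin_add[OF HomD(1)[OF CH(1)]] by simp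
  also have "\<dots> = cj C0 (B1 y) + cj C1 (B0 y)"
  proof -
    have "cj C0 (B1 y) = \<eta> (C0 (A1 x))" "cj C1 (B0 y) = \<eta> (C1 (A0 x + c *\<^sub>C x))"
      using x i B1 B0 \<eta>_in by (simp_all add: cj_apply \<zeta>\<eta>)
    then show ?thesis using lin_add[OF \<eta>] i HomD(2)[OF CH(1)] by simp
  qed
  finally show "B0 (cj C1 y) + B1 (cj C0 y) = cj C0 (B1 y) + cj C1 (B0 y)" .
qed

text \<open>The inverse intertwines up to \<open>- c\<close>, so conjugation back by
  \<open>\<zeta>\<close> is another instance of the same lemmas.\<close>

lemma (in lin_iso) inverse_shift:
  assumes T: "endo S T" and T': "\<And>x. x \<in> S \<Longrightarrow> T' (\<eta> x) = \<eta> (T x + c *\<^sub>C x)" and y: "y \<in> S'"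
  shows "T (\<zeta> y) = \<zeta> (T' y + (- c) *\<^sub>C y)"
proof -
  have z: "\<zeta> y \<in> S" "T (\<zeta> y) \<in> S" "c *\<^sub>C \<zeta> y \<in> S" using y \<zeta>_in T S by (auto simp: endo_def csub_scale)
  have "T' y + (- c) *\<^sub>C y = \<eta> (T (\<zeta> y) + c *\<^sub>C \<zeta> y) - c *\<^sub>C \<eta> (\<zeta> y)"
    using T'[OF z(1)] \<eta>\<zeta>[OF y] by simp
  also have "\<dots> = \<eta> (T (\<zeta> y))"
    using z lin_add[OF \<eta>] lin_scale[OF \<eta>] by simp
  finally show ?thesis using z \<zeta>\<eta> by simp
qed

lemma (in lin_iso) endo_transport:
  assumes T: "endo S T" and T': "\<And>x. x \<in> S \<Longrightarrow> T' (\<eta> x) = \<eta> (T x + c *\<^sub>C x)"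
  shows "endo S' T'"
proof -
  have e: "T' y = \<eta> (T (\<zeta> y) + c *\<^sub>C \<zeta> y)" if "y \<in> S'" for y using T'[OF \<zeta>_in[OF that]] \<eta>\<zeta>[OF that] by simp
  have sh: "endo S (\<lambda>x. T x + c *\<^sub>C x)" by (rule endo_shift[OF S T])
  have "lin S' (\<lambda>y. \<eta> ((\<lambda>x. T x + c *\<^sub>C x) (\<zeta> y)))"
    using \<zeta> \<zeta>_in endoD[OF sh] \<eta>
    by (intro lin_comp[of S' _ S \<eta>] lin_comp[of S' \<zeta> S "\<lambda>x. T x + c *\<^sub>C x"]) auto
  from lin_cong[OF this S', of T'] e show ?thesis
    using endoD(2)[OF sh] \<eta>_in \<zeta>_in by (auto simp: endo_def)
qed

lemma (in lin_iso) dim_comm0: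
  assumes fdS: "findim S" and T: "endo S T" and T': "\<And>x. x \<in> S \<Longrightarrow> T' (\<eta> x) = \<eta> (T x + c *\<^sub>C x)"
  shows "cdim (comm0 S' T') = cdim (comm0 S T)"
proof -
  interpret r: lin_iso S' S \<zeta> \<eta> by (rule lin_iso_sym) (rule lin_iso_axioms)
  note e' = endo_transport[OF T T']
  show ?thesis
  proof (rule dim_inverse(2)[of _ _ cj r.cj])
    show "lin (comm0 S T) cj" by (rule lin_subset[OF lin_cj]) (auto simp: comm0_def)
    show "cj C \<in> comm0 S' T'" if "C \<in> comm0 S T" for C by (rule cj_comm0[OF T T' that])
    show "r.cj C \<in> comm0 S T" if "C \<in> comm0 S' T'" for C
      by (rule r.cj_comm0[OF e' inverse_shift[OF T T'] that])
  qed (use cj_cj r.cj_cj csubspace_comm0[OF S T] csubspace_comm0[OF S' e'] findim_comm0[OF fdS T] in \<open>auto simp: comm0_def\<close>)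
qed

lemma (in lin_iso) dim_comm1:
  assumes fdS: "findim S" and A: "endo S A1" "endo S A0" and B1: "\<And>x. x \<in> S \<Longrightarrow> B1 (\<eta> x) = \<eta> (A1 x)"
    and B0: "\<And>x. x \<in> S \<Longrightarrow> B0 (\<eta> x) = \<eta> (A0 x + c *\<^sub>C x)"
  shows "cdim (comm1 S' B1 B0) = cdim (comm1 S A1 A0)"
proof -
  interpret r: lin_iso S' S \<zeta> \<eta> by (rule lin_iso_sym) (rule lin_iso_axioms)
  have B1': "B1 (\<eta> x) = \<eta> (A1 x + 0 *\<^sub>C x)" if "x \<in> S" for x using B1[OF that] by simp
  note e1 = endo_transport[OF A(1) B1'] and e0 = endo_transport[OF A(2) B0]
  have i1: "A1 (\<zeta> y) = \<zeta> (B1 y)" if "y \<in> S'" for y using inverse_shift[OF A(1) B1' that] by simp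
  have l: "lin (comm1 S A1 A0) (\<lambda>p. (cj (fst p), cj (snd p)))"
  proof (rule linI)
    fix p q c assume p: "p \<in> comm1 S A1 A0"
    show "(cj (fst (c *\<^sub>C p)), cj (snd (c *\<^sub>C p))) = c *\<^sub>C (cj (fst p), cj (snd p))"
      using p lin_scale[OF lin_cj] by (auto simp: cscale_prod_def comm1_def)
    assume "q \<in> comm1 S A1 A0"
    then show "(cj (fst (p + q)), cj (snd (p + q))) = (cj (fst p), cj (snd p)) + (cj (fst q), cj (snd q))"
      using p lin_add[OF lin_cj] by (auto simp: comm1_def)
  qed
  show ?thesis
  proof (rule dim_inverse(2)[OF csubspace_comm1[OF S A] csubspace_comm1[OF S' e1 e0] l _ _ _ _ findim_comm1[OF fdS A],
        of "\<lambda>p. (r.cj (fst p), r.cj (snd p))"])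
    show "(cj (fst p), cj (snd p)) \<in> comm1 S' B1 B0" if "p \<in> comm1 S A1 A0" for p
      using cj_comm1[OF A B1 B0, of "fst p" "snd p"] that by simp
    show "(r.cj (fst p), r.cj (snd p)) \<in> comm1 S A1 A0" if "p \<in> comm1 S' B1 B0" for p
      using r.cj_comm1[OF e1 e0 i1 inverse_shift[OF A(2) B0], of "fst p" "snd p"] that by simp
  qed (use cj_cj r.cj_cj in \<open>auto simp: comm1_def\<close>)
qed

text \<open>Restriction to the image of \<open>T\<close> is surjective; its kernel consists of the maps from the
  cokernel to the kernel of \<open>T\<close>.\<close>

lemma dim_comm0_image:
  assumes S: "findim S" and T: "endo S T"
  shows "cdim (comm0 S T) = cdim (comm0 (T ` S) T) + (cdim S - cdim (T ` S))\<^sup>2"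
proof -
  define I where "I = T ` S"
  define K where "K = {x \<in> S. T x = 0}"
  note sub = findim_sub[OF S] and lT = endoD(1)[OF T]
  have IS: "I \<subseteq> S" using T by (auto simp: I_def endo_def)
  have subI: "csubspace I" unfolding I_def by (rule csubspace_image[OF sub lT])
  have TI: "endo I T" using IS lin_subset[OF lT] by (auto simp: endo_def I_def)
  obtain q where q: "lin UNIV q" "\<And>x. q x \<in> I" "\<And>x. x \<in> I \<Longrightarrow> q x = x"
    by (rule lin_projection[OF subI]) blast
  obtain s where s: "lin I s" "\<And>y. y \<in> I \<Longrightarrow> s y \<in> S" "\<And>y. y \<in> I \<Longrightarrow> T (s y) = y"
    unfolding I_def by (rule lin_right_inverse[OF sub lT]) blast
  \<comment> \<open>A complement of \<open>I\<close> in \<open>S\<close>, standing in for the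
    cokernel of \<open>T\<close>.\<close>
  define J where "J = {x \<in> S. q x = 0}"
  have fdJ: "findim J" unfolding J_def by (rule rank_nullity(1)[OF S lin_subset[OF q(1)]]) simp
  have fdK: "findim K" unfolding K_def by (rule rank_nullity(1)[OF S lT])
  have qS: "q ` S = I" using q IS by force
  have dJ: "cdim J = cdim S - cdim I"
    using rank_nullity(3)[OF S lin_subset[OF q(1)]] qS by (simp add: J_def)
  have dK: "cdim K = cdim S - cdim I"
    using rank_nullity(3)[OF S lT] by (simp add: K_def I_def)
  define r where "r = (\<lambda>C::'a \<Rightarrow> 'a. \<lambda>x. if x \<in> I then C x else 0)"
  have lr: "lin X r" for X by (rule linI) (auto simp: r_def fun_eq_iff)
  have im: "r ` comm0 S T = comm0 I T"
  proof (intro equalityI subsetI)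
    fix D assume "D \<in> r ` comm0 S T"
    then obtain C where C: "C \<in> comm0 S T" "D = r C" by blast
    have CH: "C \<in> Hom S S" and Cc: "\<And>x. x \<in> S \<Longrightarrow> C (T x) = T (C x)" using C by (auto simp: comm0_def)
    have CI: "C x \<in> I" if "x \<in> I" for x using that Cc HomD(2)[OF CH] by (auto simp: I_def)
    have "D \<in> Hom I I" unfolding C(2) r_def
      by (intro Hom_restrict subI lin_subset[OF HomD(1)[OF CH] IS] CI)
    then show "D \<in> comm0 I T" using Cc IS endoD(2)[OF TI] by (auto simp: comm0_def C(2) r_def)
  next
    fix Y assume Y: "Y \<in> comm0 I T"
    then have YH: "Y \<in> Hom I I" and Yc: "\<And>x. x \<in> I \<Longrightarrow> Y (T x) = T (Y x)" by (auto simp: comm0_def)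
    note lY = HomD(1)[OF YH] and YI = HomD(2)[OF YH]
    \<comment> \<open>Commuting with \<open>T\<close> requires T X = Y T, as \<open>X\<close> must
      agree with \<open>Y\<close> on \<open>I\<close>. On the complement of \<open>I\<close> this
      prescribes T (X x), and the section \<open>s\<close> of \<open>T\<close> selects a
      value.\<close>
    define X where "X = (\<lambda>x. Y (q x) + s (Y (T (x - q x))))"
    have xq: "x - q x \<in> S" if "x \<in> S" for x using that q(2) IS csub_diff[OF sub] by blast
    have Txq: "T (x - q x) \<in> I" if "x \<in> S" for x using xq[OF that] by (simp add: I_def)
    have XS: "X x \<in> S" if "x \<in> S" for x
      unfolding X_def using Txq[OF that] YI q(2) IS s(2) by (intro csub_add[OF sub]) blast+
    have l1: "lin S (\<lambda>x. T (x - q x))"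
      using xq by (intro lin_comp[of S "\<lambda>x. x - q x" S T] lin_minus lin_id lin_subset[OF q(1)] lT) auto
    have lX: "lin S X" unfolding X_def
      using q(2) Txq YI s(1)
      by (intro lin_plus lin_comp[of S q I Y] lin_subset[OF q(1)] lY
          lin_comp[of S "\<lambda>x. Y (T (x - q x))" I s] lin_comp[of S "\<lambda>x. T (x - q x)" I Y] l1) auto
    have XI: "X x = Y x" if "x \<in> I" for x
      using that q(3) lin_0[OF lT sub] lin_0[OF lY subI] lin_0[OF s(1) subI] by (simp add: X_def)
    have TX: "X (T x) = T (X x)" if x: "x \<in> S" for x
    proof -
      have Tx: "T x \<in> I" "T (q x) \<in> I" using x q(2) IS by (auto simp: I_def)
      have "T (X x) = T (Y (q x)) + T (s (Y (T (x - q x))))"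
        unfolding X_def using Txq[OF x] YI q(2) IS s(2) by (intro lin_add[OF lT]) blast+
      also have "\<dots> = Y (T (q x)) + Y (T (x - q x))"
        using Yc[OF q(2)] s(3) YI Txq[OF x] by simp
      also have "\<dots> = Y (T (q x) + T (x - q x))"
        using lin_add[OF lY] Tx Txq[OF x] by simp
      also have "T (q x) + T (x - q x) = T x"
        using lin_diff[OF lT sub] x q(2) IS by (simp add: subset_iff)
      finally show ?thesis using XI[OF Tx(1)] by simp
    qed
    define C where "C = (\<lambda>x. if x \<in> S then X x else 0)"
    have "C \<in> Hom S S" unfolding C_def by (intro Hom_restrict sub lX XS)
    then have "C \<in> comm0 S T" using TX endoD(2)[OF T] by (auto simp: comm0_def C_def)
    moreover have "r C = Y" using XI IS HomD(3)[OF YH] by (auto simp: r_def C_def fun_eq_iff)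
    ultimately show "Y \<in> r ` comm0 S T" by blast
  qed
  define Z where "Z = {C \<in> comm0 S T. r C = 0}"
  have subZ: "csubspace Z" unfolding Z_def by (rule csubspace_kernel[OF csubspace_comm0[OF sub T] lr])
  have ZI: "C x = 0" if "C \<in> Z" "x \<in> I" for C x
    using that by (auto simp: Z_def r_def fun_eq_iff) metis
  have "cdim Z = cdim (Hom J K)"
  proof (rule dim_inverse(2)[of "Hom J K" Z "\<lambda>D x. if x \<in> S then D (x - q x) else 0"
        "\<lambda>C x. if x \<in> J then C x else 0"])
    show "csubspace (Hom J K)" by (rule csubspace_Hom[OF findim_sub[OF fdK]])
    show "findim (Hom J K)" using dim_Hom[OF fdJ fdK] by simp
    have jJ: "x - q x \<in> J" if "x \<in> S" for x
    proof -
      have "q x \<in> S" using q(2) IS by blast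
      then show ?thesis
        using that q csub_diff[OF sub] lin_diff[OF q(1), of x "q x"] by (simp add: J_def)
    qed
    show "lin (Hom J K) (\<lambda>D x. if x \<in> S then D (x - q x) else 0)"
      by (rule linI) (auto simp: fun_eq_iff)
    show "(\<lambda>x. if x \<in> S then D (x - q x) else 0) \<in> Z" if D: "D \<in> Hom J K" for D
    proof -
      have lD: "lin S (\<lambda>x. D (x - q x))"
        using jJ by (intro lin_comp[of S "\<lambda>x. x - q x" J D] lin_minus lin_id lin_subset[OF q(1)] HomD(1)[OF D]) auto
      have DK: "D (x - q x) \<in> K" if "x \<in> S" for x using HomD(2)[OF D jJ[OF that]] .
      have D0: "D (x - q x) = 0" if "x \<in> I" for x
        using that q(3) lin_0[OF HomD(1)[OF D] findim_sub[OF fdJ]] by simp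
      have "(\<lambda>x. if x \<in> S then D (x - q x) else 0) \<in> Hom S S"
        by (rule Hom_restrict[OF sub lD]) (use DK K_def in blast)
      then show ?thesis
        using DK D0 endoD(2)[OF T] by (auto simp: Z_def comm0_def r_def fun_eq_iff K_def I_def)
    qed
    show "(\<lambda>x. if x \<in> J then C x else 0) \<in> Hom J K" if C: "C \<in> Z" for C
    proof (rule Hom_restrict[OF findim_sub[OF fdJ]])
      have CH: "C \<in> Hom S S" and Cc: "\<And>x. x \<in> S \<Longrightarrow> C (T x) = T (C x)" using C by (auto simp: Z_def comm0_def)
      show "lin J C" using lin_subset[OF HomD(1)[OF CH]] by (auto simp: J_def)
      show "C x \<in> K" if "x \<in> J" for x
        using that Cc[of x] ZI[OF C, of "T x"] HomD(2)[OF CH] by (auto simp: K_def J_def I_def)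
    qed
    show "(\<lambda>x. if x \<in> J then (if x \<in> S then D (x - q x) else 0) else 0) = D" if "D \<in> Hom J K" for D
      using HomD(3)[OF that] by (auto simp: fun_eq_iff J_def)
    show "(\<lambda>x. if x \<in> S then (if x - q x \<in> J then C (x - q x) else 0) else 0) = C" if C: "C \<in> Z" for C
    proof
      have CH: "C \<in> Hom S S" using C by (auto simp: Z_def comm0_def)
      fix x
      show "(if x \<in> S then (if x - q x \<in> J then C (x - q x) else 0) else 0) = C x"
        using jJ HomD(3)[OF CH] lin_diff[OF HomD(1)[OF CH] sub, of x "q x"] q(2)[of x] IS ZI[OF C, of "q x"] by auto
    qed
  qed (rule subZ)
  \<comment> \<open>Kernel and cokernel of an endomorphism have equal dimension, whence the
    square.\<close>
  then have "cdim Z = (cdim S - cdim I)\<^sup>2"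
    using dim_Hom[OF fdJ fdK] dJ dK by (simp add: power2_eq_square)
  moreover have "cdim (comm0 S T) = cdim Z + cdim (comm0 I T)"
    using rank_nullity(3)[OF findim_comm0[OF S T] lr] im by (simp add: Z_def)
  ultimately show ?thesis by (simp add: I_def)
qed

section \<open>Splitting a pair along the kernel and the image of its leading term\<close>

locale fitting =
  fixes S :: "'a::cvs set" and A1 A0 :: "'a \<Rightarrow> 'a"
  assumes S: "findim S" and A1: "endo S A1" and A0: "endo S A0"
    and ss: "\<And>x. x \<in> S \<Longrightarrow> A1 (A1 x) = 0 \<Longrightarrow> A1 x = 0"
begin

definition N :: "'a set" where "N = {x \<in> S. A1 x = 0}"
definition I :: "'a set" where "I = A1 ` S"

definition J :: "'a \<Rightarrow> 'a" where
  "J = (SOME J. lin I J \<and> (\<forall>y\<in>I. J y \<in> I \<and> A1 (J y) = y \<and> J (A1 y) = y))"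

text \<open>Since \<open>J\<close> inverts \<open>A1\<close> on its image, \<open>Q\<close> is the
  projection onto the image along the kernel, and \<open>P\<close> is the complementary one.\<close>

definition Q :: "'a \<Rightarrow> 'a" where "Q x = J (A1 x)"
definition P :: "'a \<Rightarrow> 'a" where "P x = x - Q x"

lemma sub: "csubspace S"
  by (rule findim_sub[OF S])

lemma lA1: "lin S A1" and lA0: "lin S A0" and A1_in: "x \<in> S \<Longrightarrow> A1 x \<in> S" and A0_in: "x \<in> S \<Longrightarrow> A0 x \<in> S"
  using A1 A0 by (auto simp: endo_def)

lemma IS: "I \<subseteq> S" and NS: "N \<subseteq> S"
  using A1_in by (auto simp: I_def N_def)

lemma fdI: "findim I" and fdN: "findim N" and dim_NI: "cdim S = cdim N + cdim I"
  using rank_nullity[OF S lA1] by (simp_all add: I_def N_def)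

lemma subI: "csubspace I" and subN: "csubspace N"
  using fdI fdN findim_sub by blast+

lemma I_inj: "x \<in> I \<Longrightarrow> A1 x = 0 \<Longrightarrow> x = 0"
  using ss by (auto simp: I_def)

text \<open>By \<open>ss\<close> the kernel and the image of \<open>A1\<close> meet in 0, so
  \<open>A1\<close> is injective on its image and, by dimension, bijective there.\<close>

lemma J_ex: "\<exists>J. lin I J \<and> (\<forall>y\<in>I. J y \<in> I \<and> A1 (J y) = y \<and> J (A1 y) = y)"
proof -
  have lI: "lin I A1" by (rule lin_subset[OF lA1 IS])
  have "A1 ` I \<subseteq> I" using IS by (auto simp: I_def)
  have "{x \<in> I. A1 x = 0} = {0}" using I_inj csub_0[OF subI] lin_0[OF lA1 sub] by auto
  then have "cdim (A1 ` I) = cdim I" using rank_nullity(3)[OF fdI lI] by simp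
  from dim_eqD[OF fdI csubspace_image[OF subI lI] \<open>A1 ` I \<subseteq> I\<close> this] have im: "A1 ` I = I" .
  obtain \<zeta> where "lin_iso I I A1 \<zeta>" by (rule lin_isoI[OF subI lI im I_inj]) blast+
  then show ?thesis by (auto simp: lin_iso_def)
qed

lemma lJ: "lin I J" and J_in: "y \<in> I \<Longrightarrow> J y \<in> I" and A1J: "y \<in> I \<Longrightarrow> A1 (J y) = y"
    and JA1: "y \<in> I \<Longrightarrow> J (A1 y) = y"
  using someI_ex[OF J_ex] by (auto simp: J_def[symmetric])

lemma A1_I: "x \<in> S \<Longrightarrow> A1 x \<in> I"
  by (simp add: I_def)

lemma Q_in: "x \<in> S \<Longrightarrow> Q x \<in> I" and Q_S: "x \<in> S \<Longrightarrow> Q x \<in> S"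
  using J_in A1_I IS by (auto simp: Q_def)

lemma lQ: "lin S Q"
  unfolding Q_def using A1_I by (intro lin_comp[OF lA1 _ lJ]) auto

lemma lP: "lin S P"
  unfolding P_def by (intro lin_minus lin_id lQ)

lemma A1Q: "x \<in> S \<Longrightarrow> A1 (Q x) = A1 x"
  by (simp add: Q_def A1J A1_I)

lemma P_S: "x \<in> S \<Longrightarrow> P x \<in> S"
  using Q_S csub_diff[OF sub] by (simp add: P_def)

lemma P_in: "x \<in> S \<Longrightarrow> P x \<in> N"
  using P_S A1Q Q_S lin_diff[OF lA1 sub] by (simp add: N_def P_def)

lemma Q_I: "x \<in> I \<Longrightarrow> Q x = x" and P_I: "x \<in> I \<Longrightarrow> P x = 0"
  using JA1 by (auto simp: Q_def P_def)

lemma Q_N: "x \<in> N \<Longrightarrow> Q x = 0" and P_N: "x \<in> N \<Longrightarrow> P x = x"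
  using lin_0[OF lJ subI] by (auto simp: Q_def P_def N_def)

lemma PQ: "x = P x + Q x"
  by (simp add: P_def)

lemma N_A1: "x \<in> N \<Longrightarrow> A1 x = 0"
  by (simp add: N_def)

text \<open>\<open>D\<close> and \<open>d\<close> are the diagonal blocks of \<open>A0\<close> on
  the kernel and on the image of \<open>A1\<close>.\<close>

abbreviation D :: "'a \<Rightarrow> 'a" where "D \<equiv> \<lambda>x. P (A0 x)"
abbreviation d :: "'a \<Rightarrow> 'a" where "d \<equiv> \<lambda>x. Q (A0 x)"

lemma D_endo: "endo N D"
  unfolding endo_def
proof
  show "lin N D" by (rule lin_comp[of N A0 S P]) (use NS A0_in lP in \<open>auto intro: lin_subset[OF lA0]\<close>)
  show "\<forall>x\<in>N. D x \<in> N" using NS A0_in P_in by blast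
qed

lemma d_endo: "endo I d" and A1_endo_I: "endo I A1"
proof -
  have "lin I d" by (rule lin_comp[of I A0 S Q]) (use IS A0_in lQ in \<open>auto intro: lin_subset[OF lA0]\<close>)
  moreover have "\<forall>x\<in>I. d x \<in> I" using IS A0_in Q_in by blast
  ultimately show "endo I d" by (simp add: endo_def)
  show "endo I A1" using lin_subset[OF lA1 IS] A1_I IS by (auto simp: endo_def)
qed

text \<open>For a pair (x, y) in the kernel of the block matrix, the kernel component of the second
  equation reads D x = 0, the image component determines Q y through \<open>J\<close>, and P y
  remains free. The dimension is therefore that of ker D plus that of \<open>N\<close>.\<close>

lemma dim_kernel:
  shows "cdim {p \<in> S \<times> S. A1 (fst p) = 0 \<and> A1 (snd p) + A0 (fst p) = 0} = cdim N + (cdim N - cdim (D ` N))"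
    and "cdim (D ` N) \<le> cdim N"
proof -
  define K where "K = {p \<in> S \<times> S. A1 (fst p) = 0 \<and> A1 (snd p) + A0 (fst p) = 0}"
  define K2 where "K2 = {x \<in> N. D x = 0}"
  have fdK2: "findim K2" and dK2: "cdim N = cdim K2 + cdim (D ` N)"
    using rank_nullity[OF fdN endoD(1)[OF D_endo]] by (auto simp: K2_def)
  then show "cdim (D ` N) \<le> cdim N" by simp
  have subK2: "csubspace K2" using fdK2 findim_sub by blast
  have subK: "csubspace K"
  proof (rule csubspaceI)
    show "0 \<in> K" using csub_0[OF sub] lin_0[OF lA1 sub] lin_0[OF lA0 sub] by (simp add: K_def zero_prod_def)
    show "p + q \<in> K" if "p \<in> K" "q \<in> K" for p q
    proof -
      have m: "fst p \<in> S" "snd p \<in> S" "fst q \<in> S" "snd q \<in> S" using that by (auto simp: K_def)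
      have "A1 (snd p + snd q) + A0 (fst p + fst q) = (A1 (snd p) + A0 (fst p)) + (A1 (snd q) + A0 (fst q))"
        using m by (simp add: lin_add[OF lA1] lin_add[OF lA0] algebra_simps)
      also have "\<dots> = 0" using that by (simp add: K_def)
      finally show ?thesis using that m csub_add[OF sub] by (simp add: K_def lin_add[OF lA1] mem_Times_iff)
    qed
    show "c *\<^sub>C p \<in> K" if "p \<in> K" for c p
    proof -
      have m: "fst p \<in> S" "snd p \<in> S" using that by (auto simp: K_def)
      have "A1 (c *\<^sub>C snd p) + A0 (c *\<^sub>C fst p) = c *\<^sub>C (A1 (snd p) + A0 (fst p))"
        using m by (simp add: lin_scale[OF lA1] lin_scale[OF lA0] cscale_add_right)
      also have "\<dots> = 0" using that by (simp add: K_def)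
      finally show ?thesis using that m csub_scale[OF sub] by (simp add: K_def lin_scale[OF lA1] mem_Times_iff)
    qed
  qed
  have sol: "A1 y + A0 x = 0 \<longleftrightarrow> D x = 0 \<and> Q y = - J (Q (A0 x))" if "x \<in> S" "y \<in> S" for x y
  proof
    assume a: "A1 y + A0 x = 0"
    then have a': "A0 x = - A1 y" by (simp add: add_eq_0_iff)
    have "- A1 y \<in> I" using A1_I[OF that(2)] csub_neg[OF subI] by blast
    then show "D x = 0 \<and> Q y = - J (Q (A0 x))"
      using a' P_I Q_I that A1_I lin_neg[OF lJ subI] by (simp add: Q_def[of y])
  next
    assume a: "D x = 0 \<and> Q y = - J (Q (A0 x))"
    have "J (Q (A0 x)) \<in> S" using J_in Q_in A0_in that IS by blast
    have "A1 y = A1 (Q y)" using A1Q that by simp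
    also have "\<dots> = - A1 (J (Q (A0 x)))"
      using a lin_neg[OF lA1 sub \<open>J (Q (A0 x)) \<in> S\<close>] by simp
    also have "\<dots> = - Q (A0 x)" using A1J Q_in A0_in that by simp
    finally show "A1 y + A0 x = 0" using a PQ[of "A0 x"] by simp
  qed
  have "cdim K = cdim (K2 \<times> N)"
  proof (rule dim_inverse(2)[of "K2 \<times> N" K "\<lambda>p. (fst p, snd p - J (Q (A0 (fst p))))" "\<lambda>p. (fst p, P (snd p))"])
    have JQ: "J (Q (A0 x)) \<in> I" if "x \<in> S" for x using that J_in Q_in A0_in by blast
    have lJQ: "lin S (\<lambda>x. J (Q (A0 x)))"
      using Q_in A0_in by (intro lin_comp[of S "\<lambda>x. Q (A0 x)" I J] lin_comp[of S A0 S Q] lA0 lQ lJ) auto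
    show "csubspace (K2 \<times> N)" by (rule csubspace_Times[OF subK2 subN])
    show "findim (K2 \<times> N)" by (rule dim_Times(1)[OF fdK2 fdN])
    show "lin (K2 \<times> N) (\<lambda>p. (fst p, snd p - J (Q (A0 (fst p)))))"
      by (rule linI) (use NS K2_def in \<open>auto simp: cscale_prod_def lin_add[OF lJQ] lin_scale[OF lJQ] cv.scale_right_diff_distrib subset_iff\<close>)
    show "(fst p, snd p - J (Q (A0 (fst p)))) \<in> K" if "p \<in> K2 \<times> N" for p
    proof -
      have m: "fst p \<in> S" "snd p \<in> N" "snd p \<in> S" "D (fst p) = 0" "A1 (fst p) = 0"
        using that NS by (auto simp: K2_def N_def)
      define y where "y = snd p - J (Q (A0 (fst p)))"
      have y: "y \<in> S" using m JQ IS csub_diff[OF sub] by (auto simp: y_def)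
      have "Q y = - J (Q (A0 (fst p)))"
        using m Q_N Q_I[OF JQ] lin_diff[OF lQ sub, of "snd p" "J (Q (A0 (fst p)))"] JQ IS by (auto simp: y_def)
      then have "A1 y + A0 (fst p) = 0" using sol m y by blast
      then show ?thesis using m y by (simp add: K_def y_def)
    qed
    show "(fst p, P (snd p)) \<in> K2 \<times> N" if "p \<in> K" for p
      using that sol P_in by (auto simp: K_def K2_def N_def)
    show "(fst (fst p, snd p - J (Q (A0 (fst p)))), P (snd (fst p, snd p - J (Q (A0 (fst p)))))) = p"
      if "p \<in> K2 \<times> N" for p
    proof -
      have m: "fst p \<in> S" "snd p \<in> N" "snd p \<in> S" using that NS by (auto simp: K2_def)
      have "J (Q (A0 (fst p))) \<in> S" using JQ[OF m(1)] IS by blast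
      then show ?thesis using m P_N P_I[OF JQ] lin_diff[OF lP sub] by simp
    qed
    show "(fst (fst p, P (snd p)), snd (fst p, P (snd p)) - J (Q (A0 (fst (fst p, P (snd p)))))) = p"
      if "p \<in> K" for p
      using that sol[of "fst p" "snd p"] PQ[of "snd p"] by (auto simp: K_def)
  qed (rule subK)
  then have "cdim K = cdim K2 + cdim N" using dim_Times(2)[OF fdK2 fdN] by simp
  then show "cdim {p \<in> S \<times> S. A1 (fst p) = 0 \<and> A1 (snd p) + A0 (fst p) = 0} = cdim N + (cdim N - cdim (D ` N))"
    using dK2 by (simp add: K_def)
qed

text \<open>The off-diagonal blocks of \<open>C0\<close> with respect to the decomposition into kernel and
  image of \<open>A1\<close> are determined by \<open>C1\<close>; the diagonal blocks decouple.\<close>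

lemma dim_comm1_split:
  "cdim (comm1 S A1 A0) = (cdim N)\<^sup>2 + cdim (comm0 N D) + cdim (comm1 I A1 d)"
proof -
  \<comment> \<open>The diagonal blocks on \<open>N\<close> and on \<open>I\<close>. As
    \<open>C1\<close> commutes with \<open>A1\<close> it respects both summands, so for
    \<open>C1\<close> they are all the blocks.\<close>
  define f where "f = (\<lambda>p::('a \<Rightarrow> 'a) \<times> ('a \<Rightarrow> 'a).
    (((\<lambda>x. if x \<in> N then P (snd p x) else 0), (\<lambda>x. if x \<in> N then fst p x else 0)),
     ((\<lambda>x. if x \<in> I then fst p x else 0), (\<lambda>x. if x \<in> I then Q (snd p x) else 0))))"
  have f_app: "f (C1, C0) =
    (((\<lambda>x. if x \<in> N then P (C0 x) else 0), (\<lambda>x. if x \<in> N then C1 x else 0)),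
     ((\<lambda>x. if x \<in> I then C1 x else 0), (\<lambda>x. if x \<in> I then Q (C0 x) else 0)))" for C1 C0
    unfolding f_def fst_conv snd_conv ..
  define T where "T = (Hom N N \<times> comm0 N D) \<times> comm1 I A1 d"
  have fdT: "findim (Hom N N)" "findim (comm0 N D)" "findim (comm1 I A1 d)"
    using dim_Hom[OF fdN fdN] findim_comm0[OF fdN D_endo] findim_comm1[OF fdI A1_endo_I d_endo] by auto
  have dT: "cdim T = (cdim N)\<^sup>2 + cdim (comm0 N D) + cdim (comm1 I A1 d)"
    unfolding T_def
    using dim_Times(2)[OF dim_Times(1)[OF fdT(1,2)] fdT(3)] dim_Times(2)[OF fdT(1,2)] dim_Hom[OF fdN fdN]
    by (simp add: power2_eq_square)
  have eqs: "C1 \<in> Hom S S" "C0 \<in> Hom S S" "\<And>x. x \<in> S \<Longrightarrow> C1 (A1 x) = A1 (C1 x)"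
      "\<And>x. x \<in> S \<Longrightarrow> A0 (C1 x) + A1 (C0 x) = C0 (A1 x) + C1 (A0 x)"
    if "(C1, C0) \<in> comm1 S A1 A0" for C1 C0
    using that by (auto simp: comm1_def)
  have C1N: "C1 x \<in> N" if "(C1, C0) \<in> comm1 S A1 A0" "x \<in> N" for C1 C0 x
  proof -
    have "A1 (C1 x) = C1 (A1 x)" using eqs(3)[OF that(1), of x] that(2) NS by auto
    also have "\<dots> = 0" using that(2) N_A1 lin_0[OF HomD(1)[OF eqs(1)[OF that(1)]] sub] by simp
    finally show ?thesis using HomD(2)[OF eqs(1)[OF that(1)]] that(2) NS by (auto simp: N_def)
  qed
  have C1I: "C1 x \<in> I" if "(C1, C0) \<in> comm1 S A1 A0" "x \<in> I" for C1 C0 x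
    using that eqs(3)[OF that(1)] HomD(2)[OF eqs(1)[OF that(1)]] by (auto simp: I_def)
  have lf: "lin (comm1 S A1 A0) f"
  proof (rule linI)
    have m: "fst p x \<in> S" "snd p x \<in> S" if "p \<in> comm1 S A1 A0" "x \<in> S" for p x
      using that eqs(1,2)[of "fst p" "snd p"] HomD(2) by (metis prod.collapse)+
    show "f (p + q) = f p + f q" if "p \<in> comm1 S A1 A0" "q \<in> comm1 S A1 A0" for p q
      using m[OF that(1)] m[OF that(2)] NS IS lin_add[OF lP] lin_add[OF lQ]
      by (auto simp: f_def fun_eq_iff subset_iff)
    show "f (c *\<^sub>C p) = c *\<^sub>C f p" if "p \<in> comm1 S A1 A0" for p c
      using m[OF that(1)] NS IS lin_scale[OF lP] lin_scale[OF lQ]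
      by (auto simp: f_def fun_eq_iff subset_iff cscale_prod_def)
  qed
  have f_in: "f (C1, C0) \<in> T" if C: "(C1, C0) \<in> comm1 S A1 A0" for C1 C0
  proof -
    note CH = eqs(1,2)[OF C] and e = eqs(3,4)[OF C]
    have CS: "C1 x \<in> S" "C0 x \<in> S" if "x \<in> S" for x using HomD(2)[OF CH(1)] HomD(2)[OF CH(2)] that by auto
    have c1: "(\<lambda>x. if x \<in> N then P (C0 x) else 0) \<in> Hom N N"
      using NS CS P_in lP
      by (intro Hom_restrict subN lin_comp[of N C0 S P] lin_subset[OF HomD(1)[OF CH(2)]]) auto
    have c2: "(\<lambda>x. if x \<in> N then C1 x else 0) \<in> Hom N N"
      by (intro Hom_restrict subN lin_subset[OF HomD(1)[OF CH(1)]] NS C1N[OF C])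
    have c3: "(\<lambda>x. if x \<in> I then C1 x else 0) \<in> Hom I I"
      by (intro Hom_restrict subI lin_subset[OF HomD(1)[OF CH(1)]] IS C1I[OF C])
    have c4: "(\<lambda>x. if x \<in> I then Q (C0 x) else 0) \<in> Hom I I"
      using IS CS Q_in lQ
      by (intro Hom_restrict subI lin_comp[of I C0 S Q] lin_subset[OF HomD(1)[OF CH(2)]]) auto
    have PC1: "P (C1 x) = C1 (P x)" "Q (C1 x) = C1 (Q x)" if "x \<in> S" for x
    proof -
      have "C1 x = C1 (P x) + C1 (Q x)"
        using PQ[of x] lin_add[OF HomD(1)[OF CH(1)] P_S[OF that] Q_S[OF that]] by simp
      moreover have m: "C1 (P x) \<in> N" "C1 (Q x) \<in> I" using C1N[OF C] C1I[OF C] P_in Q_in that by auto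
      moreover have "C1 (P x) \<in> S" "C1 (Q x) \<in> S" using m NS IS by auto
      ultimately show "P (C1 x) = C1 (P x)" "Q (C1 x) = C1 (Q x)"
        using lin_add[OF lP, of "C1 (P x)" "C1 (Q x)"] lin_add[OF lQ, of "C1 (P x)" "C1 (Q x)"]
          P_N P_I Q_N Q_I by auto
    qed
    \<comment> \<open>On the kernel the term C0 A1 vanishes, and \<open>P\<close> annihilates A1 C0;
      what remains involves \<open>C1\<close> alone.\<close>
    have "C1 (D x) = D (C1 x)" if x: "x \<in> N" for x
    proof -
      have xS: "x \<in> S" using x NS by blast
      have m: "A0 (C1 x) \<in> S" "A1 (C0 x) \<in> I" "C1 (A0 x) \<in> S" "C0 x \<in> S"
        using xS CS A0_in A1_I by auto
      have "A0 (C1 x) + A1 (C0 x) = C1 (A0 x)"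
        using e(2)[OF xS] N_A1[OF x] lin_0[OF HomD(1)[OF CH(2)] sub] by simp
      then have "P (A0 (C1 x) + A1 (C0 x)) = P (C1 (A0 x))" by simp
      then show ?thesis using lin_add[OF lP m(1)] m IS P_I PC1(1)[OF A0_in[OF xS]] by auto
    qed
    moreover have "Q (A0 (C1 x)) + A1 (Q (C0 x)) = Q (C0 (A1 x)) + C1 (Q (A0 x))" if x: "x \<in> I" for x
    proof -
      have xS: "x \<in> S" using x IS by blast
      have m: "A0 (C1 x) \<in> S" "A1 (C0 x) \<in> I" "C1 (A0 x) \<in> S" "C0 x \<in> S" "C0 (A1 x) \<in> S" "A1 (C0 x) \<in> S"
        using xS CS A0_in A1_I A1_in by auto
      have "Q (A0 (C1 x) + A1 (C0 x)) = Q (C0 (A1 x) + C1 (A0 x))" using e(2)[OF xS] by simp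
      then have "Q (A0 (C1 x)) + Q (A1 (C0 x)) = Q (C0 (A1 x)) + Q (C1 (A0 x))"
        using lin_add[OF lQ] m by simp
      then show ?thesis using m Q_I[OF m(2)] A1Q[OF m(4)] PC1(2)[OF A0_in[OF xS]] by simp
    qed
    ultimately show ?thesis
      using c1 c2 c3 c4 NS IS e(1) C1N[OF C] C1I[OF C] endoD(2)[OF D_endo] endoD(2)[OF d_endo] endoD(2)[OF A1_endo_I]
      unfolding f_app by (simp add: T_def comm0_def comm1_def subset_iff)
  qed
  \<comment> \<open>Once \<open>C1\<close> is 0 the second equation says that \<open>C0\<close>
    commutes with \<open>A1\<close>. Then \<open>C0\<close> respects \<open>N\<close> and
    \<open>I\<close> too, and its diagonal blocks vanish.\<close>
  have inj: "p = 0" if p: "p \<in> comm1 S A1 A0" "f p = 0" for p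
  proof -
    obtain C1 C0 where [simp]: "p = (C1, C0)" by (metis prod.collapse)
    note C = p(1)[simplified]
    note CH = eqs(1,2)[OF C] and e = eqs(4)[OF C]
    have z: "x \<in> N \<Longrightarrow> P (C0 x) = 0" "x \<in> N \<Longrightarrow> C1 x = 0" "x \<in> I \<Longrightarrow> C1 x = 0" "x \<in> I \<Longrightarrow> Q (C0 x) = 0" for x
    proof -
      have q: "(\<lambda>x. if x \<in> N then P (C0 x) else 0) = 0" "(\<lambda>x. if x \<in> N then C1 x else 0) = 0"
        "(\<lambda>x. if x \<in> I then C1 x else 0) = 0" "(\<lambda>x. if x \<in> I then Q (C0 x) else 0) = 0"
        using p(2) by (simp_all add: f_app zero_prod_def)
      show "x \<in> N \<Longrightarrow> P (C0 x) = 0" "x \<in> N \<Longrightarrow> C1 x = 0" "x \<in> I \<Longrightarrow> C1 x = 0" "x \<in> I \<Longrightarrow> Q (C0 x) = 0"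
        using fun_cong[OF q(1), of x] fun_cong[OF q(2), of x] fun_cong[OF q(3), of x] fun_cong[OF q(4), of x]
        by simp_all
    qed
    have dec: "C x = C (P x) + C (Q x)" if "C \<in> Hom S S" "x \<in> S" for C x
      using PQ[of x] lin_add[OF HomD(1)[OF that(1)] P_S[OF that(2)] Q_S[OF that(2)]] by simp
    have C1z: "C1 x = 0" if "x \<in> S" for x
      using dec[OF CH(1) that] z P_in Q_in that by simp
    have C0c: "C0 (A1 x) = A1 (C0 x)" if "x \<in> S" for x
      using e[OF that] C1z that A0_in lin_0[OF lA0 sub] by simp
    have C0N: "C0 x = 0" if "x \<in> N" for x
    proof -
      have xS: "x \<in> S" "C0 x \<in> S" using that NS HomD(2)[OF CH(2)] by auto
      have "A1 (C0 x) = 0" using C0c[OF xS(1)] N_A1[OF that] lin_0[OF HomD(1)[OF CH(2)] sub] by simp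
      then have "C0 x \<in> N" using xS by (simp add: N_def)
      then show ?thesis using P_N z(1)[OF that] by simp
    qed
    have C0I: "C0 x = 0" if "x \<in> I" for x
    proof -
      have "C0 x \<in> I" using that C0c HomD(2)[OF CH(2)] by (auto simp: I_def)
      then show ?thesis using Q_I z(4)[OF that] by simp
    qed
    have C0z: "C0 x = 0" if "x \<in> S" for x
      using dec[OF CH(2) that] C0N[OF P_in[OF that]] C0I[OF Q_in[OF that]] by simp
    have "C1 = 0" "C0 = 0"
    proof -
      show "C1 = 0" using C1z HomD(3)[OF CH(1)] by (intro ext) (metis zero_fun_apply)
      show "C0 = 0" using C0z HomD(3)[OF CH(2)] by (intro ext) (metis zero_fun_apply)
    qed
    then show "p = 0" by (simp add: zero_prod_def)
  qed
  have surj: "t \<in> f ` comm1 S A1 A0" if t: "t \<in> T" for t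
  proof -
    obtain c0 c c1' c0' where t_eq: "t = ((c0, c), (c1', c0'))" by (metis prod.collapse)
    have c0: "c0 \<in> Hom N N" and c: "c \<in> Hom N N" and cD: "\<And>x. x \<in> N \<Longrightarrow> c (D x) = D (c x)"
      and c1': "c1' \<in> Hom I I" and c0': "c0' \<in> Hom I I" and ca: "\<And>x. x \<in> I \<Longrightarrow> c1' (A1 x) = A1 (c1' x)"
      and cd: "\<And>x. x \<in> I \<Longrightarrow> d (c1' x) + A1 (c0' x) = c0' (A1 x) + c1' (d x)"
      using t by (auto simp: T_def t_eq comm0_def comm1_def)
    note cN = HomD(2)[OF c] HomD(2)[OF c0] and cI = HomD(2)[OF c1'] HomD(2)[OF c0']
    define C1 where "C1 = (\<lambda>x. c (P x) + c1' (Q x))"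
    \<comment> \<open>The equation to solve is A1 C0 - C0 A1 = G. From \<open>N\<close> to
      \<open>I\<close> only the first term survives, which gives the block J Q G P of
      \<open>C0\<close>; from \<open>I\<close> to \<open>N\<close> only the second survives, which
      gives - P G J Q.\<close>
    define G where "G = (\<lambda>x. C1 (A0 x) - A0 (C1 x))"
    define C0 where "C0 = (\<lambda>x. c0 (P x) + c0' (Q x) + J (Q (G (P x))) - P (G (J (Q x))))"
    have l1: "lin S C1" unfolding C1_def
      using P_in Q_in by (intro lin_plus lin_comp[of S P N c] lin_comp[of S Q I c1'] lP lQ HomD(1)[OF c] HomD(1)[OF c1']) auto
    have C1S: "C1 x \<in> S" if "x \<in> S" for x
      unfolding C1_def using that cN(1)[OF P_in] cI(1)[OF Q_in] NS IS by (intro csub_add[OF sub]) auto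
    have lG: "lin S G" unfolding G_def
      using A0_in C1S by (intro lin_minus lin_comp[of S A0 S C1] lin_comp[of S C1 S A0] l1 lA0) auto
    have GS: "G x \<in> S" if "x \<in> S" for x
      unfolding G_def using that A0_in C1S by (intro csub_diff[OF sub]) auto
    have l0: "lin S C0" unfolding C0_def
      using P_in Q_in P_S GS J_in IS NS
      by (intro lin_plus lin_minus lin_comp[of S P N c0] lin_comp[of S Q I c0'] lP lQ HomD(1)[OF c0] HomD(1)[OF c0']
          lin_comp[of S "\<lambda>x. Q (G (P x))" I J] lin_comp[of S "\<lambda>x. G (P x)" S Q] lin_comp[of S P S G] lG lJ
          lin_comp[of S "\<lambda>x. G (J (Q x))" S P] lin_comp[of S "\<lambda>x. J (Q x)" S G] lin_comp[of S Q I J]) (auto simp: subset_iff)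
    have JQG: "J (Q (G x)) \<in> I" if "x \<in> S" for x using that J_in Q_in GS by blast
    have PGJ: "P (G (J x)) \<in> N" if "x \<in> I" for x using that J_in P_in GS IS by blast
    have C0S: "C0 x \<in> S" if "x \<in> S" for x
      unfolding C0_def using that cN(2)[OF P_in] cI(2)[OF Q_in] NS IS JQG[OF P_S] PGJ[OF Q_in]
      by (intro csub_add[OF sub] csub_diff[OF sub]) (auto simp: subset_iff)
    have C1_N: "C1 x = c x" if "x \<in> N" for x
      using that P_N Q_N lin_0[OF HomD(1)[OF c1'] subI] by (simp add: C1_def)
    have C1_I: "C1 x = c1' x" if "x \<in> I" for x
      using that P_I Q_I lin_0[OF HomD(1)[OF c] subN] by (simp add: C1_def)
    have z0: "G 0 = 0" "J 0 = 0" "P 0 = 0" "Q 0 = 0"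
      using lin_0[OF lG sub] lin_0[OF lJ subI] lin_0[OF lP sub] lin_0[OF lQ sub] by auto
    have C0_N: "C0 x = c0 x + J (Q (G x))" if "x \<in> N" for x
      using that P_N Q_N lin_0[OF HomD(1)[OF c0'] subI] z0 by (simp add: C0_def)
    have C0_I: "C0 x = c0' x - P (G (J x))" if "x \<in> I" for x
      using that P_I Q_I lin_0[OF HomD(1)[OF c0] subN] z0 by (simp add: C0_def)
    have PC1: "P (C1 x) = c (P x)" "Q (C1 x) = c1' (Q x)" if "x \<in> S" for x
    proof -
      have m: "c (P x) \<in> N" "c1' (Q x) \<in> I" using cN cI P_in Q_in that by auto
      then have "c (P x) \<in> S" "c1' (Q x) \<in> S" using NS IS by auto
      then show "P (C1 x) = c (P x)" "Q (C1 x) = c1' (Q x)"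
        using m lin_add[OF lP] lin_add[OF lQ] P_N P_I Q_N Q_I by (simp_all add: C1_def)
    qed
    have e1: "C1 (A1 x) = A1 (C1 x)" if x: "x \<in> S" for x
    proof -
      have m: "c (P x) \<in> N" "c1' (Q x) \<in> I" using cN cI P_in Q_in that by auto
      then have mS: "c (P x) \<in> S" "c1' (Q x) \<in> S" using NS IS by auto
      have "A1 (C1 x) = A1 (c1' (Q x))" using lin_add[OF lA1 mS] N_A1[OF m(1)] by (simp add: C1_def)
      also have "\<dots> = c1' (A1 (Q x))" using ca[OF Q_in[OF x]] by simp
      also have "\<dots> = C1 (A1 x)" using A1Q x C1_I[OF A1_I[OF x]] by simp
      finally show ?thesis by simp
    qed
    \<comment> \<open>The defect of that equation. Its diagonal parts vanish by the conditions on
      \<open>c\<close>, \<open>c1'\<close> and \<open>c0'\<close>, its off-diagonal parts by the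
      choice of \<open>C0\<close>.\<close>
    define E where "E = (\<lambda>x. A1 (C0 x) - C0 (A1 x) - G x)"
    have lE: "lin S E" unfolding E_def
      using C0S A1_in by (intro lin_minus lin_comp[of S C0 S A1] lin_comp[of S A1 S C0] lA1 l0 lG) auto
    have E_N: "E x = 0" if x: "x \<in> N" for x
    proof -
      have xS: "x \<in> S" using x NS by blast
      have m: "c0 x \<in> S" "c0 x \<in> N" "J (Q (G x)) \<in> S" using x xS cN NS IS JQG by auto
      have mA: "A0 x \<in> S" "C1 (A0 x) \<in> S" "A0 (C1 x) \<in> S" using xS A0_in C1S by auto
      have "A1 (C0 x) = A1 (c0 x) + A1 (J (Q (G x)))" using C0_N[OF x] lin_add[OF lA1] m by simp
      also have "\<dots> = Q (G x)" using N_A1[OF m(2)] A1J[OF Q_in[OF GS[OF xS]]] by simp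
      finally have 1: "A1 (C0 x) = Q (G x)" .
      have "P (G x) = P (C1 (A0 x)) - P (A0 (C1 x))" using lin_diff[OF lP sub] mA by (simp add: G_def)
      also have "\<dots> = c (D x) - D (c x)" using PC1(1)[OF mA(1)] C1_N[OF x] by simp
      also have "\<dots> = 0" using cD[OF x] by simp
      finally have "G x = Q (G x)" using PQ[of "G x"] by simp
      then show ?thesis using 1 N_A1[OF x] lin_0[OF l0 sub] by (simp add: E_def)
    qed
    have E_I: "E x = 0" if x: "x \<in> I" for x
    proof -
      have xS: "x \<in> S" and AI: "A1 x \<in> I" using x IS A1_I by auto
      have mA: "A0 x \<in> S" "C1 (A0 x) \<in> S" "A0 (C1 x) \<in> S" using xS A0_in C1S by auto
      have m: "c0' x \<in> S" "P (G (J x)) \<in> N" "P (G (J x)) \<in> S" using x cI NS IS PGJ by (auto simp: subset_iff)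
      have 1: "A1 (C0 x) = A1 (c0' x)" using C0_I[OF x] lin_diff[OF lA1 sub] m N_A1[OF m(2)] by simp
      have 2: "C0 (A1 x) = c0' (A1 x) - P (G x)" using C0_I[OF AI] JA1[OF x] by simp
      have "Q (G x) = Q (C1 (A0 x)) - Q (A0 (C1 x))" using lin_diff[OF lQ sub] mA by (simp add: G_def)
      also have "\<dots> = c1' (d x) - d (c1' x)" using PC1(2)[OF mA(1)] C1_I[OF x] by simp
      finally have 3: "Q (G x) = c1' (d x) - d (c1' x)" .
      have "E x = A1 (c0' x) - c0' (A1 x) - Q (G x)" using 1 2 by (simp add: E_def P_def)
      also have "A1 (c0' x) = c0' (A1 x) + (c1' (d x) - d (c1' x))"
        using cd[OF x] by (simp add: algebra_simps)
      also have "\<dots> - c0' (A1 x) - Q (G x) = 0" using 3 by simp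
      finally show ?thesis .
    qed
    have E: "E x = 0" if "x \<in> S" for x
    proof -
      have "E (P x + Q x) = 0" using lin_add[OF lE P_S[OF that] Q_S[OF that]] E_N[OF P_in[OF that]] E_I[OF Q_in[OF that]] by simp
      then show ?thesis using PQ[of x] by simp
    qed
    define r where "r = (\<lambda>C::'a \<Rightarrow> 'a. \<lambda>x. if x \<in> S then C x else 0)"
    have "r C1 \<in> Hom S S" "r C0 \<in> Hom S S" unfolding r_def by (intro Hom_restrict sub l1 l0 C1S C0S; assumption)+
    moreover have "A0 (C1 x) + A1 (C0 x) = C0 (A1 x) + C1 (A0 x)" if "x \<in> S" for x
      using E[OF that] by (simp add: E_def G_def algebra_simps)
    ultimately have "(r C1, r C0) \<in> comm1 S A1 A0"
      using e1 A1_in A0_in by (simp add: comm1_def r_def)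
    moreover have "f (r C1, r C0) = t"
    proof -
      have 1: "P (C0 x) = c0 x" if "x \<in> N" for x
      proof -
        have m: "c0 x \<in> N" "J (Q (G x)) \<in> I" using that cN NS JQG by auto
        then have "c0 x \<in> S" "J (Q (G x)) \<in> S" using NS IS by auto
        then show ?thesis using C0_N[OF that] lin_add[OF lP] P_N P_I m by simp
      qed
      have 2: "Q (C0 x) = c0' x" if "x \<in> I" for x
      proof -
        have m: "c0' x \<in> I" "P (G (J x)) \<in> N" using that cI PGJ by auto
        then have "c0' x \<in> S" "P (G (J x)) \<in> S" using NS IS by auto
        then show ?thesis using C0_I[OF that] lin_diff[OF lQ sub] Q_N Q_I m by simp
      qed
      show ?thesis
        using 1 2 C1_N C1_I NS IS HomD(3)[OF c0] HomD(3)[OF c] HomD(3)[OF c1'] HomD(3)[OF c0']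
        by (auto simp: f_app t_eq r_def fun_eq_iff subset_iff)
    qed
    ultimately show ?thesis by (metis imageI)
  qed
  have im: "f ` comm1 S A1 A0 = T"
    using f_in surj by auto
  show ?thesis
    using dim_bij(2)[OF csubspace_comm1[OF sub A1 A0] lf im inj findim_comm1[OF S A1 A0]] dT by simp
qed

end

text \<open>\<open>\<sigma>\<close> and \<open>T\<close> have the same kernel, so
  \<open>\<sigma>\<close> induces an isomorphism between the images of \<open>T\<close> and
  \<open>T'\<close>. The commutants on the images then agree up to a scalar shift, and
  \<open>dim_comm0_image\<close> accounts for the rest; written as sums to avoid subtraction of the
  squares.\<close>

lemma dim_comm0_transfer:
  assumes X: "findim X" "endo X T" and X': "findim X'" "endo X' T'" and \<sigma>: "lin X \<sigma>" "\<sigma> ` X = T' ` X'"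
    and ker: "\<And>y. y \<in> X \<Longrightarrow> \<sigma> y = 0 \<longleftrightarrow> T y = 0"
    and shift: "\<And>y. y \<in> X \<Longrightarrow> T' (\<sigma> y) = \<sigma> (T y + c *\<^sub>C y)"
  shows "cdim (T' ` X') = cdim (T ` X)" (is ?A)
    and "cdim (comm0 X' T') + (cdim X - cdim (T ` X))\<^sup>2
       = cdim (comm0 X T) + (cdim X' - cdim (T ` X))\<^sup>2" (is ?B)
proof -
  note sub = findim_sub[OF X(1)] and lT = endoD(1)[OF X(2)] and TX = endoD(2)[OF X(2)]
  define I where "I = T ` X"
  have fdI: "findim I" unfolding I_def by (rule rank_nullity(2)[OF X(1) lT])
  note subI = findim_sub[OF fdI]
  have IX: "I \<subseteq> X" using TX by (auto simp: I_def)
  obtain s where s: "lin I s" "\<And>y. y \<in> I \<Longrightarrow> s y \<in> X" "\<And>y. y \<in> I \<Longrightarrow> T (s y) = y"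
    unfolding I_def by (rule lin_right_inverse[OF sub lT]) blast
  \<comment> \<open>The induced isomorphism \<open>T y\<close> \<mapsto> \<open>\<sigma> y\<close>,
    which does not depend on the section \<open>s\<close>.\<close>
  define \<theta> where "\<theta> = (\<lambda>y. \<sigma> (s y))"
  have \<theta>T: "\<theta> (T y) = \<sigma> y" if "y \<in> X" for y
  proof -
    have m: "s (T y) \<in> X" "T (s (T y)) = T y" using s that by (auto simp: I_def)
    have "T (s (T y) - y) = 0" using lin_diff[OF lT sub] m that by simp
    then have "\<sigma> (s (T y) - y) = 0" using ker m that csub_diff[OF sub] by simp
    then show ?thesis using lin_diff[OF \<sigma>(1) sub] m that by (simp add: \<theta>_def)
  qed
  have l\<theta>: "lin I \<theta>" unfolding \<theta>_def using s by (intro lin_comp[of I s X \<sigma>] \<sigma>(1)) auto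
  have im: "\<theta> ` I = T' ` X'"
    using \<theta>T by (simp add: I_def image_image \<sigma>(2)[symmetric])
  have inj: "y = 0" if "y \<in> I" "\<theta> y = 0" for y
    using that \<theta>T ker by (auto simp: I_def)
  obtain \<zeta> where iso: "lin_iso I (T' ` X') \<theta> \<zeta>" using lin_isoI[OF subI l\<theta> im inj] by blast
  have TI: "endo I T" using IX lin_subset[OF lT] by (auto simp: endo_def I_def)
  have sh: "T' (\<theta> y) = \<theta> (T y + c *\<^sub>C y)" if y: "y \<in> I" for y
  proof -
    obtain x where x: "x \<in> X" "y = T x" using y by (auto simp: I_def)
    have m: "T x \<in> X" "c *\<^sub>C x \<in> X" "T x + c *\<^sub>C x \<in> X" using x TX csub_add[OF sub] csub_scale[OF sub] by auto
    have "T' (\<theta> y) = \<sigma> (T x + c *\<^sub>C x)" using x \<theta>T shift by simp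
    also have "\<dots> = \<theta> (T (T x + c *\<^sub>C x))" using \<theta>T m by simp
    also have "T (T x + c *\<^sub>C x) = T y + c *\<^sub>C y" using lin_add[OF lT] lin_scale[OF lT] m x by simp
    finally show ?thesis .
  qed
  have "cdim (comm0 (T' ` X') T') = cdim (comm0 I T)"
    by (rule lin_iso.dim_comm0[OF iso fdI TI, where T' = T' and c = c]) (rule sh)
  moreover show A: ?A using dim_bij(2)[OF subI l\<theta> im inj fdI] by (simp add: I_def)
  ultimately show ?B
    using dim_comm0_image[OF X] dim_comm0_image[OF X'] by (simp add: I_def)
qed

section \<open>Local change of the commutant\<close>

text \<open>The case m_i = 0. Equal ranks force the nullity to grow from k to k + e, and the
  commutant grows by (k + e)^2 - k^2.\<close>

lemma dim_comm0_conv: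
  assumes V: "findim V" and W: "findim W" and X: "csubspace X"
    and p: "lin X p" "p ` X = W" and F: "lin X F" "F ` X = V"
    and i0: "lin V i0" "\<And>x. x \<in> V \<Longrightarrow> i0 x \<in> X"
    and A0: "endo V A0" and B0: "endo W B0"
    and Fi0: "\<And>x. x \<in> V \<Longrightarrow> F (i0 x) = A0 x + \<mu> *\<^sub>C x"
    and B0p: "\<And>v. v \<in> X \<Longrightarrow> B0 (p v) = p (i0 (F v))"
    and ker: "\<And>x. x \<in> V \<Longrightarrow> p (i0 x) = 0 \<longleftrightarrow> A0 x = 0"
    and e: "int (cdim W) = int (cdim V) + e"
  shows "int (cdim (comm0 W B0)) = int (cdim (comm0 V A0)) + e\<^sup>2 + 2 * e * int (cdim {x \<in> V. A0 x = 0})"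
proof -
  define \<sigma> where "\<sigma> = (\<lambda>x. p (i0 x))"
  have l: "lin V \<sigma>" unfolding \<sigma>_def by (rule lin_comp[of V i0 X p]) (use i0 p in auto)
  have im: "\<sigma> ` V = B0 ` W"
    unfolding F(2)[symmetric] p(2)[symmetric] image_image using B0p by (simp add: \<sigma>_def)
  have sh: "B0 (\<sigma> y) = \<sigma> (A0 y + \<mu> *\<^sub>C y)" if "y \<in> V" for y
    using B0p[OF i0(2)[OF that]] Fi0[OF that] by (simp add: \<sigma>_def)
  have ker': "\<sigma> y = 0 \<longleftrightarrow> A0 y = 0" if "y \<in> V" for y using ker[OF that] by (simp add: \<sigma>_def)
  note t = dim_comm0_transfer[OF V A0 W B0 l im ker', where c = \<mu>]
  define \<rho> where "\<rho> = cdim (A0 ` V)"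
  have d1: "cdim V = cdim {x \<in> V. A0 x = 0} + \<rho>"
    using rank_nullity(3)[OF V endoD(1)[OF A0]] by (simp add: \<rho>_def)
  have d2: "cdim W = cdim {x \<in> W. B0 x = 0} + \<rho>"
    using rank_nullity(3)[OF W endoD(1)[OF B0]] t(1) sh by (simp add: \<rho>_def)
  define k where "k = cdim {x \<in> V. A0 x = 0}"
  define k' where "k' = cdim {x \<in> W. B0 x = 0}"
  have "int (cdim (comm0 W B0)) + (int k)\<^sup>2 = int (cdim (comm0 V A0)) + (int k')\<^sup>2"
    using t(2) sh d1 d2 unfolding \<rho>_def[symmetric] k_def[symmetric] k'_def[symmetric]
    by (simp flip: of_nat_power of_nat_add)
  moreover have "int k' = int k + e" using d1 d2 e by (simp add: k_def k'_def)
  ultimately show ?thesis unfolding k_def[symmetric] by (simp add: power2_eq_square algebra_simps)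
qed

text \<open>The case m_i = 1. The image parts are isomorphic, so the dimension n0 of the kernel of
  \<open>A1\<close> grows by e, while the rank r of \<open>D\<close> is unchanged. The growth is (n0
  + e)^2 - n0^2 + (n0 + e - r)^2 - (n0 - r)^2 = 2 e^2 + 2 e (2 n0 - r), and 2 n0 - r is the
  dimension found in \<open>dim_kernel\<close>.\<close>

lemma dim_comm1_conv:
  assumes V: "findim V" and W: "findim W" and X: "csubspace X"
    and p: "lin X p" "p ` X = W" and F: "lin X F" "F ` X = V"
    and i0: "lin V i0" "\<And>x. x \<in> V \<Longrightarrow> i0 x \<in> X" and i1: "lin V i1" "\<And>x. x \<in> V \<Longrightarrow> i1 x \<in> X"
    and A1: "endo V A1" and A0: "endo V A0" and B1: "endo W B1" and B0: "endo W B0"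
    and ss: "\<And>x. x \<in> V \<Longrightarrow> A1 (A1 x) = 0 \<Longrightarrow> A1 x = 0"
    and Fi1: "\<And>x. x \<in> V \<Longrightarrow> F (i1 x) = A1 x"
    and Fi0: "\<And>x. x \<in> V \<Longrightarrow> F (i0 x) = A0 x + \<mu> *\<^sub>C x"
    and B1p: "\<And>v. v \<in> X \<Longrightarrow> B1 (p v) = p (i1 (F v))"
    and B0p: "\<And>v. v \<in> X \<Longrightarrow> \<exists>z\<in>V. B0 (p v) = p (i0 (F v)) + p (i1 z)"
    and B0i1: "\<And>x. x \<in> V \<Longrightarrow> B0 (p (i1 x)) = p (i0 (A1 x)) + \<mu> *\<^sub>C p (i1 x)"
    and ker: "\<And>x y. x \<in> V \<Longrightarrow> y \<in> V \<Longrightarrow> A1 x = 0 \<Longrightarrow> p (i0 x + i1 y) = 0 \<longleftrightarrow> A1 y + A0 x = 0"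
    and e: "int (cdim W) = int (cdim V) + e"
  shows "int (cdim (comm1 W B1 B0)) = int (cdim (comm1 V A1 A0)) + 2 * e\<^sup>2
    + 2 * e * int (cdim {q \<in> V \<times> V. A1 (fst q) = 0 \<and> A1 (snd q) + A0 (fst q) = 0})"
proof -
  interpret a: fitting V A1 A0 by standard (use V A1 A0 ss in auto)
  note sV = a.sub
  define \<kappa> where "\<kappa> = (\<lambda>x. p (i1 x))"
  define \<tau> where "\<tau> = (\<lambda>x. p (i0 x))"
  have l\<kappa>: "lin V \<kappa>" unfolding \<kappa>_def by (rule lin_comp[of V i1 X p]) (use i1 p in auto)
  have l\<tau>: "lin V \<tau>" unfolding \<tau>_def by (rule lin_comp[of V i0 X p]) (use i0 p in auto)
  have \<kappa>W: "\<kappa> x \<in> W" and \<tau>W: "\<tau> x \<in> W" if "x \<in> V" for x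
    using that i1(2) i0(2) p(2) by (auto simp: \<kappa>_def \<tau>_def)
  have FV: "F v \<in> V" if "v \<in> X" for v using that F(2) by auto
  have \<kappa>0: "\<kappa> x = 0 \<longleftrightarrow> A1 x = 0" if "x \<in> V" for x
    using ker[OF csub_0[OF sV] that] lin_0[OF a.lA1 sV] lin_0[OF a.lA0 sV] lin_0[OF i0(1) sV]
    by (simp add: \<kappa>_def)
  have B1\<kappa>: "B1 (p v) = \<kappa> (F v)" if "v \<in> X" for v using B1p[OF that] by (simp add: \<kappa>_def)
  have B1W: "B1 ` W = \<kappa> ` V"
    unfolding F(2)[symmetric] p(2)[symmetric] image_image using B1\<kappa> by simp
  have B1\<kappa>\<kappa>: "B1 (\<kappa> x) = \<kappa> (A1 x)" if "x \<in> V" for x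
    using B1\<kappa>[OF i1(2)[OF that]] Fi1[OF that] by (simp add: \<kappa>_def)
  interpret b: fitting W B1 B0
  proof
    fix w assume w: "w \<in> W" "B1 (B1 w) = 0"
    then obtain x where x: "x \<in> V" "B1 w = \<kappa> x" using B1W by blast
    then have "\<kappa> (A1 x) = 0" using w B1\<kappa>\<kappa> by simp
    then have "A1 x = 0" using \<kappa>0 a.A1_in x ss by blast
    then show "B1 w = 0" using \<kappa>0 x by simp
  qed (use W B1 B0 in auto)
  have bI: "b.I = \<kappa> ` V" using B1W by (simp add: b.I_def)
  have \<kappa>I: "\<kappa> x \<in> b.I" if "x \<in> V" for x using that bI by blast
  \<comment> \<open>The map \<open>A1 x\<close> \<mapsto> \<open>\<kappa> x\<close>, which
    identifies the image of \<open>A1\<close> with the image of \<open>B1\<close>.\<close>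
  define \<eta> where "\<eta> = (\<lambda>y. \<kappa> (a.J y))"
  have \<kappa>Q: "\<kappa> (a.Q x) = \<kappa> x" if x: "x \<in> V" for x
  proof -
    have "\<kappa> (a.P x) = 0" using \<kappa>0 a.P_in[OF x] a.N_A1 a.NS by auto
    then have "\<kappa> (a.P x + a.Q x) = \<kappa> (a.Q x)" using lin_add[OF l\<kappa> a.P_S a.Q_S] x by simp
    then show ?thesis using a.PQ[of x] by simp
  qed
  have \<eta>A: "\<eta> (A1 x) = \<kappa> x" if "x \<in> V" for x
    using \<kappa>Q[OF that] by (simp add: \<eta>_def a.Q_def)
  have l\<eta>: "lin a.I \<eta>" unfolding \<eta>_def
    using a.J_in a.IS by (intro lin_comp[of a.I a.J V \<kappa>] a.lJ l\<kappa>) auto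
  have im\<eta>: "\<eta> ` a.I = b.I" unfolding bI a.I_def image_image using \<eta>A by simp
  have inj\<eta>: "y = 0" if "y \<in> a.I" "\<eta> y = 0" for y
    using that \<eta>A \<kappa>0 by (auto simp: a.I_def)
  obtain \<zeta> where iso: "lin_iso a.I b.I \<eta> \<zeta>" using lin_isoI[OF a.subI l\<eta> im\<eta> inj\<eta>] by blast
  have \<eta>I: "\<eta> y \<in> b.I" if "y \<in> a.I" for y using that im\<eta> by blast
  have B1\<eta>: "B1 (\<eta> y) = \<eta> (A1 y)" if "y \<in> a.I" for y
    using that \<eta>A B1\<kappa>\<kappa> a.A1_in by (auto simp: a.I_def)
  \<comment> \<open>One summand \<mu> comes from \<open>Fi0\<close>, by applying \<open>B1\<close>
    to \<open>\<tau> y\<close>; the other is the explicit one in \<open>B0i1\<close>.\<close>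
  have d\<eta>: "b.d (\<eta> y) = \<eta> (a.d y + (2 * \<mu>) *\<^sub>C y)" if y: "y \<in> a.I" for y
  proof -
    have yV: "y \<in> V" "A0 y \<in> V" "\<mu> *\<^sub>C y \<in> V" "A0 y + \<mu> *\<^sub>C y \<in> V"
      using y a.IS a.A0_in csub_scale[OF sV] csub_add[OF sV] by (auto simp: subset_iff)
    have yI: "\<mu> *\<^sub>C y \<in> a.I" "a.d y \<in> a.I" "a.d y + \<mu> *\<^sub>C y \<in> a.I"
      using y a.Q_in yV csub_scale[OF a.subI] csub_add[OF a.subI] by auto
    obtain x where x: "x \<in> V" "y = A1 x" using y by (auto simp: a.I_def)
    have "\<kappa> (a.d y + \<mu> *\<^sub>C y) = \<kappa> (A0 y + \<mu> *\<^sub>C y)"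
      using yV yI a.Q_S a.Q_I lin_add[OF l\<kappa>] \<kappa>Q by simp
    moreover have "B1 (\<eta> (a.d y + \<mu> *\<^sub>C y)) = \<kappa> (a.d y + \<mu> *\<^sub>C y)"
      using B1\<eta>[OF yI(3)] \<eta>A yI(3) a.IS by auto
    moreover have "B1 (\<tau> y) = \<kappa> (A0 y + \<mu> *\<^sub>C y)"
      using B1\<kappa>[OF i0(2)[OF yV(1)]] Fi0[OF yV(1)] by (simp add: \<tau>_def)
    ultimately have "b.Q (\<tau> y) = b.J (B1 (\<eta> (a.d y + \<mu> *\<^sub>C y)))" by (simp add: b.Q_def)
    also have "\<dots> = \<eta> (a.d y + \<mu> *\<^sub>C y)" using b.JA1 \<eta>I yI by blast
    finally have 1: "b.Q (\<tau> y) = \<eta> (a.d y + \<mu> *\<^sub>C y)" .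
    have "\<eta> y = \<kappa> x" using \<eta>A x by simp
    then have "B0 (\<eta> y) = \<tau> y + \<mu> *\<^sub>C \<eta> y"
      using B0i1[OF x(1)] x(2) by (simp add: \<kappa>_def \<tau>_def)
    moreover have "\<eta> y \<in> W" "\<mu> *\<^sub>C \<eta> y \<in> b.I" "\<mu> *\<^sub>C \<eta> y \<in> W"
      using \<eta>I[OF y] b.IS csub_scale[OF b.subI] by auto
    ultimately have "b.d (\<eta> y) = \<eta> (a.d y + \<mu> *\<^sub>C y) + \<mu> *\<^sub>C \<eta> y"
      using lin_add[OF b.lQ \<tau>W[OF yV(1)]] 1 b.Q_I by simp
    also have "\<dots> = \<eta> ((a.d y + \<mu> *\<^sub>C y) + \<mu> *\<^sub>C y)"
      using lin_add[OF l\<eta> yI(3) yI(1)] lin_scale[OF l\<eta> y] by simp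
    also have "(a.d y + \<mu> *\<^sub>C y) + \<mu> *\<^sub>C y = a.d y + (2 * \<mu>) *\<^sub>C y"
      by (simp only: mult_2 cscale_add_left add.assoc)
    finally show ?thesis .
  qed
  have commI: "cdim (comm1 b.I B1 b.d) = cdim (comm1 a.I A1 a.d)"
    by (rule lin_iso.dim_comm1[OF iso a.fdI a.A1_endo_I a.d_endo, where c = "2 * \<mu>"])
      (use B1\<eta> d\<eta> in auto)
  \<comment> \<open>On the kernels of \<open>A1\<close> and \<open>B1\<close> this is the map that
    relates the compressions \<open>a.D\<close> and \<open>b.D\<close>, in the role that
    \<open>p\<close> after \<open>i0\<close> has for a single operator.\<close>
  define \<sigma> where "\<sigma> = (\<lambda>y. b.P (\<tau> y))"
  have l\<sigma>: "lin V \<sigma>" unfolding \<sigma>_def using \<tau>W by (intro lin_comp[of V \<tau> W b.P] l\<tau> b.lP) auto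
  have bD: "F v \<in> a.N \<and> b.D (p v) = \<sigma> (F v)" if v: "v \<in> X" "p v \<in> b.N" for v
  proof
    show FN: "F v \<in> a.N" using that B1\<kappa>[OF v(1)] b.N_A1[OF v(2)] \<kappa>0 FV[OF v(1)] by (simp add: a.N_def)
    obtain z where z: "z \<in> V" "B0 (p v) = \<tau> (F v) + \<kappa> z" using B0p[OF v(1)] by (auto simp: \<tau>_def \<kappa>_def)
    show "b.D (p v) = \<sigma> (F v)"
      using z lin_add[OF b.lP \<tau>W[OF FV[OF v(1)]] \<kappa>W[OF z(1)]] b.P_I[OF \<kappa>I[OF z(1)]] by (simp add: \<sigma>_def)
  qed
  have im\<sigma>: "\<sigma> ` a.N = b.D ` b.N"
  proof (intro equalityI subsetI)
    fix t assume "t \<in> \<sigma> ` a.N"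
    then obtain y where y: "y \<in> a.N" "t = \<sigma> y" by blast
    then obtain v where v: "v \<in> X" "F v = y" using F(2) a.NS by blast
    have "p v \<in> b.N" using v y B1\<kappa>[OF v(1)] \<kappa>0 a.N_A1 a.NS p(2) by (auto simp: b.N_def)
    then show "t \<in> b.D ` b.N" using bD v y by force
  next
    fix t assume "t \<in> b.D ` b.N"
    then obtain w where w: "w \<in> b.N" "t = b.D w" by blast
    then obtain v where "v \<in> X" "w = p v" using p(2) b.NS by blast
    then show "t \<in> \<sigma> ` a.N" using bD w by force
  qed
  have \<sigma>0: "\<sigma> y = 0 \<longleftrightarrow> a.D y = 0" if y: "y \<in> a.N" for y
  proof -
    have yV: "y \<in> V" "A1 y = 0" "A0 y \<in> V" using y a.NS a.N_A1 a.A0_in by auto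
    \<comment> \<open>The vector \<open>\<sigma> y\<close> vanishes when \<open>\<tau> y\<close>
      lies in the image of \<open>B1\<close>, that is, equals some \<open>\<kappa> z\<close>. By
      \<open>ker\<close> this means that A0 y = A1 z, so that A0 y lies in the image of
      \<open>A1\<close>.\<close>
    have "\<sigma> y = 0 \<longleftrightarrow> \<tau> y \<in> b.I"
    proof
      assume "\<sigma> y = 0"
      then have "\<tau> y = b.Q (\<tau> y)" using b.PQ[of "\<tau> y"] by (simp add: \<sigma>_def)
      then show "\<tau> y \<in> b.I" using b.Q_in[OF \<tau>W[OF yV(1)]] by simp
    qed (simp add: \<sigma>_def b.P_I)
    also have "\<dots> \<longleftrightarrow> (\<exists>z\<in>V. \<tau> y = \<kappa> z)" by (auto simp: bI)
    also have "\<dots> \<longleftrightarrow> (\<exists>z\<in>V. A0 y = A1 z)"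
    proof (intro bex_cong refl)
      fix z assume z: "z \<in> V"
      then have mz: "- z \<in> V" using csub_neg[OF sV] by blast
      have "p (i0 y + i1 (- z)) = \<tau> y - \<kappa> z"
        unfolding lin_add[OF p(1) i0(2)[OF yV(1)] i1(2)[OF mz]]
        using lin_neg[OF l\<kappa> sV z] unfolding \<tau>_def \<kappa>_def by (simp only: diff_conv_add_uminus)
      then have "\<tau> y = \<kappa> z \<longleftrightarrow> p (i0 y + i1 (- z)) = 0" by simp
      also have "\<dots> \<longleftrightarrow> A1 (- z) + A0 y = 0" by (rule ker[OF yV(1) mz yV(2)])
      also have "A1 (- z) + A0 y = A0 y - A1 z" by (simp add: lin_neg[OF a.lA1 sV z])
      also have "A0 y - A1 z = 0 \<longleftrightarrow> A0 y = A1 z" by simp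
      finally show "\<tau> y = \<kappa> z \<longleftrightarrow> A0 y = A1 z" .
    qed
    also have "\<dots> \<longleftrightarrow> A0 y \<in> a.I" by (auto simp: a.I_def)
    also have "\<dots> \<longleftrightarrow> a.D y = 0"
    proof
      assume "a.D y = 0"
      then have "A0 y = a.Q (A0 y)" using a.PQ[of "A0 y"] by simp
      then show "A0 y \<in> a.I" using a.Q_in[OF yV(3)] by simp
    qed (rule a.P_I)
    finally show ?thesis .
  qed
  have sh\<sigma>: "b.D (\<sigma> y) = \<sigma> (a.D y + \<mu> *\<^sub>C y)" if y: "y \<in> a.N" for y
  proof -
    have yV: "y \<in> V" "A0 y \<in> V" "\<mu> *\<^sub>C y \<in> V" "\<mu> *\<^sub>C y \<in> a.N"
      using y a.NS a.A0_in csub_scale[OF sV] csub_scale[OF a.subN] by auto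
    have "b.Q (\<tau> y) \<in> \<kappa> ` V" using b.Q_in[OF \<tau>W[OF yV(1)]] bI by simp
    then obtain z where z: "z \<in> V" "b.Q (\<tau> y) = \<kappa> z" by blast
    \<comment> \<open>A preimage of \<open>\<sigma> y\<close> under \<open>p\<close>: subtracting
      \<open>i1 z\<close> removes the component of \<open>\<tau> y\<close> in the image of
      \<open>B1\<close>, so that \<open>bD\<close> applies.\<close>
    define v where "v = i0 y - i1 z"
    have v: "v \<in> X" using csub_diff[OF X i0(2) i1(2)] yV z by (simp add: v_def)
    have pv: "p v = \<sigma> y"
      using lin_diff[OF p(1) X i0(2)[OF yV(1)] i1(2)[OF z(1)]] z
      by (simp add: v_def \<sigma>_def b.P_def \<tau>_def \<kappa>_def)
    moreover have "\<sigma> y \<in> b.N" using b.P_in[OF \<tau>W[OF yV(1)]] by (simp add: \<sigma>_def)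
    ultimately have b: "F v \<in> a.N" "b.D (\<sigma> y) = \<sigma> (F v)" using bD[OF v] by auto
    have "F v = (A0 y + \<mu> *\<^sub>C y) - A1 z"
      using lin_diff[OF F(1) X i0(2)[OF yV(1)] i1(2)[OF z(1)]] Fi0[OF yV(1)] Fi1[OF z(1)] by (simp add: v_def)
    then have "a.P (F v) = a.D y + \<mu> *\<^sub>C y"
      using lin_diff[OF a.lP sV csub_add[OF sV yV(2,3)] a.A1_in[OF z(1)]] lin_add[OF a.lP yV(2,3)]
        a.P_I[OF a.A1_I[OF z(1)]] a.P_N[OF yV(4)] by simp
    then show ?thesis using b a.P_N by simp
  qed
  have t: "cdim (b.D ` b.N) = cdim (a.D ` a.N)"
    "cdim (comm0 b.N b.D) + (cdim a.N - cdim (a.D ` a.N))\<^sup>2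
       = cdim (comm0 a.N a.D) + (cdim b.N - cdim (a.D ` a.N))\<^sup>2"
    by (rule dim_comm0_transfer[OF a.fdN a.D_endo b.fdN b.D_endo lin_subset[OF l\<sigma> a.NS] im\<sigma>, where c = \<mu>];
      use \<sigma>0 sh\<sigma> in blast)+
  define r where "r = cdim (a.D ` a.N)"
  define n0 where "n0 = cdim a.N"
  define n0' where "n0' = cdim b.N"
  have le: "r \<le> n0" "r \<le> n0'" using a.dim_kernel(2) b.dim_kernel(2) t(1) by (auto simp: r_def n0_def n0'_def)
  have "cdim b.I = cdim a.I" using dim_bij(2)[OF a.subI l\<eta> im\<eta> inj\<eta> a.fdI] .
  then have n0': "int n0' = int n0 + e"
    using a.dim_NI b.dim_NI e by (simp add: n0_def n0'_def)
  have k: "int (cdim {q \<in> V \<times> V. A1 (fst q) = 0 \<and> A1 (snd q) + A0 (fst q) = 0}) = 2 * int n0 - int r"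
    using a.dim_kernel(1) le(1) by (simp add: n0_def r_def of_nat_diff)
  have t2: "int (cdim (comm0 b.N b.D)) + (int n0 - int r)\<^sup>2 = int (cdim (comm0 a.N a.D)) + (int n0' - int r)\<^sup>2"
    using arg_cong[OF t(2), of int] le unfolding r_def[symmetric] n0_def[symmetric] n0'_def[symmetric]
    by (simp add: of_nat_diff)
  have a: "int (cdim (comm1 V A1 A0)) = (int n0)\<^sup>2 + int (cdim (comm0 a.N a.D)) + int (cdim (comm1 a.I A1 a.d))"
    using a.dim_comm1_split by (simp add: n0_def)
  have b: "int (cdim (comm1 W B1 B0)) = (int n0')\<^sup>2 + int (cdim (comm0 b.N b.D)) + int (cdim (comm1 a.I A1 a.d))"
    using b.dim_comm1_split commI by (simp add: n0'_def)
  show ?thesis unfolding a b k using t2 unfolding n0' by (simp add: power2_eq_square algebra_simps)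
qed

section \<open>The convolution space\<close>

declare One_nat_def [simp del]

lemma lin_sumf: "(\<And>k. k \<in> E \<Longrightarrow> lin S (f k)) \<Longrightarrow> lin S (\<lambda>x. \<Sum>k\<in>E. f k x)"
  by (induction E rule: infinite_finite_induct) (simp_all add: lin_zero lin_plus)

lemma sum_fun_apply: "(\<Sum>k\<in>S. f k) x = (\<Sum>k\<in>S. f k x)"
  by (induction S rule: infinite_finite_induct) simp_all

definition complete_on :: "nat \<Rightarrow> (nat \<Rightarrow> nat \<Rightarrow> 'a::cvs \<Rightarrow> 'a) \<Rightarrow> nat \<Rightarrow> nat \<Rightarrow> 'a \<Rightarrow> 'a" where
  "complete_on r A i j = (if i = 0 \<and> j = 0 then \<lambda>x. - (\<Sum>k\<in>{1..r}. A k 0 x) else A i j)"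

definition commutant_dim :: "'a::cvs set \<Rightarrow> nat \<Rightarrow> (nat \<Rightarrow> 'a \<Rightarrow> 'a) \<Rightarrow> nat" where
  "commutant_dim S m B = (if m = 0 then cdim (comm0 S (B 0)) else cdim (comm1 S (B 1) (B 0)))"

definition idx_on :: "'a::cvs set \<Rightarrow> nat \<Rightarrow> (nat \<Rightarrow> nat) \<Rightarrow> (nat \<Rightarrow> nat \<Rightarrow> 'a \<Rightarrow> 'a) \<Rightarrow> int" where
  "idx_on S r m A = (\<Sum>i\<le>r. int (commutant_dim S (m i) (complete_on r A i)))
     - (int (r + (\<Sum>i\<le>r. m i)) - 1) * (int (cdim S))\<^sup>2"

text \<open>Removes the shifts at i = 0; the identity map intertwines an operator with its
  shift.\<close>

lemma dim_comm_shift: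
  assumes "findim S" "endo S A1" "endo S A0"
  shows "cdim (comm1 S A1 (\<lambda>x. A0 x + c *\<^sub>C x)) = cdim (comm1 S A1 A0)"
    and "cdim (comm0 S (\<lambda>x. A0 x + c *\<^sub>C x)) = cdim (comm0 S A0)"
proof -
  have "lin_iso S S (\<lambda>x. x) (\<lambda>x. x)"
    using assms(1) by (simp add: lin_iso_def findim_sub lin_id)
  then interpret lin_iso S S "\<lambda>x. x" "\<lambda>x. x" .
  show "cdim (comm1 S A1 (\<lambda>x. A0 x + c *\<^sub>C x)) = cdim (comm1 S A1 A0)"
    by (rule dim_comm1[OF assms(1-3), where c = c]) auto
  show "cdim (comm0 S (\<lambda>x. A0 x + c *\<^sub>C x)) = cdim (comm0 S A0)"
    by (rule dim_comm0[OF assms(1,3), where c = c]) auto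
qed

lemma entries_Sigma: "entries r m = (SIGMA i:{..r}. {(if i = 0 then 1 else 0)..m i})"
  by (auto simp: entries_def)

lemma finite_entries: "finite (entries r m)"
  unfolding entries_Sigma by auto

text \<open>The number M of the index formula: i contributes m_i + 1 entries, and (0, 0) is left
  out.\<close>

lemma card_entries: "card (entries r m) = r + (\<Sum>i\<le>r. m i)"
proof -
  have "card (entries r m) = (\<Sum>i\<le>r. Suc (m i) - (if i = 0 then 1 else 0))"
    unfolding entries_Sigma by (subst card_SigmaI) auto
  also have "\<dots> = r + (\<Sum>i\<le>r. m i)"
    by (induction r) auto
  finally show ?thesis .
qed

section \<open>The convolution on a subspace and its factorisation\<close>

locale mc_data =
  fixes V :: "'a::cvs set" and r :: nat and m :: "nat \<Rightarrow> nat" and A :: "nat \<Rightarrow> nat \<Rightarrow> 'a \<Rightarrow> 'a"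
    and \<mu> :: complex
  assumes V: "findim V" and r: "1 \<le> r" and m: "\<And>i. i \<le> r \<Longrightarrow> m i \<le> 1"
    and A: "\<And>i j. (i, j) \<in> entries r m \<Longrightarrow> endo V (A i j)"
begin

abbreviation E :: "(nat \<times> nat) set" where "E \<equiv> entries r m"

definition X :: "(nat \<times> nat \<Rightarrow> 'a) set" where "X = fun_space E (\<lambda>_. V)"

definition csum :: "(nat \<times> nat \<Rightarrow> 'a) \<Rightarrow> 'a" where
  "csum v = (\<Sum>k\<in>E. A (fst k) (snd k) (v k))"

definition conv :: "nat \<Rightarrow> nat \<Rightarrow> (nat \<times> nat \<Rightarrow> 'a) \<Rightarrow> nat \<times> nat \<Rightarrow> 'a" where
  "conv i j v = (\<lambda>k. if k \<notin> E \<or> fst k \<noteq> i \<or> snd k < j then 0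
     else if j < snd k then \<mu> *\<^sub>C v (i, snd k - j)
     else if i = 0 then csum v else \<mu> *\<^sub>C v (i, 0) + csum v)"

text \<open>The convention that A^(i)_1 = 0 when m_i = 0 lets both cases share the formulas
  below.\<close>

definition a1 :: "nat \<Rightarrow> 'a \<Rightarrow> 'a" where
  "a1 i x = (if m i = 1 then A i 1 x else 0)"

definition a00 :: "'a \<Rightarrow> 'a" where
  "a00 x = - (\<Sum>k\<in>{1..r}. A k 0 x)"

text \<open>For \<open>\<mu> \<noteq> 0\<close> this is $\mathcal{K} + \mathcal{L}(\mu)$: the vector \<open>l\<close> parametrises the
  $\mathcal{L}(\mu)$-component, and \<open>v (i, 0) + l\<close> is the component in $\mathcal{K}$.\<close>
definition QQ :: "(nat \<times> nat \<Rightarrow> 'a) set" where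
  "QQ = {v \<in> X. if \<mu> = 0 then csum v = 0 else
     (\<exists>l\<in>V. a1 0 l = 0 \<and> a00 l - \<mu> *\<^sub>C l + a1 0 (v (0, 1)) = 0 \<and>
       (\<forall>i\<in>{1..r}. a1 i (v (i, 0) + l) = 0 \<and> A i 0 (v (i, 0) + l) + a1 i (v (i, 1)) = 0))}"

lemma sub: "csubspace V"
  by (rule findim_sub[OF V])

lemma E0: "(0, 1) \<in> E \<longleftrightarrow> m 0 = 1" and E0': "(0, 0) \<notin> E"
  and Ei0: "i \<in> {1..r} \<Longrightarrow> (i, 0) \<in> E" and Ei1: "i \<le> r \<Longrightarrow> (i, 1) \<in> E \<longleftrightarrow> m i = 1"
  using m[of 0] m[of i] by (auto simp: entries_def)

lemma E_cases: "k \<in> E \<Longrightarrow> (\<exists>i\<in>{1..r}. k = (i, 0)) \<or> (\<exists>i\<le>r. m i = 1 \<and> k = (i, 1))"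
proof -
  assume k: "k \<in> E"
  obtain i j where [simp]: "k = (i, j)" by (cases k)
  have "j = 0 \<or> j = 1" using k m[of i] by (auto simp: entries_def)
  then show ?thesis using k m[of i] by (auto simp: entries_def split: if_splits)
qed

lemma endo_a1: "i \<le> r \<Longrightarrow> endo V (a1 i)"
proof (cases "m i = 1")
  case True
  assume "i \<le> r"
  then have "endo V (A i 1)" using A Ei1 True by blast
  then show ?thesis using lin_cong[OF _ sub, of "A i 1" "a1 i"] True by (simp add: endo_def a1_def)
next
  case False
  then have "a1 i = (\<lambda>x. 0)" by (auto simp: a1_def)
  then show ?thesis using csub_0[OF sub] by (simp add: endo_def lin_zero)
qed

lemma endo_A0: "i \<in> {1..r} \<Longrightarrow> endo V (A i 0)"
  using A Ei0 by blast

lemma endo_a00: "endo V a00"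
proof -
  have "lin V (\<lambda>x. - (\<Sum>k\<in>{1..r}. A k 0 x))"
    using endo_A0 by (intro lin_uminus lin_sumf) (auto simp: endo_def)
  moreover have "- (\<Sum>k\<in>{1..r}. A k 0 x) \<in> V" if "x \<in> V" for x
    using that endo_A0 by (intro csub_neg[OF sub] cv.subspace_sum[OF sub]) (auto simp: endo_def)
  ultimately show ?thesis by (simp add: endo_def a00_def[abs_def])
qed

lemmas la1 = endoD(1)[OF endo_a1] and lA0 = endoD(1)[OF endo_A0] and la00 = endoD(1)[OF endo_a00]
lemmas a00_in = endoD(2)[OF endo_a00]

lemma fdX: "findim X" and dimX: "cdim X = (r + (\<Sum>i\<le>r. m i)) * cdim V"
  using dim_fun_space[OF finite_entries, of r m "\<lambda>_. V"] V by (auto simp: X_def card_entries)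

lemma subX: "csubspace X"
  by (rule findim_sub[OF fdX])

lemma X_in: "v \<in> X \<Longrightarrow> v k \<in> V"
  using csub_0[OF sub] by (cases "k \<in> E") (auto simp: X_def fun_space_def simp del: split_paired_All)

lemma X_out: "v \<in> X \<Longrightarrow> k \<notin> E \<Longrightarrow> v k = 0"
  unfolding X_def fun_space_def by blast

lemma X_I: "(\<And>k. k \<in> E \<Longrightarrow> v k \<in> V) \<Longrightarrow> (\<And>k. k \<notin> E \<Longrightarrow> v k = 0) \<Longrightarrow> v \<in> X"
  by (auto simp: X_def fun_space_def)

lemma lin_eval: "lin S (\<lambda>v. v k)"
  by (rule linI) auto

lemma lin_A_eval: "k \<in> E \<Longrightarrow> lin X (\<lambda>v. A (fst k) (snd k) (v k))"
  using A[of "fst k" "snd k"] X_in[of _ k] by (intro lin_comp[of X "\<lambda>v. v k" V "A (fst k) (snd k)"] lin_eval) (auto simp: endo_def)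

lemma lin_csum: "lin X csum"
  unfolding csum_def by (intro lin_sumf lin_A_eval)

lemma csum_in: "v \<in> X \<Longrightarrow> csum v \<in> V"
  unfolding csum_def
proof (rule cv.subspace_sum[OF sub])
  fix k assume "v \<in> X" "k \<in> E"
  then show "A (fst k) (snd k) (v k) \<in> V"
    using endoD(2)[OF A[of "fst k" "snd k"] X_in[of v k]] by simp
qed

lemma csum_eq:
  assumes "v \<in> X"
  shows "csum v = (\<Sum>i\<in>{1..r}. A i 0 (v (i, 0)) + a1 i (v (i, 1))) + a1 0 (v (0, 1))"
proof -
  let ?g = "\<lambda>i. \<Sum>j\<in>{(if i = 0 then 1 else 0)..m i}. A i j (v (i, j))"
  have "csum v = (\<Sum>i\<le>r. ?g i)"
    unfolding csum_def entries_Sigma by (subst sum.Sigma) (auto simp: case_prod_beta)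
  also have "{..r} = insert 0 {1..r}" by auto
  also have "(\<Sum>i\<in>insert 0 {1..r}. ?g i) = ?g 0 + (\<Sum>i\<in>{1..r}. ?g i)" by simp
  also have "?g 0 = a1 0 (v (0, 1))"
  proof -
    have "m 0 = 0 \<or> m 0 = 1" using m[of 0] by auto
    then show ?thesis by (auto simp: a1_def)
  qed
  also have "(\<Sum>i\<in>{1..r}. ?g i) = (\<Sum>i\<in>{1..r}. A i 0 (v (i, 0)) + a1 i (v (i, 1)))"
  proof (rule sum.cong[OF refl])
    fix i assume i: "i \<in> {1..r}"
    then have "m i = 0 \<or> m i = 1" using m[of i] by auto
    moreover have "{0..1} = {0, 1 :: nat}" by auto
    ultimately show "?g i = A i 0 (v (i, 0)) + a1 i (v (i, 1))"
      using i by (auto simp: a1_def)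
  qed
  finally show ?thesis by (simp add: add.commute)
qed

text \<open>The maps $\iota$ and $\Phi$: \<open>i1\<close>, \<open>i0\<close> are the coefficients of $\iota$ and \<open>F\<close> is the constant
  term of $\Phi$.  At \<open>i = 0\<close> the operators in question are \<open>a00 - \<mu>\<close> on the given space and
  $\tilde A^{(0)}_0 + \mu$ on the convolution.\<close>
definition i1 :: "nat \<Rightarrow> 'a \<Rightarrow> nat \<times> nat \<Rightarrow> 'a" where
  "i1 i x = (\<lambda>k. if k = (i, 1) then x else 0)"

definition i0 :: "nat \<Rightarrow> 'a \<Rightarrow> nat \<times> nat \<Rightarrow> 'a" where
  "i0 i x = (\<lambda>k. if i = 0 then (if fst k \<in> {1..r} \<and> snd k = 0 then - x else 0) else if k = (i, 0) then x else 0)"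

definition F :: "nat \<Rightarrow> (nat \<times> nat \<Rightarrow> 'a) \<Rightarrow> 'a" where
  "F i v = (if i = 0 then csum v else csum v + \<mu> *\<^sub>C v (i, 0))"

definition a0 :: "nat \<Rightarrow> 'a \<Rightarrow> 'a" where
  "a0 i x = (if i = 0 then a00 x - \<mu> *\<^sub>C x else A i 0 x)"

lemma lin_i1: "lin S (i1 i)" and lin_i0: "lin S (i0 i)"
  by (rule linI; auto simp: i1_def i0_def fun_eq_iff)+

lemma i1_X: "i \<le> r \<Longrightarrow> m i = 1 \<or> x = 0 \<Longrightarrow> x \<in> V \<Longrightarrow> i1 i x \<in> X"
  using Ei1 csub_0[OF sub] by (intro X_I) (auto simp: i1_def)

lemma i0_X: "i \<le> r \<Longrightarrow> x \<in> V \<Longrightarrow> i0 i x \<in> X"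
  using Ei0 csub_0[OF sub] csub_neg[OF sub] by (intro X_I) (auto simp: i0_def)

lemma lin_F: "lin X (F i)"
  unfolding F_def by (cases "i = 0") (auto intro!: lin_plus lin_csum lin_cscale lin_eval)

lemma F_in: "v \<in> X \<Longrightarrow> F i v \<in> V"
  using csum_in X_in csub_add[OF sub] csub_scale[OF sub] by (auto simp: F_def)

lemma endo_a0: "i \<le> r \<Longrightarrow> endo V (a0 i)"
proof (cases "i = 0")
  case True
  have "a0 i = (\<lambda>x. a00 x + (- \<mu>) *\<^sub>C x)" using True by (auto simp: a0_def)
  show ?thesis unfolding \<open>a0 i = _\<close> by (rule endo_shift[OF sub endo_a00])
next
  case False
  assume "i \<le> r"
  with False endo_A0[of i] show ?thesis by (simp add: a0_def[abs_def])
qed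

lemma z: "i \<le> r \<Longrightarrow> a1 i 0 = 0" "i \<in> {1..r} \<Longrightarrow> A i 0 0 = 0" "a00 0 = 0"
  using lin_0[OF la1 sub] lin_0[OF lA0 sub] lin_0[OF la00 sub] by auto

text \<open>The sign in \<open>i0 0\<close> turns the sum of the A k 0 into the completed
  coefficient \<open>a00\<close>.\<close>

lemma csum_i: 
  assumes "i \<le> r" "x \<in> V" "y \<in> V" "m i = 1 \<or> y = 0"
  shows "csum (i0 i x + i1 i y) = (if i = 0 then a00 x else A i 0 x) + a1 i y"
proof -
  have X: "i0 i x + i1 i y \<in> X" using assms by (intro csub_add[OF subX] i0_X i1_X)
  show ?thesis
  proof (cases "i = 0")
    case True
    have "A k 0 (- x) = - A k 0 x" if "k \<in> {1..r}" for k using lin_neg[OF lA0 sub] that assms by simp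
    then show ?thesis using True unfolding csum_eq[OF X]
      by (simp add: i0_def i1_def a00_def z sum_negf)
  next
    case False
    then have i: "i \<in> {1..r}" using assms by auto
    have "(\<Sum>k\<in>{1..r}. A k 0 ((i0 i x + i1 i y) (k, 0)) + a1 k ((i0 i x + i1 i y) (k, 1)))
        = (\<Sum>k\<in>{1..r}. if k = i then A i 0 x + a1 i y else 0)"
      using False by (intro sum.cong refl) (auto simp: i0_def i1_def z)
    also have "\<dots> = A i 0 x + a1 i y" using i by simp
    finally show ?thesis using False unfolding csum_eq[OF X] by (simp add: i0_def i1_def z)
  qed
qed

text \<open>For i \<noteq> 0 the scalar \<mu> stems from the extra term of \<open>F\<close>; for i =
  0 it compensates the shift in \<open>a0\<close>. Thus one formula serves all i.\<close>

lemma F_i: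
  assumes "i \<le> r" "x \<in> V" "y \<in> V" "m i = 1 \<or> y = 0"
  shows "F i (i0 i x + i1 i y) = a0 i x + \<mu> *\<^sub>C x + a1 i y"
  using csum_i[OF assms] by (cases "i = 0") (auto simp: F_def a0_def i0_def i1_def algebra_simps)

lemma F_i1: "i \<le> r \<Longrightarrow> m i = 1 \<Longrightarrow> x \<in> V \<Longrightarrow> F i (i1 i x) = a1 i x"
  using F_i[of i 0 x] csub_0[OF sub] lin_0[OF lin_i0 sub, of i] lin_0[OF endoD(1)[OF endo_a0] sub, of i] by simp

lemma F_i0: "i \<le> r \<Longrightarrow> x \<in> V \<Longrightarrow> F i (i0 i x) = a0 i x + \<mu> *\<^sub>C x"
  using F_i[of i x 0] csub_0[OF sub] lin_0[OF lin_i1 sub, of i] z(1)[of i] by simp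

lemma conv_i1:
  assumes "i \<le> r" "m i = 1"
  shows "conv i 1 v = i1 i (F i v)"
proof
  fix k
  show "conv i 1 v k = i1 i (F i v) k"
    using E_cases[of k] Ei1[OF assms(1)] assms by (cases "k \<in> E") (auto simp: conv_def i1_def F_def add.commute)
qed

text \<open>The \<epsilon>-coefficient of the factorisation. Its second term is \<open>i1\<close>
  applied to the \<epsilon>-coefficient \<mu> v (i, 1) of the surjective factor.\<close>

lemma conv_i0:
  assumes i: "i \<in> {1..r}" and v: "v \<in> X"
  shows "conv i 0 v = i0 i (F i v) + i1 i (\<mu> *\<^sub>C v (i, 1))"
proof
  fix k
  have "m i = 0 \<Longrightarrow> v (i, 1) = 0" using X_out[OF v] Ei1[of i] i by auto
  then show "conv i 0 v k = (i0 i (F i v) + i1 i (\<mu> *\<^sub>C v (i, 1))) k"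
    using E_cases[of k] Ei0[OF i] Ei1[of i] i m[of i] by (cases "k \<in> E") (auto simp: conv_def i0_def i1_def F_def add.commute)
qed

text \<open>The reason for the shift at i = 0: adding \<mu> v cancels the multiples \<mu> v (k, j)
  with k \<ge> 1 produced by the \<open>conv k 0\<close>. Left are - csum v at each (k, 0) and \<mu>
  v at (0, 1), again of the factorised form.\<close>

lemma conv_00:
  assumes v: "v \<in> X"
  shows "- (\<Sum>k\<in>{1..r}. conv k 0 v) + \<mu> *\<^sub>C v = i0 0 (F 0 v) + i1 0 (\<mu> *\<^sub>C v (0, 1))"
proof
  fix k :: "nat \<times> nat"
  obtain a b where k: "k = (a, b)" by (cases k)
  have s: "(\<Sum>k\<in>{1..r}. conv k 0 v) k = (\<Sum>i\<in>{1..r}. conv i 0 v k)" for k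
    by (rule sum_fun_apply)
  have t: "(\<Sum>i\<in>{1..r}. conv i 0 v k) = (if a \<in> {1..r} then conv a 0 v k else 0)"
  proof -
    have "(\<Sum>i\<in>{1..r}. conv i 0 v k) = (\<Sum>i\<in>{1..r}. if i = a then conv a 0 v k else 0)"
      by (intro sum.cong refl) (auto simp: conv_def k)
    then show ?thesis by simp
  qed
  have "(- (\<Sum>k\<in>{1..r}. conv k 0 v) + \<mu> *\<^sub>C v) k
      = - (if a \<in> {1..r} then conv a 0 v k else 0) + \<mu> *\<^sub>C v k"
    by (simp only: plus_fun_apply uminus_apply cscale_fun_apply s t)
  then show "(- (\<Sum>k\<in>{1..r}. conv k 0 v) + \<mu> *\<^sub>C v) k = (i0 0 (F 0 v) + i1 0 (\<mu> *\<^sub>C v (0, 1))) k"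
  proof (rule trans)
    show "- (if a \<in> {1..r} then conv a 0 v k else 0) + \<mu> *\<^sub>C v k = (i0 0 (F 0 v) + i1 0 (\<mu> *\<^sub>C v (0, 1))) k"
  proof (cases "k \<in> E")
    case True
    then show ?thesis using E_cases[OF True] E0' unfolding k
      by (auto simp: conv_def i0_def i1_def F_def)
  next
    case False
    then have "v k = 0" by (rule X_out[OF v])
    with False show ?thesis using E0 Ei0 X_out[OF v, of "(0, 1)"] unfolding k
      by (auto simp: conv_def i0_def i1_def F_def)
  qed
  qed
qed

lemma conv_X: "i \<le> r \<Longrightarrow> v \<in> X \<Longrightarrow> conv i j v \<in> X"
proof (rule X_I)
  assume v: "v \<in> X"
  show "conv i j v k \<in> V" for k
    using csum_in[OF v] X_in[OF v] csub_0[OF sub] csub_add[OF sub] csub_scale[OF sub] by (auto simp: conv_def)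
  show "k \<notin> E \<Longrightarrow> conv i j v k = 0" for k by (simp add: conv_def)
qed

lemma lin_conv: "lin X (conv i j)"
  by (rule linI)
    (auto simp: conv_def fun_eq_iff lin_add[OF lin_csum] lin_scale[OF lin_csum] cscale_add_right cscale_cscale mult.commute)

end

section \<open>Consequences of irreducibility and of a nonzero middle convolution\<close>

locale mc_irr = mc_data +
  assumes ss: "\<And>i x. i \<le> r \<Longrightarrow> m i = 1 \<Longrightarrow> x \<in> V \<Longrightarrow> A i 1 (A i 1 x) = 0 \<Longrightarrow> A i 1 x = 0"
    and irr: "\<And>U. csubspace U \<Longrightarrow> U \<subseteq> V \<Longrightarrow> (\<And>i j x. (i, j) \<in> entries r m \<Longrightarrow> x \<in> U \<Longrightarrow> A i j x \<in> U)
      \<Longrightarrow> U = {0} \<or> U = V"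
    and nz: "QQ \<noteq> X"
begin

lemma Q0: "\<mu> = 0 \<Longrightarrow> QQ = {v \<in> X. csum v = 0}"
  unfolding QQ_def by simp

lemma irr':
  assumes "csubspace U" "U \<subseteq> V" "\<And>i x. i \<le> r \<Longrightarrow> x \<in> U \<Longrightarrow> a1 i x \<in> U"
    and "\<And>i x. i \<in> {1..r} \<Longrightarrow> x \<in> U \<Longrightarrow> A i 0 x \<in> U"
  shows "U = {0} \<or> U = V"
proof (rule irr[OF assms(1,2)])
  fix i j x assume "(i, j) \<in> E" "x \<in> U"
  then show "A i j x \<in> U" using E_cases[of "(i, j)"] assms(3)[of i x] assms(4)[of i x] by (auto simp: a1_def)
qed

text \<open>For a zero tuple K + L(\<mu>) would be all of V', with l = 0 as witness when \<mu>
  \<noteq> 0.\<close>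

lemma not_all_zero:
  assumes "\<And>i x. i \<le> r \<Longrightarrow> x \<in> V \<Longrightarrow> a1 i x = 0" and "\<And>i x. i \<in> {1..r} \<Longrightarrow> x \<in> V \<Longrightarrow> A i 0 x = 0"
  shows False
proof -
  have "v \<in> QQ" if v: "v \<in> X" for v
  proof (cases "\<mu> = 0")
    case True
    have "csum v = 0" unfolding csum_eq[OF v] using assms X_in[OF v] by simp
    then show ?thesis using v Q0[OF True] by simp
  next
    case False
    then show ?thesis using v assms X_in[OF v] csub_0[OF sub] z
      by (auto simp: QQ_def intro!: bexI[of _ 0])
  qed
  then show False using nz by (auto simp: QQ_def)
qed

text \<open>The other degenerate tuple: A i 0 = - \<mu> and nothing else. Here a00 l = \<mu> l for
  all l, and l = - v (i, 0) places every v in K + L(\<mu>).\<close>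

lemma not_single_scalar:
  assumes i: "i \<in> {1..r}" and a1: "\<And>i x. i \<le> r \<Longrightarrow> x \<in> V \<Longrightarrow> a1 i x = 0"
    and Ak: "\<And>k x. k \<in> {1..r} \<Longrightarrow> k \<noteq> i \<Longrightarrow> x \<in> V \<Longrightarrow> A k 0 x = 0"
    and Ai: "\<And>x. x \<in> V \<Longrightarrow> A i 0 x = - (\<mu> *\<^sub>C x)"
  shows False
proof (cases "\<mu> = 0")
  case True
  have "A k 0 x = 0" if "k \<in> {1..r}" "x \<in> V" for k x
    using Ak[OF that(1) _ that(2)] Ai[OF that(2)] True by (cases "k = i") auto
  then show False using not_all_zero a1 by blast
next
  case False
  have "v \<in> QQ" if v: "v \<in> X" for v
  proof -
    define l where "l = - v (i, 0)"
    have l: "l \<in> V" using csub_neg[OF sub X_in[OF v]] by (simp add: l_def)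
    have "(\<Sum>k\<in>{1..r}. A k 0 l) = (\<Sum>k\<in>{1..r}. if k = i then A i 0 l else 0)"
      using Ak l by (intro sum.cong) auto
    then have "a00 l = \<mu> *\<^sub>C l" using i Ai[OF l] by (simp add: a00_def)
    moreover have "a1 k (v (k, 0) + l) = 0 \<and> A k 0 (v (k, 0) + l) + a1 k (v (k, 1)) = 0" if k: "k \<in> {1..r}" for k
    proof -
      have "v (k, 0) + l \<in> V" "v (k, 1) \<in> V" using csub_add[OF sub] X_in[OF v] l by auto
      then show ?thesis using a1[of k] k Ak[OF k] z(2)[OF k] by (cases "k = i") (auto simp: l_def)
    qed
    ultimately show ?thesis using v False l a1[of 0] X_in[OF v, of "(0, 1)"]
      by (auto simp: QQ_def intro!: bexI[of _ l])
  qed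
  then show False using nz by (auto simp: QQ_def)
qed

text \<open>The line through \<open>z\<close> is invariant, hence equals V. The action on
  \<open>z\<close> thus determines the whole tuple, which can be compared with the two degenerate
  ones.\<close>

lemma common_eigenvector:
  assumes z: "z \<in> V" "z \<noteq> 0" and a1z: "\<And>i. i \<le> r \<Longrightarrow> a1 i z = 0"
    and A0z: "\<And>i. i \<in> {1..r} \<Longrightarrow> A i 0 z = \<alpha> i *\<^sub>C z"
  shows "i \<le> r \<Longrightarrow> x \<in> V \<Longrightarrow> a1 i x = 0" "i \<in> {1..r} \<Longrightarrow> x \<in> V \<Longrightarrow> A i 0 x = \<alpha> i *\<^sub>C x"
proof -
  define U where "U = range (\<lambda>c. c *\<^sub>C z)"
  have a: "a1 i (c *\<^sub>C z) = 0" if "i \<le> r" for i c using lin_scale[OF la1[OF that] z(1)] a1z[OF that] by simp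
  have b: "A i 0 (c *\<^sub>C z) = \<alpha> i *\<^sub>C c *\<^sub>C z" if "i \<in> {1..r}" for i c
    using lin_scale[OF lA0[OF that] z(1)] A0z[OF that] by (simp add: cscale_cscale mult.commute)
  have "U = {0} \<or> U = V"
  proof (rule irr')
    have r: "c *\<^sub>C z \<in> U" for c unfolding U_def by (rule rangeI)
    have "0 \<in> U" using r[of 0] by simp
    show "csubspace U"
    proof (rule csubspaceI)
      show "x + y \<in> U" if "x \<in> U" "y \<in> U" for x y
        using that r by (auto simp: U_def simp flip: cscale_add_left)
      show "c *\<^sub>C x \<in> U" if "x \<in> U" for c x using that r by (auto simp: U_def cscale_cscale)
    qed fact
    show "U \<subseteq> V" using csub_scale[OF sub z(1)] by (auto simp: U_def)
    show "a1 i x \<in> U" if "i \<le> r" "x \<in> U" for i x using a[OF that(1)] that(2) \<open>0 \<in> U\<close> by (auto simp: U_def)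
    show "A i 0 x \<in> U" if "i \<in> {1..r}" "x \<in> U" for i x using b[OF that(1)] that(2) by (auto simp: U_def cscale_cscale)
  qed
  moreover have "z \<in> U" unfolding U_def by (rule range_eqI[of _ _ 1]) (simp add: cscale_one)
  ultimately have "V = U" using z(2) by auto
  then show "i \<le> r \<Longrightarrow> x \<in> V \<Longrightarrow> a1 i x = 0" "i \<in> {1..r} \<Longrightarrow> x \<in> V \<Longrightarrow> A i 0 x = \<alpha> i *\<^sub>C x"
    using a b by (auto simp: U_def)
qed

text \<open>The image is invariant: it contains the values of all \<open>a1 k\<close>, those of A k
  0 for k \<noteq> i, and A i 0 x + \<mu> x if i \<noteq> 0, whence A i 0 x as well for x in the
  image. By irreducibility it is V or 0, and 0 would give a degenerate tuple.\<close>

lemma surj_F: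
  assumes i: "i \<le> r"
  shows "F i ` X = V"
proof -
  define U where "U = F i ` X"
  have UV: "U \<subseteq> V" using F_in by (auto simp: U_def)
  have subU: "csubspace U" unfolding U_def by (rule csubspace_image[OF subX lin_F])
  have e0: "a0 i x + \<mu> *\<^sub>C x \<in> U" if "x \<in> V" for x
    using F_i0[OF i that] i0_X[OF i that] by (auto simp: U_def intro!: image_eqI[of _ _ "i0 i x"])
  have ek: "a1 k x \<in> U" "k \<in> {1..r} \<Longrightarrow> k \<noteq> i \<Longrightarrow> A k 0 x \<in> U" if k: "k \<le> r" and x: "x \<in> V" for k x
  proof -
    have c: "F i (i1 k x) = a1 k x" if "m k = 1"
    proof -
      have "csum (i1 k x) = a1 k x"
        using csum_i[OF k csub_0[OF sub] x] that z k lin_0[OF lin_i0 sub, of k] by (auto split: if_splits)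
      then show ?thesis by (simp add: F_def i1_def)
    qed
    show "a1 k x \<in> U"
    proof (cases "m k = 1")
      case True
      then show ?thesis using c i1_X[OF k _ x] by (auto simp: U_def intro!: image_eqI[of _ _ "i1 k x"])
    next
      case False
      then show ?thesis using csub_0[OF subU] by (simp add: a1_def)
    qed
    show "A k 0 x \<in> U" if k1: "k \<in> {1..r}" "k \<noteq> i"
    proof -
      have "csum (i0 k x) = A k 0 x"
        using csum_i[OF k x csub_0[OF sub]] k1 z k lin_0[OF lin_i1 sub, of k] by (auto split: if_splits)
      then have "F i (i0 k x) = A k 0 x" using k1 by (auto simp: F_def i0_def)
      then show ?thesis using i0_X[OF k x] by (auto simp: U_def intro!: image_eqI[of _ _ "i0 k x"])
    qed
  qed
  have ei: "A i 0 x \<in> U" if "i \<in> {1..r}" "x \<in> U" for x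
  proof -
    have "a0 i x + \<mu> *\<^sub>C x - \<mu> *\<^sub>C x \<in> U" using that e0 UV csub_diff[OF subU] csub_scale[OF subU] by blast
    then show ?thesis using that by (simp add: a0_def)
  qed
  have A0U: "A k 0 x \<in> U" if "k \<in> {1..r}" "x \<in> U" for k x
    using ek(2)[of k x] ei[of x] that UV by (cases "k = i") auto
  have "U = {0} \<or> U = V"
    using ek(1) UV A0U by (intro irr'[OF subU UV]) auto
  moreover have "U \<noteq> {0}"
  proof
    assume U: "U = {0}"
    have az: "a1 k x = 0" if "k \<le> r" "x \<in> V" for k x using ek(1)[OF that] U by simp
    have Az: "A k 0 x = 0" if "k \<in> {1..r}" "k \<noteq> i" "x \<in> V" for k x using ek(2)[of k x] that U by simp
    show False
    proof (cases "i = 0")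
      case True
      then show False using not_all_zero az Az by auto
    next
      case False
      then have i1: "i \<in> {1..r}" using i by auto
      have "A i 0 x = - (\<mu> *\<^sub>C x)" if "x \<in> V" for x
        using e0[OF that] U False by (simp add: a0_def eq_neg_iff_add_eq_0)
      then show False using not_single_scalar[OF i1 az Az] by blast
    qed
  qed
  ultimately show ?thesis by (simp add: U_def)
qed

text \<open>For \<mu> \<noteq> 0 the expected witness l of membership in \<open>QQ\<close> is x if i
  = 0, and 0 otherwise. The deviation of an arbitrary witness from it would, if nonzero, be a common
  eigenvector with eigenvalues that make the tuple degenerate.\<close>

lemma ker_i:
  assumes i: "i \<le> r" and x: "x \<in> V" and y: "y \<in> V" and my: "m i = 1 \<or> y = 0" and a1x: "a1 i x = 0"
  shows "i0 i x + i1 i y \<in> QQ \<longleftrightarrow> a1 i y + a0 i x = 0"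
proof -
  have X: "i0 i x + i1 i y \<in> X" using assms by (intro csub_add[OF subX] i0_X i1_X)
  show ?thesis
  proof (cases "\<mu> = 0")
    case True
    then have "\<mu> *\<^sub>C x = 0" by simp
    then show ?thesis using csum_i[OF i x y my] X Q0[OF True] by (auto simp: a0_def add.commute)
  next
    case mu: False
    have y1: "a1 i y = a1 i ((i0 i x + i1 i y) (i, 1))" by (auto simp: i0_def i1_def)
    have q: "i0 i x + i1 i y \<in> QQ \<longleftrightarrow>
       (\<exists>l\<in>V. a1 0 l = 0 \<and> a00 l - \<mu> *\<^sub>C l + a1 0 ((i0 i x + i1 i y) (0, 1)) = 0 \<and>
       (\<forall>k\<in>{1..r}. a1 k ((i0 i x + i1 i y) (k, 0) + l) = 0 \<and>
          A k 0 ((i0 i x + i1 i y) (k, 0) + l) + a1 k ((i0 i x + i1 i y) (k, 1)) = 0))"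
      using X mu unfolding QQ_def by simp
    show ?thesis
    proof (cases "i = 0")
      case True
      have c: "(i0 i x + i1 i y) (0, 1) = y" "\<And>k. k \<in> {1..r} \<Longrightarrow> (i0 i x + i1 i y) (k, 0) = - x"
        "\<And>k. k \<in> {1..r} \<Longrightarrow> (i0 i x + i1 i y) (k, 1) = 0"
        using True by (auto simp: i0_def i1_def)
      show ?thesis
      proof
        assume "i0 i x + i1 i y \<in> QQ"
        then obtain l where l: "l \<in> V" "a1 0 l = 0" "a00 l - \<mu> *\<^sub>C l + a1 0 y = 0"
          and l2: "\<And>k. k \<in> {1..r} \<Longrightarrow> a1 k (- x + l) = 0" "\<And>k. k \<in> {1..r} \<Longrightarrow> A k 0 (- x + l) = 0"
          using q c z by auto
        \<comment> \<open>By \<open>l2\<close>, \<open>l\<close> and \<open>a1x\<close>, this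
          deviation is killed by every entry of the tuple.\<close>
        define w where "w = - x + l"
        have w: "w \<in> V" using csub_add[OF sub csub_neg[OF sub x] l(1)] by (simp add: w_def)
        have w1: "a1 k w = 0" if "k \<le> r" for k
        proof (cases "k = 0")
          case True
          have "a1 0 w = - a1 0 x + a1 0 l" unfolding w_def
            using lin_add[OF la1[of 0] csub_neg[OF sub x] l(1)] lin_neg[OF la1[of 0] sub x] by simp
          then show ?thesis using True l a1x \<open>i = 0\<close> by simp
        next
          case False
          then show ?thesis using l2(1)[of k] that by (simp add: w_def)
        qed
        have w2: "A k 0 w = 0 *\<^sub>C w" if "k \<in> {1..r}" for k using l2(2)[OF that] by (simp add: w_def)
        have "w = 0"
        proof (rule ccontr)
          assume "w \<noteq> 0"
          from common_eigenvector[OF w this w1 w2] have "\<And>i x. i \<le> r \<Longrightarrow> x \<in> V \<Longrightarrow> a1 i x = 0"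
            "\<And>i x. i \<in> {1..r} \<Longrightarrow> x \<in> V \<Longrightarrow> A i 0 x = 0" by auto
          then show False by (rule not_all_zero)
        qed
        then have "l = x" by (simp add: w_def eq_neg_iff_add_eq_0)
        then show "a1 i y + a0 i x = 0" using l True by (simp add: a0_def add.commute)
      next
        assume "a1 i y + a0 i x = 0"
        then show "i0 i x + i1 i y \<in> QQ" unfolding q using x a1x True c z
          by (intro bexI[of _ x]) (auto simp: a0_def add.commute)
      qed
    next
      case False
      then have i1: "i \<in> {1..r}" using i by auto
      have c: "(i0 i x + i1 i y) (0, 1) = 0" "(i0 i x + i1 i y) (i, 0) = x" "(i0 i x + i1 i y) (i, 1) = y"
        "\<And>k. k \<noteq> i \<Longrightarrow> (i0 i x + i1 i y) (k, 0) = 0"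
        "\<And>k. k \<noteq> i \<Longrightarrow> (i0 i x + i1 i y) (k, 1) = 0"
        using False by (auto simp: i0_def i1_def)
      show ?thesis
      proof
        assume "i0 i x + i1 i y \<in> QQ"
        then obtain l where l: "l \<in> V" "a1 0 l = 0" "a00 l - \<mu> *\<^sub>C l = 0"
          and l2: "\<And>k. k \<in> {1..r} \<Longrightarrow> k \<noteq> i \<Longrightarrow> a1 k l = 0" "\<And>k. k \<in> {1..r} \<Longrightarrow> k \<noteq> i \<Longrightarrow> A k 0 l = 0"
          and l3: "a1 i (x + l) = 0" "A i 0 (x + l) + a1 i y = 0"
        proof -
          assume a: "\<And>l. \<lbrakk>l \<in> V; a1 0 l = 0; a00 l - \<mu> *\<^sub>C l = 0; \<And>k. \<lbrakk>k \<in> {1..r}; k \<noteq> i\<rbrakk> \<Longrightarrow> a1 k l = 0;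
             \<And>k. \<lbrakk>k \<in> {1..r}; k \<noteq> i\<rbrakk> \<Longrightarrow> A k 0 l = 0; a1 i (x + l) = 0; A i 0 (x + l) + a1 i y = 0\<rbrakk> \<Longrightarrow> thesis"
          from \<open>i0 i x + i1 i y \<in> QQ\<close> obtain l where l: "l \<in> V" "a1 0 l = 0"
            "a00 l - \<mu> *\<^sub>C l + a1 0 ((i0 i x + i1 i y) (0, 1)) = 0"
            and lk: "\<And>k. k \<in> {1..r} \<Longrightarrow> a1 k ((i0 i x + i1 i y) (k, 0) + l) = 0"
            "\<And>k. k \<in> {1..r} \<Longrightarrow> A k 0 ((i0 i x + i1 i y) (k, 0) + l) + a1 k ((i0 i x + i1 i y) (k, 1)) = 0"
            using q by blast
          show thesis
          proof (rule a[OF l(1,2)])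
            show "a00 l - \<mu> *\<^sub>C l = 0" using l(3) c z by simp
            show "a1 k l = 0" "A k 0 l = 0" if "k \<in> {1..r}" "k \<noteq> i" for k
              using lk[OF that(1)] c(4,5)[OF that(2)] z(1)[of k] that by auto
            show "a1 i (x + l) = 0" "A i 0 (x + l) + a1 i y = 0" using lk[OF i1] c by auto
          qed
        qed
        have a1l: "a1 k l = 0" if "k \<le> r" for k
        proof -
          have "a1 i l = 0" using l3(1) a1x lin_add[OF la1[OF i] x l(1)] by simp
          then show ?thesis using l2(1)[of k] l(2) that by (cases "k = 0"; cases "k = i") auto
        qed
        have "(\<Sum>k\<in>{1..r}. A k 0 l) = (\<Sum>k\<in>{1..r}. if k = i then A i 0 l else 0)"
          using l2(2) by (intro sum.cong) auto
        then have "a00 l = - A i 0 l" using i1 by (simp add: a00_def)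
        then have "A i 0 l = - a00 l" by simp
        then have Ail: "A i 0 l = - (\<mu> *\<^sub>C l)" using l(3) by simp
        \<comment> \<open>As each A k 0 with k \<noteq> i kills l, the relation a00 l = \<mu> l
          leaves the eigenvalue - \<mu> for A i 0: the situation of
          \<open>not_single_scalar\<close>.\<close>
        define \<alpha> where "\<alpha> = (\<lambda>k. if k = i then - \<mu> else 0)"
        have A0l: "A k 0 l = \<alpha> k *\<^sub>C l" if "k \<in> {1..r}" for k
          using l2(2)[OF that] Ail by (auto simp: \<alpha>_def)
        have "l = 0"
        proof (rule ccontr)
          assume "l \<noteq> 0"
          have c1: "a1 k x = 0" if "k \<le> r" "x \<in> V" for k x
            using common_eigenvector(1)[OF l(1) \<open>l \<noteq> 0\<close> a1l A0l that] .
          have c2: "A k 0 x = \<alpha> k *\<^sub>C x" if "k \<in> {1..r}" "x \<in> V" for k x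
            using common_eigenvector(2)[OF l(1) \<open>l \<noteq> 0\<close> a1l A0l that] .
          show False
            by (rule not_single_scalar[OF i1 c1]) (simp_all add: c2 i1[simplified] \<alpha>_def)
        qed
        then show "a1 i y + a0 i x = 0" using l3 False by (simp add: a0_def add.commute)
      next
        assume a: "a1 i y + a0 i x = 0"
        have "a1 k ((i0 i x + i1 i y) (k, 0) + 0) = 0 \<and>
          A k 0 ((i0 i x + i1 i y) (k, 0) + 0) + a1 k ((i0 i x + i1 i y) (k, 1)) = 0" if "k \<in> {1..r}" for k
          using a a1x c z(1)[of k] z(2)[OF that] that False by (cases "k = i") (auto simp: a0_def add.commute)
        then show "i0 i x + i1 i y \<in> QQ" unfolding q using csub_0[OF sub] z c
          by (intro bexI[of _ 0]) auto
      qed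
    qed
  qed
qed

section \<open>Dimension and invariance of K + L(\<mu>)\<close>

definition Kd :: "nat \<Rightarrow> ('a \<times> 'a) set" where
  "Kd i = {q \<in> V \<times> (if m i = 0 then {0} else V). (a1 i (fst q), a1 i (snd q) + a0 i (fst q)) = 0}"

lemma findim_Kd: "i \<le> r \<Longrightarrow> findim (Kd i)"
proof -
  assume i: "i \<le> r"
  let ?Y = "V \<times> (if m i = 0 then {0} else V)"
  have Y: "findim ?Y" using dim_Times(1)[OF V, of "if m i = 0 then {0} else V"] V by auto
  have YV: "fst q \<in> V" "snd q \<in> V" if "q \<in> ?Y" for q using that csub_0[OF sub] by (auto split: if_splits)
  have "lin ?Y (\<lambda>q. (a1 i (fst q), a1 i (snd q) + a0 i (fst q)))"
    by (rule linI) (use YV in \<open>simp_all add: lin_add[OF la1[OF i]] lin_scale[OF la1[OF i]]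
       lin_add[OF endoD(1)[OF endo_a0[OF i]]] lin_scale[OF endoD(1)[OF endo_a0[OF i]]] cscale_prod_def cscale_add_right algebra_simps\<close>)
  from rank_nullity(1)[OF Y this] show ?thesis by (simp add: Kd_def)
qed

text \<open>For \<mu> \<noteq> 0 this is the addition map from the product of the K^(i) with i \<ge>
  1 and L(\<mu>) to V'. The factor \<open>Kd 0\<close> is L(\<mu>) with l as first coordinate, which
  accounts for the subtraction of \<open>fst (t 0)\<close>.\<close>

definition \<Phi> :: "(nat \<Rightarrow> 'a \<times> 'a) \<Rightarrow> nat \<times> nat \<Rightarrow> 'a" where
  "\<Phi> t = (\<lambda>k. if k \<notin> E then 0 else if snd k = 1 then snd (t (fst k)) else fst (t (fst k)) - fst (t 0))"

lemma KdD: 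
  assumes "q \<in> Kd i"
  shows "fst q \<in> V" "snd q \<in> V" "m i = 0 \<Longrightarrow> snd q = 0" "a1 i (fst q) = 0" "a1 i (snd q) + a0 i (fst q) = 0"
  using assms csub_0[OF sub] by (auto simp: Kd_def zero_prod_def split: if_splits)

lemma KdI: 
  assumes "x \<in> V" "y \<in> V" "m i = 0 \<Longrightarrow> y = 0" "a1 i x = 0" "a1 i y + a0 i x = 0"
  shows "(x, y) \<in> Kd i"
  using assms by (auto simp: Kd_def zero_prod_def)

text \<open>The sum of K and L(\<mu>) is direct: on the intersection every A i 0 kills l, so a00 l =
  0, while a00 l = \<mu> l and \<mu> \<noteq> 0.\<close>

lemma dimQ:
  assumes mu: "\<mu> \<noteq> 0"
  shows "findim QQ" "cdim QQ = (\<Sum>i\<le>r. cdim (Kd i))"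
proof -
  define T where "T = fun_space {..r} Kd"
  have T: "findim T" "cdim T = (\<Sum>i\<le>r. cdim (Kd i))"
    using dim_fun_space[of "{..r}" Kd] findim_Kd by (auto simp: T_def)
  have l: "lin T \<Phi>" by (rule linI) (auto simp: \<Phi>_def fun_eq_iff cv.scale_right_diff_distrib)
  have Td: "t i \<in> Kd i" if "t \<in> T" "i \<le> r" for t i using that by (auto simp: T_def fun_space_def)
  have q: "v \<in> QQ \<longleftrightarrow> v \<in> X \<and> (\<exists>l\<in>V. a1 0 l = 0 \<and> a00 l - \<mu> *\<^sub>C l + a1 0 (v (0, 1)) = 0 \<and>
       (\<forall>i\<in>{1..r}. a1 i (v (i, 0) + l) = 0 \<and> A i 0 (v (i, 0) + l) + a1 i (v (i, 1)) = 0))" for v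
    using mu by (simp add: QQ_def)
  have ev: "\<Phi> t (i, 1) = snd (t i)" "i \<in> {1..r} \<Longrightarrow> \<Phi> t (i, 0) = fst (t i) - fst (t 0)" if t: "t \<in> T" "i \<le> r" for t i
  proof -
    have "m i \<noteq> 1 \<Longrightarrow> m i = 0" using m[OF t(2)] by auto
    then show "\<Phi> t (i, 1) = snd (t i)" using KdD(3)[OF Td[OF t]] Ei1[OF t(2)] by (auto simp: \<Phi>_def)
    show "i \<in> {1..r} \<Longrightarrow> \<Phi> t (i, 0) = fst (t i) - fst (t 0)" using Ei0 by (auto simp: \<Phi>_def)
  qed
  have im: "\<Phi> ` T = QQ"
  proof (intro equalityI subsetI)
    fix v assume "v \<in> \<Phi> ` T"
    then obtain t where t: "t \<in> T" "v = \<Phi> t" by blast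
    note K0 = KdD[OF Td[OF t(1), of 0, simplified]]
    have "v \<in> X" unfolding t(2)
    proof (rule X_I)
      fix k assume "k \<in> E"
      then show "\<Phi> t k \<in> V"
        using E_cases[of k] ev[OF t(1)] KdD(1,2)[OF Td[OF t(1)]] K0(1) csub_diff[OF sub] by auto
    qed (simp add: \<Phi>_def)
    moreover have "a1 i (v (i, 0) + fst (t 0)) = 0 \<and> A i 0 (v (i, 0) + fst (t 0)) + a1 i (v (i, 1)) = 0"
      if i: "i \<in> {1..r}" for i
    proof -
      have "i \<le> r" "i \<noteq> 0" using i by auto
      then show ?thesis using ev[OF t(1) \<open>i \<le> r\<close>] KdD(4,5)[OF Td[OF t(1) \<open>i \<le> r\<close>]] i t(2)
        by (simp add: a0_def add.commute)
    qed
    ultimately show "v \<in> QQ" unfolding q using K0 ev(1)[OF t(1), of 0] t(2)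
      by (intro conjI bexI[of _ "fst (t 0)"]) (auto simp: a0_def add.commute)
  next
    fix v assume "v \<in> QQ"
    then obtain l where v: "v \<in> X" and l: "l \<in> V" "a1 0 l = 0" "a00 l - \<mu> *\<^sub>C l + a1 0 (v (0, 1)) = 0"
      and lk: "\<And>i. i \<in> {1..r} \<Longrightarrow> a1 i (v (i, 0) + l) = 0"
        "\<And>i. i \<in> {1..r} \<Longrightarrow> A i 0 (v (i, 0) + l) + a1 i (v (i, 1)) = 0" unfolding q by blast
    define t where "t = (\<lambda>i. if i = 0 then (l, v (0, 1)) else if i \<le> r then (v (i, 0) + l, v (i, 1)) else 0)"
    have "t i \<in> Kd i" if i: "i \<le> r" for i
    proof -
      have v1: "v (i, 1) = 0" if "m i = 0" using X_out[OF v, of "(i, 1)"] Ei1[OF i] that by auto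
      show ?thesis
      proof (cases "i = 0")
        case True
        then show ?thesis using l v1 X_in[OF v]
          by (auto simp: t_def a0_def add.commute intro!: KdI)
      next
        case False
        then have "i \<in> {1..r}" using i by auto
        then show ?thesis using lk[of i] l v1 X_in[OF v] csub_add[OF sub] False
          by (auto simp: t_def a0_def add.commute intro!: KdI)
      qed
    qed
    then have tT: "t \<in> T" by (auto simp: T_def fun_space_def t_def)
    moreover have "\<Phi> t = v"
    proof
      fix k
      show "\<Phi> t k = v k"
        using E_cases[of k] ev[OF tT] X_out[OF v, of k]
        by (cases "k \<in> E") (auto simp: t_def, auto simp: \<Phi>_def)
    qed
    ultimately show "v \<in> \<Phi> ` T" by blast
  qed
  have inj: "t = 0" if t: "t \<in> T" "\<Phi> t = 0" for t
  proof -
    define l where "l = fst (t 0)"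
    have s: "snd (t i) = 0" if "i \<le> r" for i using ev(1)[OF t(1) that] t(2) by simp
    have f: "fst (t i) = l" if "i \<in> {1..r}" for i using ev(2)[OF t(1), of i] that t(2) by (simp add: l_def)
    have lV: "l \<in> V" using KdD(1)[OF Td[OF t(1), of 0]] by (simp add: l_def)
    have "A i 0 l = 0" if "i \<in> {1..r}" for i
      using KdD(5)[OF Td[OF t(1), of i]] s[of i] f[OF that] that z(1)[of i] by (simp add: a0_def)
    then have "a00 l = 0" by (simp add: a00_def)
    moreover have "a0 0 l = 0" using KdD(5)[OF Td[OF t(1), of 0]] s[of 0] z(1)[of 0] by (simp add: l_def)
    ultimately have "l = 0" using mu by (simp add: a0_def)
    show "t = 0"
    proof
      fix i
      show "t i = 0 i"
      proof (cases "i \<le> r")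
        case True
        have "fst (t i) = 0"
        proof (cases "i = 0")
          case True
          then show ?thesis using \<open>l = 0\<close> by (simp add: l_def)
        next
          case False
          then show ?thesis using f[of i] \<open>l = 0\<close> \<open>i \<le> r\<close> by simp
        qed
        then show ?thesis using s[OF True] by (simp add: prod_eq_iff)
      next
        case False
        then show ?thesis using t(1) by (simp add: T_def fun_space_def)
      qed
    qed
  qed
  show "findim QQ" "cdim QQ = (\<Sum>i\<le>r. cdim (Kd i))"
    using dim_bij[OF findim_sub[OF T(1)] l im inj] T by auto
qed

lemma subQ: "csubspace QQ"
proof (cases "\<mu> = 0")
  case True
  show ?thesis unfolding Q0[OF True] by (rule csubspace_kernel[OF subX lin_csum])
next
  case False
  then show ?thesis using dimQ(1) findim_sub by blast
qed

lemma QX: "QQ \<subseteq> X"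
  by (auto simp: QQ_def)

text \<open>For \<mu> \<noteq> 0, csum v = \<mu> l on K + L(\<mu>). Hence F i v is \<mu> times the
  kernel vector in question, and the factorised form of \<open>conv i j v\<close> satisfies the
  criterion \<open>ker_i\<close>. For \<mu> = 0 the convolution vanishes on
  \<open>QQ\<close>.\<close>

lemma conv_Q:
  assumes k: "(i, j) \<in> E" and v: "v \<in> QQ"
  shows "conv i j v \<in> QQ"
proof -
  have vX: "v \<in> X" using v QX by blast
  have i: "i \<le> r" using k by (auto simp: entries_def)
  show ?thesis
  proof (cases "\<mu> = 0")
    case True
    have "csum v = 0" using v Q0[OF True] by simp
    then have "conv i j v = 0" unfolding conv_def fun_eq_iff by (simp add: True)
    then show ?thesis using csub_0[OF subQ] by simp
  next
    case mu: False
    obtain l where l: "l \<in> V" "a1 0 l = 0" "a00 l - \<mu> *\<^sub>C l + a1 0 (v (0, 1)) = 0"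
      and lk: "\<And>i. i \<in> {1..r} \<Longrightarrow> a1 i (v (i, 0) + l) = 0"
        "\<And>i. i \<in> {1..r} \<Longrightarrow> A i 0 (v (i, 0) + l) + a1 i (v (i, 1)) = 0"
      using v mu by (auto simp: QQ_def)
    have "A k 0 (v (k, 0)) + a1 k (v (k, 1)) = - A k 0 l" if "k \<in> {1..r}" for k
      using lk(2)[OF that] lin_add[OF lA0[OF that] X_in[OF vX] l(1)] by (simp add: eq_neg_iff_add_eq_0 algebra_simps)
    then have "csum v = a00 l + a1 0 (v (0, 1))"
      unfolding csum_eq[OF vX] by (simp add: a00_def sum_negf)
    then have cs: "csum v = \<mu> *\<^sub>C l" using l(3) by (simp add: algebra_simps)
    have Fv: "F i v = \<mu> *\<^sub>C (if i = 0 then l else v (i, 0) + l)"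
      by (simp add: F_def cs cscale_add_right add.commute)
    have Fi: "a1 i (F i v) = 0"
    proof (cases "i = 0")
      case True
      then show ?thesis using Fv l lin_scale[OF la1[OF i] l(1)] by simp
    next
      case False
      then have "i \<in> {1..r}" using i by auto
      then show ?thesis using Fv False lk(1)[of i] lin_scale[OF la1[OF i] csub_add[OF sub X_in[OF vX] l(1)]] by simp
    qed
    note FV = F_in[OF vX, of i]
    from E_cases[OF k] show ?thesis
    proof
      assume "\<exists>i'\<in>{1..r}. (i, j) = (i', 0)"
      then have ij: "i \<in> {1..r}" "j = 0" by auto
      have mi: "m i = 1 \<or> \<mu> *\<^sub>C v (i, 1) = 0" using X_out[OF vX, of "(i, 1)"] Ei1[OF i] by auto
      have "a1 i (\<mu> *\<^sub>C v (i, 1)) + a0 i (F i v) = \<mu> *\<^sub>C (A i 0 (v (i, 0) + l) + a1 i (v (i, 1)))"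
        using ij Fv lin_scale[OF la1[OF i] X_in[OF vX]] lin_scale[OF lA0[OF ij(1)] csub_add[OF sub X_in[OF vX] l(1)]]
        by (simp add: a0_def cscale_add_right add.commute)
      also have "\<dots> = 0" using lk(2)[OF ij(1)] by simp
      finally have "i0 i (F i v) + i1 i (\<mu> *\<^sub>C v (i, 1)) \<in> QQ"
        using ker_i[OF i FV csub_scale[OF sub X_in[OF vX]] mi Fi] by simp
      then show ?thesis using conv_i0[OF ij(1) vX] ij by simp
    next
      assume "\<exists>i'\<le>r. m i' = 1 \<and> (i, j) = (i', 1)"
      then have ij: "m i = 1" "j = 1" by auto
      have "i0 i 0 + i1 i (F i v) \<in> QQ"
        using ker_i[OF i csub_0[OF sub] FV, THEN iffD2] ij Fi z(1)[OF i] lin_0[OF endoD(1)[OF endo_a0[OF i]] sub] by simp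
      then show ?thesis using conv_i1[OF i ij(1)] ij lin_0[OF lin_i0 sub] by simp
    qed
  qed
qed

lemma dim_Kd:
  assumes i: "i \<le> r"
  shows "m i = 0 \<Longrightarrow> cdim (Kd i) = cdim {x \<in> V. a0 i x = 0}"
    and "m i = 1 \<Longrightarrow> cdim (Kd i) = cdim {q \<in> V \<times> V. A i 1 (fst q) = 0 \<and> A i 1 (snd q) + a0 i (fst q) = 0}"
proof -
  show "cdim (Kd i) = cdim {q \<in> V \<times> V. A i 1 (fst q) = 0 \<and> A i 1 (snd q) + a0 i (fst q) = 0}" if "m i = 1"
    using that by (simp add: Kd_def a1_def[abs_def] zero_prod_def)
  assume mi: "m i = 0"
  have s: "csubspace {x \<in> V. a0 i x = 0}" by (rule csubspace_kernel[OF sub endoD(1)[OF endo_a0[OF i]]])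
  have f: "findim {x \<in> V. a0 i x = 0}" by (rule findim_subset[OF V s]) auto
  have e: "Kd i = (\<lambda>x. (x, 0)) ` {x \<in> V. a0 i x = 0}"
    using mi by (auto simp: Kd_def a1_def zero_prod_def)
  show "cdim (Kd i) = cdim {x \<in> V. a0 i x = 0}"
    by (rule dim_bij(2)[OF s _ e[symmetric] _ f]) (auto intro!: linI simp: cscale_prod_def zero_prod_def)
qed

text \<open>The image of any linear \<open>p\<close> with kernel \<open>QQ\<close> is a model of the
  middle convolution, so the count needs no cosets.\<close>

theorem idx_on_conv:
  assumes p: "lin X p" and pQ: "\<And>v. v \<in> X \<Longrightarrow> p v = 0 \<longleftrightarrow> v \<in> QQ"
    and B: "\<And>i j v. (i, j) \<in> entries r m \<Longrightarrow> v \<in> X \<Longrightarrow> B i j (p v) = p (conv i j v)"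
  shows "idx_on (p ` X) r m B = idx_on V r m A"
proof -
  define W where "W = p ` X"
  define e where "e = int (cdim W) - int (cdim V)"
  have kQ: "{v \<in> X. p v = 0} = QQ" using pQ QX by auto
  have W: "findim W" and dW: "cdim X = cdim QQ + cdim W"
    using rank_nullity(2,3)[OF fdX p] by (auto simp: W_def kQ)
  note subW = findim_sub[OF W]
  have eW: "int (cdim W) = int (cdim V) + e" by (simp add: e_def)
  have endoW: "endo W G" if G: "\<And>v. v \<in> X \<Longrightarrow> G (p v) = p (g v)" and g: "lin X g" "\<And>v. v \<in> X \<Longrightarrow> g v \<in> X" for G g
  proof -
    have "lin W G"
    proof (rule linI)
      fix x assume "x \<in> W"
      then obtain v where v: "v \<in> X" "x = p v" by (auto simp: W_def)
      show "G (c *\<^sub>C x) = c *\<^sub>C G x" for c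
        using v G[OF csub_scale[OF subX v(1)], of c] G[OF v(1)] lin_scale[OF p v(1), of c]
          lin_scale[OF p g(2)[OF v(1)], of c] lin_scale[OF g(1) v(1), of c] by simp
      fix y assume "y \<in> W"
      then obtain w where w: "w \<in> X" "y = p w" by (auto simp: W_def)
      show "G (x + y) = G x + G y"
        using v w G[OF csub_add[OF subX v(1) w(1)]] G[OF v(1)] G[OF w(1)] lin_add[OF p v(1) w(1)]
          lin_add[OF p g(2)[OF v(1)] g(2)[OF w(1)]] lin_add[OF g(1) v(1) w(1)] by simp
    qed
    moreover have "G w \<in> W" if "w \<in> W" for w
      using that G g(2) by (auto simp: W_def)
    ultimately show ?thesis by (simp add: endo_def)
  qed
  have endoB: "endo W (B i j)" if "(i, j) \<in> E" for i j
  proof (rule endoW[of "B i j" "conv i j"])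
    show "B i j (p v) = p (conv i j v)" if "v \<in> X" for v by (rule B[OF \<open>(i, j) \<in> E\<close> that])
    show "conv i j v \<in> X" if "v \<in> X" for v
      using \<open>(i, j) \<in> E\<close> that by (intro conv_X) (auto simp: entries_def)
  qed (rule lin_conv)
  define b00 where "b00 = complete_on r B 0 0"
  define b0 where "b0 = (\<lambda>i w. if i = 0 then b00 w + \<mu> *\<^sub>C w else B i 0 w)"
  have b00: "b00 w = - (\<Sum>k\<in>{1..r}. B k 0 w)" for w by (simp add: b00_def complete_on_def)
  have endo_b00: "endo W b00"
  proof -
    have k: "endo W (B k 0)" if "k \<in> {1..r}" for k using endoB Ei0 that by blast
    have "lin W (\<lambda>x. - (\<Sum>k\<in>{1..r}. B k 0 x))"
      using k by (intro lin_uminus lin_sumf) (auto simp: endo_def)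
    moreover have "- (\<Sum>k\<in>{1..r}. B k 0 x) \<in> W" if "x \<in> W" for x
      using that k by (intro csub_neg[OF subW] cv.subspace_sum[OF subW]) (auto simp: endo_def)
    ultimately show ?thesis by (simp add: endo_def b00_def complete_on_def)
  qed
  have endo_b0: "endo W (b0 i)" if "i \<le> r" for i
    using endo_shift[OF subW endo_b00, of \<mu>] endoB[of i 0] Ei0[of i] that by (cases "i = 0") (auto simp: b0_def[abs_def])
  have p_in: "i0 i x \<in> X" if "i \<le> r" "x \<in> V" for i x using i0_X that .
  have b0p: "b0 i (p v) = p (i0 i (F i v)) + p (i1 i (\<mu> *\<^sub>C v (i, 1)))" if i: "i \<le> r" and v: "v \<in> X" for i v
  proof -
    have "m i \<noteq> 1 \<Longrightarrow> v (i, 1) = 0" using X_out[OF v] Ei1[OF i] by blast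
    then have m1: "m i = 1 \<or> \<mu> *\<^sub>C v (i, 1) = 0" by auto
    have pp: "p (i0 i (F i v) + i1 i (\<mu> *\<^sub>C v (i, 1))) = p (i0 i (F i v)) + p (i1 i (\<mu> *\<^sub>C v (i, 1)))"
      by (rule lin_add[OF p i0_X[OF i F_in[OF v]] i1_X[OF i m1 csub_scale[OF sub X_in[OF v]]]])
    show ?thesis
    proof (cases "i = 0")
      case True
      have cX: "conv k 0 v \<in> X" if "k \<in> {1..r}" for k using conv_X v that by auto
      have "(\<Sum>k\<in>{1..r}. B k 0 (p v)) = (\<Sum>k\<in>{1..r}. p (conv k 0 v))"
        using B Ei0 v by (intro sum.cong) auto
      also have "\<dots> = p (\<Sum>k\<in>{1..r}. conv k 0 v)"
        using lin_sum[OF p subX, of "{1..r}" "\<lambda>k. conv k 0 v"] cX by simp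
      finally have "b0 0 (p v) = - p (\<Sum>k\<in>{1..r}. conv k 0 v) + \<mu> *\<^sub>C p v" by (simp add: b0_def b00)
      also have "\<dots> = p (- (\<Sum>k\<in>{1..r}. conv k 0 v) + \<mu> *\<^sub>C v)"
      proof -
        have s: "(\<Sum>k\<in>{1..r}. conv k 0 v) \<in> X" using cX by (rule cv.subspace_sum[OF subX])
        show ?thesis
          using lin_add[OF p csub_neg[OF subX s] csub_scale[OF subX v]] lin_neg[OF p subX s] lin_scale[OF p v] by simp
      qed
      also have "\<dots> = p (i0 0 (F 0 v) + i1 0 (\<mu> *\<^sub>C v (0, 1)))" using conv_00[OF v] by simp
      finally show ?thesis using pp True by simp
    next
      case False
      then have "i \<in> {1..r}" using i by auto
      then show ?thesis using B[OF Ei0 v] conv_i0[OF _ v] pp False by (simp add: b0_def)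
    qed
  qed
  have loc: "int (commutant_dim W (m i) (complete_on r B i)) =
      int (commutant_dim V (m i) (complete_on r A i)) + (int (m i) + 1) * e\<^sup>2 + 2 * e * int (cdim (Kd i))" if i: "i \<le> r" for i
  proof -
    have mi: "m i = 0 \<or> m i = 1" using m[OF i] by auto
    have tA0: "a0 i = (if i = 0 then (\<lambda>x. complete_on r A i 0 x + (- \<mu>) *\<^sub>C x) else complete_on r A i 0)"
      by (auto simp: a0_def fun_eq_iff complete_on_def a00_def)
    have tB0: "b0 i = (if i = 0 then (\<lambda>x. complete_on r B i 0 x + \<mu> *\<^sub>C x) else complete_on r B i 0)"
      by (auto simp: b0_def fun_eq_iff complete_on_def b00)
    have t1: "complete_on r A i 1 = A i 1" "complete_on r B i 1 = B i 1" by (auto simp: complete_on_def)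
    have eA: "endo V (complete_on r A i 0)" 
      using endo_a00 endo_A0[of i] i by (cases "i = 0") (auto simp: complete_on_def a00_def[abs_def])
    have eB: "endo W (complete_on r B i 0)"
      using endo_b00 endoB[of i 0] Ei0[of i] i by (cases "i = 0") (auto simp: complete_on_def b00[abs_def])
    show ?thesis
    proof (cases "m i = 1")
      case False
      then have m0: "m i = 0" using mi by simp
      then have a10: "a1 i x = 0" for x by (simp add: a1_def)
      have "int (cdim (comm0 W (b0 i))) = int (cdim (comm0 V (a0 i))) + e\<^sup>2 + 2 * e * int (cdim {x \<in> V. a0 i x = 0})"
      proof (rule dim_comm0_conv[of V W X p "F i" "i0 i" "a0 i" "b0 i" \<mu> e])
        show "i0 i x \<in> X" "F i (i0 i x) = a0 i x + \<mu> *\<^sub>C x" if "x \<in> V" for x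
          using i0_X[OF i that] F_i0[OF i that] .
      next
        fix v assume v: "v \<in> X"
        have "v (i, 1) = 0" using X_out[OF v, of "(i, 1)"] Ei1[OF i] m0 by simp
        then show "b0 i (p v) = p (i0 i (F i v))"
          using b0p[OF i v] lin_0[OF lin_i1 sub, of i] lin_0[OF p subX] by simp
      next
        fix x assume x: "x \<in> V"
        show "p (i0 i x) = 0 \<longleftrightarrow> a0 i x = 0"
          using ker_i[OF i x csub_0[OF sub] _ a10] pQ[OF i0_X[OF i x]] lin_0[OF lin_i1 sub, of i] a10 by simp
      qed ((rule V W subX p W_def[symmetric] lin_F surj_F[OF i] lin_i0 endo_a0[OF i] endo_b0[OF i] eW)+)
      moreover have "cdim (comm0 V (a0 i)) = cdim (comm0 V (complete_on r A i 0))"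
        unfolding tA0 using dim_comm_shift(2)[OF V eA eA, of "- \<mu>"] by (cases "i = 0") simp_all
      moreover have "cdim (comm0 W (b0 i)) = cdim (comm0 W (complete_on r B i 0))"
        unfolding tB0 using dim_comm_shift(2)[OF W eB eB, of \<mu>] by (cases "i = 0") simp_all
      ultimately show ?thesis using m0 dim_Kd(1)[OF i m0] by (simp add: commutant_dim_def)
    next
      case True
      then have a1: "a1 i = A i 1" by (simp add: a1_def[abs_def])
      have i1E: "(i, 1) \<in> E" using Ei1[OF i] True by simp
      have eA1: "endo V (A i 1)" and eB1: "endo W (B i 1)" using A endoB i1E by auto
      have i1X: "i1 i x \<in> X" if "x \<in> V" for x using i1_X[OF i _ that] True by simp
      have "int (cdim (comm1 W (B i 1) (b0 i))) = int (cdim (comm1 V (A i 1) (a0 i))) + 2 * e\<^sup>2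
        + 2 * e * int (cdim {q \<in> V \<times> V. A i 1 (fst q) = 0 \<and> A i 1 (snd q) + a0 i (fst q) = 0})"
      proof (rule dim_comm1_conv[of V W X p "F i" "i0 i" "i1 i" "A i 1" "a0 i" "B i 1" "b0 i" \<mu> e])
        show "i0 i x \<in> X" "i1 i x \<in> X" "F i (i0 i x) = a0 i x + \<mu> *\<^sub>C x" if "x \<in> V" for x
          using i0_X[OF i that] i1X[OF that] F_i0[OF i that] .
        show "A i 1 x = 0" if "x \<in> V" "A i 1 (A i 1 x) = 0" for x
          by (rule ss[OF i True that])
        show "F i (i1 i x) = A i 1 x" if "x \<in> V" for x using F_i1[OF i True that] a1 by simp
        show "B i 1 (p v) = p (i1 i (F i v))" if "v \<in> X" for v
          using B[OF i1E that] conv_i1[OF i True] by simp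
        show "\<exists>z\<in>V. b0 i (p v) = p (i0 i (F i v)) + p (i1 i z)" if v: "v \<in> X" for v
          using b0p[OF i v] csub_scale[OF sub X_in[OF v]] by blast
        show "b0 i (p (i1 i x)) = p (i0 i (A i 1 x)) + \<mu> *\<^sub>C p (i1 i x)" if x: "x \<in> V" for x
        proof -
          have "i1 i x (i, 1) = x" by (simp add: i1_def)
          then show ?thesis using b0p[OF i i1X[OF x]] F_i1[OF i True x] a1
              lin_scale[OF lin_i1 x, of i \<mu>] lin_scale[OF p i1X[OF x]] by simp
        qed
        show "p (i0 i x + i1 i y) = 0 \<longleftrightarrow> A i 1 y + a0 i x = 0" if "x \<in> V" "y \<in> V" "A i 1 x = 0" for x y
          using ker_i[OF i that(1,2)] True that(3) a1 pQ[OF csub_add[OF subX i0_X[OF i that(1)] i1X[OF that(2)]]] by simp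
      qed ((rule V W subX p W_def[symmetric] lin_F surj_F[OF i] lin_i0 lin_i1 eA1 eB1 endo_a0[OF i] endo_b0[OF i] eW)+)
      moreover have "cdim (comm1 V (A i 1) (a0 i)) = cdim (comm1 V (A i 1) (complete_on r A i 0))"
        unfolding tA0 using dim_comm_shift(1)[OF V eA1 eA, of "- \<mu>"] by (cases "i = 0") simp_all
      moreover have "cdim (comm1 W (B i 1) (b0 i)) = cdim (comm1 W (B i 1) (complete_on r B i 0))"
        unfolding tB0 using dim_comm_shift(1)[OF W eB1 eB, of \<mu>] by (cases "i = 0") simp_all
      ultimately show ?thesis using True dim_Kd(2)[OF i True] t1 by (simp add: commutant_dim_def)
    qed
  qed
  define n where "n = int (cdim V)"
  define M where "M = int (r + (\<Sum>i\<le>r. m i))"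
  define K where "K = (\<Sum>i\<le>r. int (cdim (Kd i)))"
  \<comment> \<open>Only the product with e is claimed, so that \<mu> = 0 is covered:
    \<open>csum\<close> is then a surjection onto V with kernel \<open>QQ\<close>, which gives e =
    0. For \<mu> \<noteq> 0 the factor K is the dimension of \<open>QQ\<close>.\<close>
  have eK: "e * K = e * ((M - 1) * n - e)"
  proof (cases "\<mu> = 0")
    case True
    have "csum ` X = V" using surj_F[of 0] by (simp add: F_def[abs_def])
    moreover have "{v \<in> X. csum v = 0} = QQ" using Q0[OF True] by simp
    ultimately have "cdim X = cdim QQ + cdim V" using rank_nullity(3)[OF fdX lin_csum] by simp
    then have "e = 0" using dW by (simp add: e_def)
    then show ?thesis by simp
  next
    case False
    have "int (cdim QQ) = K" using dimQ(2)[OF False] by (simp add: K_def)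
    moreover have "int (cdim X) = M * n" unfolding dimX M_def n_def by simp
    ultimately have "K = (M - 1) * n - e" using dW eW by (simp add: n_def algebra_simps)
    then show ?thesis by simp
  qed
  have sm: "(\<Sum>i\<le>r. (int (m i) + 1) * e\<^sup>2) = (M + 1) * e\<^sup>2"
    by (simp add: M_def sum.distrib flip: sum_distrib_right)
  have "idx_on W r m B = (\<Sum>i\<le>r. int (commutant_dim V (m i) (complete_on r A i)) + (int (m i) + 1) * e\<^sup>2 + 2 * e * int (cdim (Kd i)))
      - (M - 1) * (n + e)\<^sup>2"
    using loc eW by (simp add: idx_on_def M_def n_def)
  also have "\<dots> = (\<Sum>i\<le>r. int (commutant_dim V (m i) (complete_on r A i))) + (M + 1) * e\<^sup>2 + 2 * (e * K) - (M - 1) * (n + e)\<^sup>2"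
    using sm by (simp add: sum.distrib K_def sum_distrib_left mult.assoc)
  \<comment> \<open>This is the identity (M + 1) e^2 + 2 e ((M - 1) n - e) = (M - 1) ((n + e)^2 -
    n^2).\<close>
  also have "\<dots> = (\<Sum>i\<le>r. int (commutant_dim V (m i) (complete_on r A i))) - (M - 1) * n\<^sup>2"
    unfolding eK by (simp add: power2_eq_square algebra_simps)
  also have "\<dots> = idx_on V r m A" by (simp add: idx_on_def M_def n_def)
  finally show ?thesis by (simp add: W_def)
qed

end

section \<open>Transfer to module records\<close>

text \<open>The record is not assumed to be a module: it inherits the axioms from \<open>S\<close>
  through \<open>g\<close>. In this way quotients and commutants become vector spaces together with
  their dimensions.\<close>

locale rec_iso =
  fixes M :: "(complex, 'v) module" and S :: "'a::cvs set" and g :: "'a \<Rightarrow> 'v"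
  assumes S: "csubspace S" and g_bij: "bij_betw g S (carrier M)"
    and g_add: "\<And>x y. x \<in> S \<Longrightarrow> y \<in> S \<Longrightarrow> g (x + y) = g x \<oplus>\<^bsub>M\<^esub> g y"
    and g_scale: "\<And>c x. x \<in> S \<Longrightarrow> g (c *\<^sub>C x) = c \<odot>\<^bsub>M\<^esub> g x"
    and g_0: "\<zero>\<^bsub>M\<^esub> = g 0"
begin

lemma g_in: "x \<in> S \<Longrightarrow> g x \<in> carrier M"
  using g_bij by (auto simp: bij_betw_def)

lemma g_inj: "x \<in> S \<Longrightarrow> y \<in> S \<Longrightarrow> g x = g y \<longleftrightarrow> x = y"
  using g_bij by (auto simp: bij_betw_def inj_on_def)

lemma g_surj: "y \<in> carrier M \<Longrightarrow> \<exists>x\<in>S. y = g x"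
  using g_bij by (auto simp: bij_betw_def)

lemma carrier_eq: "carrier M = g ` S"
  using g_bij by (auto simp: bij_betw_def)

lemma abelian: "abelian_group M"
proof (rule abelian_groupI)
  note c = csub_add[OF S] csub_0[OF S] csub_neg[OF S]
  show "x \<oplus>\<^bsub>M\<^esub> y \<in> carrier M" if "x \<in> carrier M" "y \<in> carrier M" for x y
    using that c by (auto simp: carrier_eq simp flip: g_add)
  show "\<zero>\<^bsub>M\<^esub> \<in> carrier M" using c by (simp add: g_0 g_in)
  show "x \<oplus>\<^bsub>M\<^esub> y \<oplus>\<^bsub>M\<^esub> z = x \<oplus>\<^bsub>M\<^esub> (y \<oplus>\<^bsub>M\<^esub> z)"
    if "x \<in> carrier M" "y \<in> carrier M" "z \<in> carrier M" for x y z
    using that c by (auto simp: carrier_eq add.assoc simp flip: g_add)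
  show "x \<oplus>\<^bsub>M\<^esub> y = y \<oplus>\<^bsub>M\<^esub> x" if "x \<in> carrier M" "y \<in> carrier M" for x y
    using that c by (auto simp: carrier_eq add.commute simp flip: g_add)
  show "\<zero>\<^bsub>M\<^esub> \<oplus>\<^bsub>M\<^esub> x = x" if "x \<in> carrier M" for x
    using that c by (auto simp: carrier_eq g_0 simp flip: g_add)
  show "\<exists>y\<in>carrier M. y \<oplus>\<^bsub>M\<^esub> x = \<zero>\<^bsub>M\<^esub>" if "x \<in> carrier M" for x
  proof -
    obtain u where u: "u \<in> S" "x = g u" using g_surj[OF \<open>x \<in> carrier M\<close>] by blast
    then have "g (- u) \<oplus>\<^bsub>M\<^esub> x = \<zero>\<^bsub>M\<^esub>" using c by (simp add: g_0 flip: g_add)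
    then show ?thesis using g_in[OF c(3)[OF u(1)]] by blast
  qed
qed

lemma module: "module class_ring M"
proof (rule moduleI[OF _ abelian])
  note c = csub_add[OF S] csub_scale[OF S]
  show "cring (class_ring :: complex ring)" by (rule class_cring.cring_axioms)
  show "a \<odot>\<^bsub>M\<^esub> x \<in> carrier M" if "x \<in> carrier M" for a x
    using that c by (auto simp: carrier_eq simp flip: g_scale)
  show "(a \<oplus>\<^bsub>class_ring\<^esub> b) \<odot>\<^bsub>M\<^esub> x = a \<odot>\<^bsub>M\<^esub> x \<oplus>\<^bsub>M\<^esub> b \<odot>\<^bsub>M\<^esub> x"
    if "x \<in> carrier M" for a b x
    using that c by (auto simp: carrier_eq cscale_add_left simp flip: g_scale g_add)
  show "a \<odot>\<^bsub>M\<^esub> (x \<oplus>\<^bsub>M\<^esub> y) = a \<odot>\<^bsub>M\<^esub> x \<oplus>\<^bsub>M\<^esub> a \<odot>\<^bsub>M\<^esub> y"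
    if "x \<in> carrier M" "y \<in> carrier M" for a x y
    using that c by (auto simp: carrier_eq cscale_add_right simp flip: g_scale g_add)
  show "(a \<otimes>\<^bsub>class_ring\<^esub> b) \<odot>\<^bsub>M\<^esub> x = a \<odot>\<^bsub>M\<^esub> (b \<odot>\<^bsub>M\<^esub> x)"
    if "x \<in> carrier M" for a b x
    using that c by (auto simp: carrier_eq cscale_cscale simp flip: g_scale)
  show "\<one>\<^bsub>class_ring\<^esub> \<odot>\<^bsub>M\<^esub> x = x" if "x \<in> carrier M" for x
    using that by (auto simp: carrier_eq cscale_one simp flip: g_scale)
qed

lemma vectorspace: "vectorspace class_ring M"
  unfolding vectorspace_def using module class_field.field_axioms by blast

lemma finsum:
  assumes "finite K" "\<And>k. k \<in> K \<Longrightarrow> x k \<in> S"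
  shows "finsum M (\<lambda>k. g (x k)) K = g (\<Sum>k\<in>K. x k)"
proof -
  interpret abelian_group M by (rule abelian)
  show ?thesis
    using assms
  proof (induction K)
    case empty
    show ?case by (simp add: g_0)
  next
    case (insert k K)
    have "(\<lambda>k. g (x k)) \<in> K \<rightarrow> carrier M" using insert g_in by auto
    moreover have "(\<Sum>k\<in>K. x k) \<in> S" using insert by (intro cv.subspace_sum[OF S]) auto
    ultimately show ?case using insert g_in by (simp add: finsum_insert g_add)
  qed
qed

lemma finsum_cong:
  assumes "finite K" "\<And>k. k \<in> K \<Longrightarrow> x k \<in> S" "\<And>k. k \<in> K \<Longrightarrow> y k = g (x k)"
  shows "finsum M y K = g (\<Sum>k\<in>K. x k)"
proof -
  interpret abelian_group M by (rule abelian)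
  have "finsum M y K = finsum M (\<lambda>k. g (x k)) K"
    using assms g_in by (intro finsum_cong') auto
  then show ?thesis using finsum[OF assms(1,2)] by simp
qed

lemma uminus: "x \<in> S \<Longrightarrow> \<ominus>\<^bsub>M\<^esub> g x = g (- x)"
proof -
  interpret abelian_group M by (rule abelian)
  assume x: "x \<in> S"
  have "g (- x) \<oplus>\<^bsub>M\<^esub> g x = \<zero>\<^bsub>M\<^esub>" using x csub_neg[OF S] by (simp add: g_0 flip: g_add)
  then show ?thesis using x csub_neg[OF S x] g_in by (metis minus_equality)
qed

lemma diff: "x \<in> S \<Longrightarrow> y \<in> S \<Longrightarrow> g x \<ominus>\<^bsub>M\<^esub> g y = g (x - y)"
  using csub_neg[OF S] g_add[of x "- y"] by (simp add: a_minus_def uminus)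

lemma span_image:
  assumes D: "finite D" "D \<subseteq> S"
  shows "LinearCombinations.module.span class_ring M (g ` D) = g ` cspan D"
proof -
  interpret M: vectorspace class_ring M by (rule vectorspace)
  have gD: "g ` D \<subseteq> carrier M" using D g_in by auto
  have inj: "inj_on g D" using g_bij D inj_on_subset by (auto simp: bij_betw_def)
  have lc: "M.lincomb a (g ` D) = g (\<Sum>d\<in>D. a (g d) *\<^sub>C d)" for a
  proof -
    have "M.lincomb a (g ` D) = finsum M (\<lambda>d. a (g d) \<odot>\<^bsub>M\<^esub> g d) D"
      unfolding M.lincomb_def using gD inj by (subst M.finsum_reindex) auto
    also have "\<dots> = g (\<Sum>d\<in>D. a (g d) *\<^sub>C d)"
      using D csub_scale[OF S] g_scale by (intro finsum_cong) auto
    finally show ?thesis .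
  qed
  show ?thesis
  proof (intro equalityI subsetI)
    fix y assume "y \<in> M.span (g ` D)"
    then obtain a where "y = M.lincomb a (g ` D)" using M.finite_span[OF finite_imageI[OF D(1)] gD] by auto
    moreover have "(\<Sum>d\<in>D. a (g d) *\<^sub>C d) \<in> cspan D"
      by (intro cv.span_sum cv.span_scale cv.span_base)
    ultimately show "y \<in> g ` cspan D" using lc by auto
  next
    fix y assume "y \<in> g ` cspan D"
    then obtain u where u: "y = g (\<Sum>d\<in>D. u d *\<^sub>C d)" using cv.span_finite[OF D(1)] by auto
    define a where "a = (\<lambda>v. u (the_inv_into D g v))"
    have "(\<Sum>d\<in>D. a (g d) *\<^sub>C d) = (\<Sum>d\<in>D. u d *\<^sub>C d)"
      using inj by (intro sum.cong) (auto simp: a_def the_inv_into_f_f)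
    then have "y = M.lincomb a (g ` D)" using u lc by simp
    then show "y \<in> M.span (g ` D)" using M.finite_span[OF finite_imageI[OF D(1)] gD] by auto
  qed
qed

text \<open>The dimension of a record is the least size of a finite spanning set. The image of a
  basis bounds it from above, and the preimage of an arbitrary finite spanning set bounds it from
  below.\<close>

lemma vdim:
  assumes fdS: "findim S"
  shows "vdim M = cdim S"
proof -
  interpret M: vectorspace class_ring M by (rule vectorspace)
  obtain B where B: "finite B" "B \<subseteq> S" "cspan B = S" "card B = cdim S"
    by (rule findim_basis[OF fdS]) blast
  have injB: "inj_on g B" using g_bij B inj_on_subset by (auto simp: bij_betw_def)
  show ?thesis unfolding M.dim_def
  proof (rule Least_equality)
    show "\<exists>A. finite A \<and> card A = cdim S \<and> A \<subseteq> carrier M \<and> M.span A = carrier M"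
      using B span_image[OF B(1,2)] g_in by (intro exI[of _ "g ` B"]) (auto simp: carrier_eq card_image[OF injB])
  next
    fix k assume "\<exists>A. finite A \<and> card A = k \<and> A \<subseteq> carrier M \<and> M.span A = carrier M"
    then obtain A where A: "finite A" "card A = k" "A \<subseteq> carrier M" "M.span A = carrier M" by blast
    define D where "D = {x \<in> S. g x \<in> A}"
    have gD: "g ` D = A" using A(3) g_surj by (auto simp: D_def)
    have injD: "inj_on g D" using g_bij by (auto simp: bij_betw_def D_def inj_on_def)
    have D: "finite D" "D \<subseteq> S"
      using finite_imageD[OF _ injD] gD A(1) by (simp, auto simp: D_def)
    have sD: "cspan D \<subseteq> S" by (rule cv.span_minimal[OF D(2) S])
    have "g ` cspan D = g ` S" using span_image[OF D] gD A(4) carrier_eq by simp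
    then have "cspan D = S"
      using g_bij sD by (meson bij_betw_imp_inj_on inj_on_image_eq_iff order_refl)
    then have "cdim S \<le> card D" using D(1) cv.dim_le_card[of S D] by simp
    also have "\<dots> = k" using gD A(2) card_image[OF injD] by simp
    finally show "cdim S \<le> k" .
  qed
qed

lemma is_subspace_image:
  assumes "csubspace U" "U \<subseteq> S"
  shows "is_subspace (g ` U) M"
proof -
  have "submodule class_ring (g ` U) M"
  proof (rule submodule.intro[OF module])
    show "g ` U \<subseteq> carrier M" using assms(2) g_in by blast
    show "v \<oplus>\<^bsub>M\<^esub> w \<in> g ` U" if "v \<in> g ` U" "w \<in> g ` U" for v w
      using that assms csub_add[OF assms(1)] by (auto simp: subset_iff simp flip: g_add)
    show "\<zero>\<^bsub>M\<^esub> \<in> g ` U" using csub_0[OF assms(1)] g_0 by blast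
    show "c \<odot>\<^bsub>M\<^esub> v \<in> g ` U" if "v \<in> g ` U" for c v
      using that assms csub_scale[OF assms(1)] by (auto simp: subset_iff simp flip: g_scale)
  qed
  then show ?thesis using vectorspace by (simp add: VectorSpace.subspace_def)
qed

lemma subspace_preimage:
  assumes W: "is_subspace W M"
  obtains U where "csubspace U" "U \<subseteq> S" "W = g ` U"
proof -
  have sm: "submodule class_ring W M" using W by (simp add: VectorSpace.subspace_def)
  define U where "U = {x \<in> S. g x \<in> W}"
  have WM: "W \<subseteq> carrier M" by (rule submodule.subset[OF sm])
  have "csubspace U"
  proof (rule csubspaceI)
    show "0 \<in> U" using submodule.zero_closed[OF sm] csub_0[OF S] g_0 by (simp add: U_def)
    show "x + y \<in> U" if "x \<in> U" "y \<in> U" for x y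
      using that submodule.m_closed[OF sm] csub_add[OF S] by (simp add: U_def g_add)
    show "c *\<^sub>C x \<in> U" if "x \<in> U" for c x
      using that submodule.smult_closed[OF sm] csub_scale[OF S] by (simp add: U_def g_scale)
  qed
  moreover have "W = g ` U" using WM carrier_eq by (auto simp: U_def)
  moreover have "U \<subseteq> S" by (auto simp: U_def)
  ultimately show ?thesis by (intro that[of U])
qed

lemma is_endoI:
  assumes T: "endo S T" and e: "\<And>x. x \<in> S \<Longrightarrow> f (g x) = g (T x)"
  shows "is_endo M f"
  unfolding LinearCombinations.module_hom_def
proof (intro CollectI conjI allI impI)
  show "f \<in> carrier M \<rightarrow> carrier M" using e endoD(2)[OF T] g_in by (auto simp: carrier_eq)
  show "f (x \<oplus>\<^bsub>M\<^esub> y) = f x \<oplus>\<^bsub>M\<^esub> f y" if xy: "x \<in> carrier M \<and> y \<in> carrier M" for x y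
  proof -
    obtain u v where u: "u \<in> S" "v \<in> S" "x = g u" "y = g v"
      using g_surj[of x] g_surj[of y] xy by blast
    show ?thesis
      using u e[OF csub_add[OF S u(1,2)]] e[OF u(1)] e[OF u(2)] lin_add[OF endoD(1)[OF T] u(1,2)] endoD(2)[OF T]
      by (simp add: g_add)
  qed
  show "f (c \<odot>\<^bsub>M\<^esub> x) = c \<odot>\<^bsub>M\<^esub> f x" if cx: "c \<in> carrier class_ring \<and> x \<in> carrier M" for c x
  proof -
    obtain u where u: "u \<in> S" "x = g u" using cx g_surj[of x] by blast
    show ?thesis
      using u e[OF csub_scale[OF S u(1)], of c] e[OF u(1)] lin_scale[OF endoD(1)[OF T] u(1), of c] endoD(2)[OF T]
      by (simp add: g_scale)
  qed
qed

definition pull :: "('v \<Rightarrow> 'v) \<Rightarrow> 'a \<Rightarrow> 'a" where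
  "pull f = (\<lambda>x. if x \<in> S then the_inv_into S g (f (g x)) else 0)"

lemma pull:
  assumes f: "is_endo M f"
  shows "pull f \<in> Hom S S" "endo S (pull f)" "x \<in> S \<Longrightarrow> g (pull f x) = f (g x)"
proof -
  have inj: "inj_on g S" using g_bij by (simp add: bij_betw_def)
  have fc: "f (g x) \<in> g ` S" if "x \<in> S" for x
    using LinearCombinations.module_hom_closed[OF f] g_in[OF that] carrier_eq by auto
  have gp: "g (pull f x) = f (g x)" and pS: "pull f x \<in> S" if "x \<in> S" for x
    using that fc[OF that] f_the_inv_into_f[OF inj] the_inv_into_into[OF inj, of _ S] by (auto simp: pull_def)
  have "lin S (pull f)"
  proof (rule linI)
    fix x c assume x: "x \<in> S"
    have "g (pull f (c *\<^sub>C x)) = g (c *\<^sub>C pull f x)"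
      using gp[OF csub_scale[OF S x]] gp[OF x] g_scale[OF x] g_scale[OF pS[OF x]] g_in[OF x]
        LinearCombinations.module_hom_smult[OF f, of c "g x"] by simp
    then show "pull f (c *\<^sub>C x) = c *\<^sub>C pull f x"
      using g_inj[OF pS[OF csub_scale[OF S x]] csub_scale[OF S pS[OF x]]] by blast
    fix y assume y: "y \<in> S"
    have "g (pull f (x + y)) = g (pull f x + pull f y)"
      using gp[OF csub_add[OF S x y]] gp[OF x] gp[OF y] g_add[OF x y] g_add[OF pS[OF x] pS[OF y]] g_in x y
        LinearCombinations.module_hom_add[OF f, of "g x" "g y"] by simp
    then show "pull f (x + y) = pull f x + pull f y"
      using g_inj[OF pS[OF csub_add[OF S x y]] csub_add[OF S pS[OF x] pS[OF y]]] by blast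
  qed
  then show "pull f \<in> Hom S S" "endo S (pull f)" "x \<in> S \<Longrightarrow> g (pull f x) = f (g x)"
    using gp pS by (auto simp: Hom_def endo_def pull_def)
qed

lemma direct_power: "rec_iso (direct_power K M) (fun_space K (\<lambda>_. S)) (\<lambda>v. \<lambda>k\<in>K. g (v k))"
proof
  show "csubspace (fun_space K (\<lambda>_. S))" by (rule csubspace_fun_space[OF S])
  show "bij_betw (\<lambda>v. \<lambda>k\<in>K. g (v k)) (fun_space K (\<lambda>_. S)) (carrier (direct_power K M))"
  proof (rule bij_betwI')
    show "(\<lambda>k\<in>K. g (v k)) = (\<lambda>k\<in>K. g (w k)) \<longleftrightarrow> v = w" if "v \<in> fun_space K (\<lambda>_. S)" "w \<in> fun_space K (\<lambda>_. S)" for v w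
    proof
      assume eq: "(\<lambda>k\<in>K. g (v k)) = (\<lambda>k\<in>K. g (w k))"
      show "v = w"
      proof
        fix k
        show "v k = w k"
        proof (cases "k \<in> K")
          case True
          then have "g (v k) = g (w k)" using fun_cong[OF eq, of k] by simp
          then show ?thesis using g_inj[of "v k" "w k"] that True unfolding fun_space_def by blast
        next
          case False
          then show ?thesis using that unfolding fun_space_def by simp
        qed
      qed
    qed simp
    show "(\<lambda>k\<in>K. g (v k)) \<in> carrier (direct_power K M)" if "v \<in> fun_space K (\<lambda>_. S)" for v
      using that g_in by (auto simp: direct_power_def fun_space_def)
    show "\<exists>v\<in>fun_space K (\<lambda>_. S). y = (\<lambda>k\<in>K. g (v k))" if y: "y \<in> carrier (direct_power K M)" for y
    proof -
      have yk: "y k \<in> g ` S" if "k \<in> K" for k using y that carrier_eq by (auto simp: direct_power_def)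
      have inj: "inj_on g S" using g_bij by (simp add: bij_betw_def)
      show ?thesis
      proof (rule bexI[of _ "\<lambda>k. if k \<in> K then the_inv_into S g (y k) else 0"])
        show "y = (\<lambda>k\<in>K. g (if k \<in> K then the_inv_into S g (y k) else 0))"
        proof
          fix k show "y k = (\<lambda>k\<in>K. g (if k \<in> K then the_inv_into S g (y k) else 0)) k"
            using yk[of k] f_the_inv_into_f[OF inj] y by (cases "k \<in> K") (auto simp: direct_power_def PiE_def extensional_def)
        qed
        show "(\<lambda>k. if k \<in> K then the_inv_into S g (y k) else 0) \<in> fun_space K (\<lambda>_. S)"
          using yk the_inv_into_into[OF inj] by (auto simp: fun_space_def)
      qed
    qed
  qed
qed (auto simp: direct_power_def fun_space_def g_add g_scale g_0 restrict_def fun_eq_iff)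

end

section \<open>Block Toeplitz matrices and their commutants\<close>

definition toep :: "nat \<Rightarrow> (nat \<Rightarrow> 'a \<Rightarrow> 'a::cvs) \<Rightarrow> (nat \<Rightarrow> 'a) \<Rightarrow> nat \<Rightarrow> 'a" where
  "toep m C w = (\<lambda>j. if j \<le> m then \<Sum>k\<le>j. C (m - (j - k)) (w k) else 0)"

lemma toep_in:
  assumes "csubspace S" "\<And>j. j \<le> m \<Longrightarrow> endo S (C j)" "w \<in> fun_space {..m} (\<lambda>_. S)"
  shows "toep m C w \<in> fun_space {..m} (\<lambda>_. S)"
proof -
  have "(\<Sum>k\<le>j. C (m - (j - k)) (w k)) \<in> S" if "j \<le> m" for j
  proof (rule cv.subspace_sum[OF assms(1)])
    fix k assume "k \<in> {..j}"
    then show "C (m - (j - k)) (w k) \<in> S"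
      using endoD(2)[OF assms(2)[of "m - (j - k)"], of "w k"] assms(3) that by (auto simp: fun_space_def)
  qed
  then show ?thesis by (simp add: toep_def fun_space_def)
qed

lemma lin_toep:
  assumes "csubspace S" "\<And>j. j \<le> m \<Longrightarrow> endo S (C j)"
  shows "lin (fun_space {..m} (\<lambda>_. S)) (toep m C)"
proof (rule linI)
  have l: "lin S (C j)" if "j \<le> m" for j using endoD(1)[OF assms(2)[OF that]] .
  fix x assume x: "x \<in> fun_space {..m} (\<lambda>_. S)"
  then have xS: "x k \<in> S" if "k \<le> m" for k using that by (auto simp: fun_space_def)
  show "toep m C (c *\<^sub>C x) = c *\<^sub>C toep m C x" for c
    using xS lin_scale[OF l] by (auto simp: toep_def fun_eq_iff cv.scale_sum_right intro!: sum.cong)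
  fix y assume y: "y \<in> fun_space {..m} (\<lambda>_. S)"
  then have yS: "y k \<in> S" if "k \<le> m" for k using that by (auto simp: fun_space_def)
  show "toep m C (x + y) = toep m C x + toep m C y"
    using xS yS lin_add[OF l] by (auto simp: toep_def fun_eq_iff sum.distrib[symmetric] intro!: sum.cong)
qed

lemma toep_add: "toep m (C + D) w = toep m C w + toep m D w"
  by (simp add: toep_def fun_eq_iff sum.distrib)

lemma toep_scale: "toep m (c *\<^sub>C C) w = c *\<^sub>C toep m C w"
  by (simp add: toep_def fun_eq_iff cv.scale_sum_right)

lemma toep_0: "toep 0 C w = (\<lambda>j. if j = 0 then C 0 (w 0) else 0)"
  by (auto simp: toep_def fun_eq_iff)

lemma toep_1: "toep 1 C w = (\<lambda>j. if j = 0 then C 1 (w 0) else if j = 1 then C 0 (w 0) + C 1 (w 1) else 0)"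
proof
  fix j :: nat
  have "{..1} = {0, 1::nat}" by auto
  then show "toep 1 C w j = (if j = 0 then C 1 (w 0) else if j = 1 then C 0 (w 0) + C 1 (w 1) else 0)"
    by (cases "j = 0"; cases "j = 1") (auto simp: toep_def)
qed

text \<open>The commutant in terms of the blocks instead of the matrices, so that addition and
  scaling are those of functions.\<close>

definition toep_commutant :: "'a::cvs set \<Rightarrow> nat \<Rightarrow> (nat \<Rightarrow> 'a \<Rightarrow> 'a) \<Rightarrow> (nat \<Rightarrow> 'a \<Rightarrow> 'a) set" where
  "toep_commutant S m B = {C \<in> fun_space {..m} (\<lambda>_. Hom S S). \<forall>w\<in>fun_space {..m} (\<lambda>_. S). toep m B (toep m C w) = toep m C (toep m B w)}"

lemma toep_commutantD:
  assumes "C \<in> toep_commutant S m B"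
  shows "j \<le> m \<Longrightarrow> C j \<in> Hom S S" "j \<le> m \<Longrightarrow> endo S (C j)" "\<not> j \<le> m \<Longrightarrow> C j = 0"
    "w \<in> fun_space {..m} (\<lambda>_. S) \<Longrightarrow> toep m B (toep m C w) = toep m C (toep m B w)"
  using assms by (auto simp: toep_commutant_def fun_space_def Hom_def endo_def)

lemma csubspace_toep_commutant:
  assumes S: "csubspace S" and B: "\<And>j. j \<le> m \<Longrightarrow> endo S (B j)"
  shows "csubspace (toep_commutant S m B)"
proof (rule csubspaceI)
  let ?P = "fun_space {..m} (\<lambda>_. Hom S S)" and ?W = "fun_space {..m} (\<lambda>_. S)"
  have P: "csubspace ?P" by (rule csubspace_fun_space[OF csubspace_Hom[OF S]])
  have W: "csubspace ?W" by (rule csubspace_fun_space[OF S])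
  note l = lin_toep[OF S B]
  have in_W: "toep m C w \<in> ?W" if "C \<in> toep_commutant S m B" "w \<in> ?W" for C w
    by (rule toep_in[OF S toep_commutantD(2)[OF that(1)] that(2)])
  have t0: "toep m 0 w = 0" for w :: "nat \<Rightarrow> 'a" by (simp add: toep_def fun_eq_iff)
  show "0 \<in> toep_commutant S m B"
    using csub_0[OF P] t0 lin_0[OF l W] by (simp add: toep_commutant_def)
  show "C + D \<in> toep_commutant S m B" if "C \<in> toep_commutant S m B" "D \<in> toep_commutant S m B" for C D
  proof -
    have "C + D \<in> ?P" using csub_add[OF P] that by (simp add: toep_commutant_def)
    moreover have "toep m B (toep m (C + D) w) = toep m (C + D) (toep m B w)" if w: "w \<in> ?W" for w
      using lin_add[OF l in_W[OF \<open>C \<in> _\<close> w] in_W[OF \<open>D \<in> _\<close> w]] toep_commutantD(4)[OF \<open>C \<in> _\<close> w] toep_commutantD(4)[OF \<open>D \<in> _\<close> w]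
      by (simp add: toep_add)
    ultimately show ?thesis by (simp add: toep_commutant_def)
  qed
  show "c *\<^sub>C C \<in> toep_commutant S m B" if "C \<in> toep_commutant S m B" for C c
  proof -
    have "c *\<^sub>C C \<in> ?P" using csub_scale[OF P] that by (simp add: toep_commutant_def)
    moreover have "toep m B (toep m (c *\<^sub>C C) w) = toep m (c *\<^sub>C C) (toep m B w)" if w: "w \<in> ?W" for w
      using lin_scale[OF l in_W[OF \<open>C \<in> _\<close> w]] toep_commutantD(4)[OF \<open>C \<in> _\<close> w] by (simp add: toep_scale)
    ultimately show ?thesis by (simp add: toep_commutant_def)
  qed
qed

text \<open>Columns concentrated at index 0 already yield all coefficient equations that define
  \<open>comm0\<close> and \<open>comm1\<close>; by linearity these imply the equation on every
  column.\<close>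

lemma dim_toep_commutant:
  assumes S: "findim S" and m: "m \<le> 1" and B: "\<And>j. j \<le> m \<Longrightarrow> endo S (B j)"
  shows "findim (toep_commutant S m B)" "cdim (toep_commutant S m B) = commutant_dim S m B"
proof -
  have P: "findim (fun_space {..m} (\<lambda>_. Hom S S))"
    using dim_fun_space[of "{..m}" "\<lambda>_. Hom S S"] dim_Hom[OF S S] by auto
  have sub: "csubspace (toep_commutant S m B)" by (rule csubspace_toep_commutant[OF findim_sub[OF S] B])
  show fdT: "findim (toep_commutant S m B)" by (rule findim_subset[OF P sub]) (auto simp: toep_commutant_def)
  have single: "(\<lambda>k. if k = 0 then x else 0) \<in> fun_space {..m} (\<lambda>_. S)" if "x \<in> S" for x
    using that csub_0[OF findim_sub[OF S]] by (auto simp: fun_space_def)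
  show "cdim (toep_commutant S m B) = commutant_dim S m B"
  proof (cases "m = 0")
    case True
    have "cdim (comm0 S (B 0)) = cdim (toep_commutant S m B)"
    proof (rule dim_inverse(2)[OF sub csubspace_comm0[OF findim_sub[OF S] B[of 0]] _ _ _ _ _ fdT,
          of "\<lambda>C. C 0" "\<lambda>c j. if j = 0 then c else 0"])
      show "C 0 \<in> comm0 S (B 0)" if C: "C \<in> toep_commutant S m B" for C
      proof -
        have "C 0 (B 0 x) = B 0 (C 0 x)" if "x \<in> S" for x
          using fun_cong[OF toep_commutantD(4)[OF C single[OF that]], of 0] by (simp add: True toep_0)
        then show ?thesis using toep_commutantD(1)[OF C, of 0] by (simp add: comm0_def)
      qed
      show "(\<lambda>j. if j = 0 then c else 0) \<in> toep_commutant S m B" if c: "c \<in> comm0 S (B 0)" for c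
        using c by (auto simp: toep_commutant_def True toep_0 comm0_def fun_space_def fun_eq_iff)
      show "(\<lambda>j. if j = 0 then C 0 else 0) = C" if "C \<in> toep_commutant S m B" for C
        using toep_commutantD(3)[OF that] True by (auto simp: fun_eq_iff)
    qed (auto intro: linI)
    then show ?thesis using True by (simp add: commutant_dim_def)
  next
    case False
    then have m1: "m = 1" using m by auto
    have z: "c 0 = 0" if "c \<in> Hom S S" for c using lin_0[OF HomD(1)[OF that] findim_sub[OF S]] .
    have "cdim (comm1 S (B 1) (B 0)) = cdim (toep_commutant S m B)"
    proof (rule dim_inverse(2)[OF sub csubspace_comm1[OF findim_sub[OF S] B[of 1] B[of 0]] _ _ _ _ _ fdT,
          of "\<lambda>C. (C 1, C 0)" "\<lambda>p j. if j = 0 then snd p else if j = 1 then fst p else 0"])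
      show "(C 1, C 0) \<in> comm1 S (B 1) (B 0)" if C: "C \<in> toep_commutant S m B" for C
      proof -
        have H: "C 1 \<in> Hom S S" "C 0 \<in> Hom S S" using toep_commutantD(1)[OF C] m1 by auto
        have B0: "B 1 0 = 0" using lin_0[OF endoD(1)[OF B[of 1]] findim_sub[OF S]] m1 by simp
        have "C 1 (B 1 x) = B 1 (C 1 x) \<and> B 0 (C 1 x) + B 1 (C 0 x) = C 0 (B 1 x) + C 1 (B 0 x)" if "x \<in> S" for x
          using fun_cong[OF toep_commutantD(4)[OF C single[OF that]], of 0]
            fun_cong[OF toep_commutantD(4)[OF C single[OF that]], of 1] z[OF H(1)] z[OF H(2)] B0 by (simp add: m1 toep_1)
        then show ?thesis using H by (simp add: comm1_def)
      qed
      show "(\<lambda>j. if j = 0 then snd p else if j = 1 then fst p else 0) \<in> toep_commutant S m B"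
        if p: "p \<in> comm1 S (B 1) (B 0)" for p
      proof -
        obtain c1 c0 where [simp]: "p = (c1, c0)" by (metis prod.collapse)
        let ?C = "\<lambda>j. if j = 0 then c0 else if j = 1 then c1 else 0"
        have H: "c1 \<in> Hom S S" "c0 \<in> Hom S S"
          and e: "\<And>x. x \<in> S \<Longrightarrow> c1 (B 1 x) = B 1 (c1 x)"
          "\<And>x. x \<in> S \<Longrightarrow> B 0 (c1 x) + B 1 (c0 x) = c0 (B 1 x) + c1 (B 0 x)"
          using p by (auto simp: comm1_def)
        have "toep m B (toep m ?C w) = toep m ?C (toep m B w)" if w: "w \<in> fun_space {..m} (\<lambda>_. S)" for w
        proof -
          have wS: "w 0 \<in> S" "w 1 \<in> S" using w m1 by (auto simp: fun_space_def)
          have i: "c0 (w 0) \<in> S" "c1 (w 1) \<in> S" "B 0 (w 0) \<in> S" "B 1 (w 1) \<in> S"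
            using wS HomD(2)[OF H(1)] HomD(2)[OF H(2)] endoD(2)[OF B[of 0]] endoD(2)[OF B[of 1]] m1 by auto
          have "B 0 (c1 (w 0)) + B 1 (c0 (w 0) + c1 (w 1)) = c0 (B 1 (w 0)) + c1 (B 0 (w 0) + B 1 (w 1))"
            using lin_add[OF endoD(1)[OF B[of 1]] i(1,2)] lin_add[OF HomD(1)[OF H(1)] i(3,4)] e(2)[OF wS(1)] e(1)[OF wS(2)] m1
            by (simp add: add.assoc[symmetric])
          then show ?thesis using e(1)[OF wS(1)] by (auto simp: m1 toep_1 fun_eq_iff)
        qed
        moreover have "?C \<in> fun_space {..m} (\<lambda>_. Hom S S)" using H by (auto simp: fun_space_def m1)
        moreover have eq: "(\<lambda>j. if j = 0 then snd p else if j = 1 then fst p else 0) = ?C"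
          unfolding \<open>p = (c1, c0)\<close> fst_conv snd_conv ..
        ultimately show ?thesis unfolding eq by (simp add: toep_commutant_def)
      qed
      show "(\<lambda>j. if j = 0 then snd (C 1, C 0) else if j = 1 then fst (C 1, C 0) else 0) = C" if "C \<in> toep_commutant S m B" for C
        using toep_commutantD(3)[OF that] m1 by (auto simp: fun_eq_iff)
    qed (auto intro!: linI simp: m1 cscale_prod_def)
    then show ?thesis using m1 by (simp add: commutant_dim_def)
  qed
qed

lemma endo_complete_on:
  assumes S: "csubspace S" and e: "\<And>i j. (i, j) \<in> entries r m \<Longrightarrow> endo S (A i j)"
    and i: "i \<le> r" and j: "j \<le> m i"
  shows "endo S (complete_on r A i j)"
proof (cases "i = 0 \<and> j = 0")
  case True
  have E0: "endo S (A k 0)" if "k \<in> {1..r}" for k using that by (intro e) (auto simp: entries_def)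
  have "lin S (\<lambda>x. - (\<Sum>k\<in>{1..r}. A k 0 x))"
    using endoD(1)[OF E0] by (intro lin_uminus lin_sumf) auto
  moreover have "- (\<Sum>k\<in>{1..r}. A k 0 x) \<in> S" if "x \<in> S" for x
    using that endoD(2)[OF E0] by (intro csub_neg[OF S] cv.subspace_sum[OF S]) auto
  ultimately show ?thesis using True by (simp add: endo_def complete_on_def)
next
  case False
  then have "(i, j) \<in> entries r m" using i j by (auto simp: entries_def)
  then show ?thesis using e False by (auto simp: complete_on_def)
qed

section \<open>The index of rigidity of a record\<close>

context rec_iso
begin

definition G :: "nat \<Rightarrow> (nat \<Rightarrow> 'a) \<Rightarrow> nat \<Rightarrow> 'v" where
  "G m w = (\<lambda>k\<in>{..m}. g (w k))"

lemma G_iso: "rec_iso (direct_power {..m} M) (fun_space {..m} (\<lambda>_. S)) (G m)"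
  using direct_power[of "{..m}"] by (simp add: G_def[abs_def])

lemma toeplitz_G:
  assumes C: "\<And>j. j \<le> m \<Longrightarrow> endo S (C' j)" "\<And>j x. j \<le> m \<Longrightarrow> x \<in> S \<Longrightarrow> C j (g x) = g (C' j x)"
    and w: "w \<in> fun_space {..m} (\<lambda>_. S)"
  shows "toeplitz M m C (G m w) = G m (toep m C' w)"
proof -
  interpret G: rec_iso "direct_power {..m} M" "fun_space {..m} (\<lambda>_. S)" "G m" by (rule G_iso)
  have "finsum M (\<lambda>k. C (m - (j - k)) (G m w k)) {..j} = g (toep m C' w j)" if j: "j \<le> m" for j
  proof -
    have wS: "w k \<in> S" if "k \<le> m" for k using w that by (auto simp: fun_space_def)
    have "finsum M (\<lambda>k. C (m - (j - k)) (G m w k)) {..j} = g (\<Sum>k\<le>j. C' (m - (j - k)) (w k))"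
    proof (rule finsum_cong)
      fix k assume "k \<in> {..j}"
      then have k: "k \<le> m" "m - (j - k) \<le> m" using j by auto
      show "C' (m - (j - k)) (w k) \<in> S" using endoD(2)[OF C(1)[OF k(2)] wS[OF k(1)]] .
      show "C (m - (j - k)) (G m w k) = g (C' (m - (j - k)) (w k))"
        using C(2)[OF k(2) wS[OF k(1)]] k by (simp add: G_def)
    qed simp
    then show ?thesis using j by (simp add: toep_def)
  qed
  then show ?thesis
    using G.g_in[OF w] by (auto simp: toeplitz_def G_def[of m "toep m C' w"] fun_eq_iff restrict_def)
qed

definition push :: "('a \<Rightarrow> 'a) \<Rightarrow> 'v \<Rightarrow> 'v" where
  "push f = (\<lambda>y. g (f (the_inv_into S g y)))"

lemma push: "x \<in> S \<Longrightarrow> push f (g x) = g (f x)"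
  using g_bij by (simp add: push_def bij_betw_def the_inv_into_f_f)

text \<open>A Toeplitz matrix determines its blocks: applied to a column with x at index 0 and zeros
  elsewhere, its component of index m - j is C j x. In the other direction the blocks of a given
  matrix are pulled back to \<open>S\<close>.\<close>

lemma commutant_iso:
  assumes B: "\<And>j. j \<le> m \<Longrightarrow> endo S (B' j)" "\<And>j x. j \<le> m \<Longrightarrow> x \<in> S \<Longrightarrow> B j (g x) = g (B' j x)"
  shows "rec_iso ((End_space (direct_power {..m} M))\<lparr>carrier := toeplitz_commutant M m B\<rparr>)
    (toep_commutant S m B') (\<lambda>C. toeplitz M m (\<lambda>j. push (C j)))"
proof -
  interpret G: rec_iso "direct_power {..m} M" "fun_space {..m} (\<lambda>_. S)" "G m" by (rule G_iso)
  let ?W = "fun_space {..m} (\<lambda>_. S)"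
  define h where "h = (\<lambda>C::nat \<Rightarrow> 'a \<Rightarrow> 'a. toeplitz M m (\<lambda>j. push (C j)))"
  have hG: "h C (G m w) = G m (toep m C w)" if "C \<in> toep_commutant S m B'" "w \<in> ?W" for C w
    unfolding h_def by (rule toeplitz_G[OF toep_commutantD(2)[OF that(1)] push that(2)])
  have toep_W: "toep m C w \<in> ?W" if "C \<in> toep_commutant S m B'" "w \<in> ?W" for C w
    by (rule toep_in[OF S toep_commutantD(2)[OF that(1)] that(2)])
  have BG: "toeplitz M m B (G m w) = G m (toep m B' w)" if "w \<in> ?W" for w by (rule toeplitz_G[OF B that])
  have BW: "toep m B' w \<in> ?W" if "w \<in> ?W" for w by (rule toep_in[OF S B(1) that])
  have ext: "toeplitz M m C = f"
    if "f \<in> extensional (carrier (direct_power {..m} M))" "\<And>w. w \<in> ?W \<Longrightarrow> toeplitz M m C (G m w) = f (G m w)" for C f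
  proof
    fix v
    show "toeplitz M m C v = f v"
    proof (cases "v \<in> carrier (direct_power {..m} M)")
      case True
      then show ?thesis using that(2) G.carrier_eq by auto
    next
      case False
      then show ?thesis using that(1) by (simp add: toeplitz_def extensional_def)
    qed
  qed
  have toe_ext: "toeplitz M m C \<in> extensional (carrier (direct_power {..m} M))" for C
    by (simp add: toeplitz_def)
  have mem: "h C \<in> toeplitz_commutant M m B" if C: "C \<in> toep_commutant S m B'" for C
  proof -
    have "is_endo M (push (C j))" if "j \<le> m" for j
      by (rule is_endoI[OF toep_commutantD(2)[OF C that] push])
    moreover have "toeplitz M m B (h C v) = h C (toeplitz M m B v)" if "v \<in> carrier (direct_power {..m} M)" for v
    proof -
      obtain w where w: "w \<in> ?W" "v = G m w"
        using G.g_surj[OF \<open>v \<in> carrier _\<close>] by blast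
      then show ?thesis using hG[OF C] BG toep_W[OF C] BW toep_commutantD(4)[OF C] by simp
    qed
    ultimately show ?thesis unfolding toeplitz_commutant_def h_def by blast
  qed
  have "rec_iso ((End_space (direct_power {..m} M))\<lparr>carrier := toeplitz_commutant M m B\<rparr>) (toep_commutant S m B') h"
  proof
    show CS: "csubspace (toep_commutant S m B')" by (rule csubspace_toep_commutant[OF S B(1)])
    show "bij_betw h (toep_commutant S m B') (carrier ((End_space (direct_power {..m} M))\<lparr>carrier := toeplitz_commutant M m B\<rparr>))"
    proof (rule bij_betwI')
      show "h C = h D \<longleftrightarrow> C = D" if C: "C \<in> toep_commutant S m B'" and D: "D \<in> toep_commutant S m B'" for C D
      proof
        assume eq: "h C = h D"
        have e: "toep m C w = toep m D w" if "w \<in> ?W" for w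
          using eq hG[OF C that] hG[OF D that] G.g_inj[OF toep_W[OF C that] toep_W[OF D that]] by simp
        have CD: "C j x = D j x" if j: "j \<le> m" and x: "x \<in> S" for j x
        proof -
          define w where "w = (\<lambda>k::nat. if k = 0 then x else 0)"
          have wW: "w \<in> ?W" using x csub_0[OF S] by (auto simp: w_def fun_space_def)
          have s: "toep m K w (m - j) = K j x" if K: "K \<in> toep_commutant S m B'" for K
          proof -
            have K0: "K i 0 = 0" if "i \<le> m" for i using lin_0[OF endoD(1)[OF toep_commutantD(2)[OF K that]] S] .
            have "toep m K w (m - j) = (\<Sum>k\<le>m - j. K (m - (m - j - k)) (w k))" by (simp add: toep_def)
            also have "\<dots> = (\<Sum>k\<le>m - j. if k = 0 then K j x else 0)"
              using K0 j by (intro sum.cong) (auto simp: w_def)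
            also have "\<dots> = K j x" by simp
            finally show ?thesis .
          qed
          show ?thesis using s[OF C] s[OF D] e[OF wW] by simp
        qed
        show "C = D"
        proof
          fix j
          show "C j = D j"
          proof (cases "j \<le> m")
            case True
            then show ?thesis using Hom_eqI[OF toep_commutantD(1)[OF C True] toep_commutantD(1)[OF D True]] CD by blast
          next
            case False
            then show ?thesis using toep_commutantD(3)[OF C] toep_commutantD(3)[OF D] by simp
          qed
        qed
      qed simp
      show "h C \<in> carrier ((End_space (direct_power {..m} M))\<lparr>carrier := toeplitz_commutant M m B\<rparr>)"
        if "C \<in> toep_commutant S m B'" for C using mem[OF that] by simp
      show "\<exists>C\<in>toep_commutant S m B'. T = h C"
        if T: "T \<in> carrier ((End_space (direct_power {..m} M))\<lparr>carrier := toeplitz_commutant M m B\<rparr>)" for T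
      proof -
        obtain c where c: "T = toeplitz M m c" "\<And>j. j \<le> m \<Longrightarrow> is_endo M (c j)"
          "\<And>v. v \<in> carrier (direct_power {..m} M) \<Longrightarrow>
            toeplitz M m B (toeplitz M m c v) = toeplitz M m c (toeplitz M m B v)"
          using T by (auto simp: toeplitz_commutant_def)
        define C where "C = (\<lambda>j. if j \<le> m then pull (c j) else 0)"
        have Ce: "endo S (C j)" "\<And>x. x \<in> S \<Longrightarrow> c j (g x) = g (C j x)" if "j \<le> m" for j
          using pull[OF c(2)[OF that]] that by (auto simp: C_def)
        have cG: "toeplitz M m c (G m w) = G m (toep m C w)" if "w \<in> ?W" for w
          by (rule toeplitz_G[OF Ce that])
        have CW: "toep m C w \<in> ?W" if "w \<in> ?W" for w by (rule toep_in[OF S Ce(1) that])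
        have "toep m B' (toep m C w) = toep m C (toep m B' w)" if w: "w \<in> ?W" for w
        proof -
          have "G m (toep m B' (toep m C w)) = G m (toep m C (toep m B' w))"
            using c(3)[OF G.g_in[OF w]] cG[OF w] BG[OF w] BG[OF CW[OF w]] cG[OF BW[OF w]] by simp
          then show ?thesis using G.g_inj[OF BW[OF CW[OF w]] CW[OF BW[OF w]]] by simp
        qed
        moreover have "C \<in> fun_space {..m} (\<lambda>_. Hom S S)" using pull(1)[OF c(2)] by (auto simp: fun_space_def C_def)
        ultimately have C: "C \<in> toep_commutant S m B'" by (simp add: toep_commutant_def)
        have "T = h C" unfolding c(1)
          by (rule ext) (use hG[OF C] cG toe_ext in \<open>auto simp: h_def\<close>)
        then show ?thesis using C by blast
      qed
    qed
    show "h (C + D) = h C \<oplus>\<^bsub>(End_space (direct_power {..m} M))\<lparr>carrier := toeplitz_commutant M m B\<rparr>\<^esub> h D"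
      if C: "C \<in> toep_commutant S m B'" and D: "D \<in> toep_commutant S m B'" for C D
    proof -
      have "h (C + D) = (\<lambda>x\<in>carrier (direct_power {..m} M). h C x \<oplus>\<^bsub>direct_power {..m} M\<^esub> h D x)"
        unfolding h_def
      proof (rule ext[folded h_def])
        fix w assume w: "w \<in> ?W"
        have "h (C + D) (G m w) = G m (toep m C w + toep m D w)"
          using hG[OF csub_add[OF CS C D] w] by (simp add: toep_add)
        then show "toeplitz M m (\<lambda>j. push ((C + D) j)) (G m w) =
            (\<lambda>x\<in>carrier (direct_power {..m} M). toeplitz M m (\<lambda>j. push (C j)) x \<oplus>\<^bsub>direct_power {..m} M\<^esub> toeplitz M m (\<lambda>j. push (D j)) x) (G m w)"
          using G.g_in[OF w] hG[OF C w] hG[OF D w] G.g_add[OF toep_W[OF C w] toep_W[OF D w]] by (simp add: h_def)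
      qed simp
      then show ?thesis by (simp add: End_space_def)
    qed
    show "h (c *\<^sub>C C) = c \<odot>\<^bsub>(End_space (direct_power {..m} M))\<lparr>carrier := toeplitz_commutant M m B\<rparr>\<^esub> h C"
      if C: "C \<in> toep_commutant S m B'" for C c
    proof -
      have "h (c *\<^sub>C C) = (\<lambda>x\<in>carrier (direct_power {..m} M). c \<odot>\<^bsub>direct_power {..m} M\<^esub> h C x)"
        unfolding h_def
      proof (rule ext[folded h_def])
        fix w assume w: "w \<in> ?W"
        have "h (c *\<^sub>C C) (G m w) = G m (c *\<^sub>C toep m C w)"
          using hG[OF csub_scale[OF CS C] w] by (simp add: toep_scale)
        then show "toeplitz M m (\<lambda>j. push ((c *\<^sub>C C) j)) (G m w) =
            (\<lambda>x\<in>carrier (direct_power {..m} M). c \<odot>\<^bsub>direct_power {..m} M\<^esub> toeplitz M m (\<lambda>j. push (C j)) x) (G m w)"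
          using G.g_in[OF w] hG[OF C w] G.g_scale[OF toep_W[OF C w]] by (simp add: h_def)
      qed simp
      then show ?thesis by (simp add: End_space_def)
    qed
    have "h 0 = (\<lambda>x\<in>carrier (direct_power {..m} M). \<zero>\<^bsub>direct_power {..m} M\<^esub>)"
      unfolding h_def
    proof (rule ext[folded h_def])
      fix w assume w: "w \<in> ?W"
      have "toep m 0 w = 0" by (simp add: toep_def fun_eq_iff)
      then have "h 0 (G m w) = G m 0" using hG[OF csub_0[OF CS] w] by simp
      then show "toeplitz M m (\<lambda>j. push (0 j)) (G m w) = (\<lambda>x\<in>carrier (direct_power {..m} M). \<zero>\<^bsub>direct_power {..m} M\<^esub>) (G m w)"
        using G.g_in[OF w] G.g_0 by (simp add: h_def)
    qed simp
    then show "\<zero>\<^bsub>(End_space (direct_power {..m} M))\<lparr>carrier := toeplitz_commutant M m B\<rparr>\<^esub> = h 0"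
      by (simp add: End_space_def)
  qed
  then show ?thesis by (simp add: h_def[abs_def])
qed

lemma complete_eq:
  assumes A: "\<And>i j x. (i, j) \<in> entries r m \<Longrightarrow> x \<in> S \<Longrightarrow> A i j (g x) = g (A' i j x)"
    and e: "\<And>i j. (i, j) \<in> entries r m \<Longrightarrow> endo S (A' i j)"
    and i: "i \<le> r" and j: "j \<le> m i" and x: "x \<in> S"
  shows "complete M r A i j (g x) = g (complete_on r A' i j x)"
proof -
  have E0: "(k, 0) \<in> entries r m" if "k \<in> {1..r}" for k using that by (auto simp: entries_def)
  have s: "(\<Sum>k\<in>{1..r}. A' k 0 y) \<in> S" if "y \<in> S" for y
    using that endoD(2)[OF e[OF E0]] by (intro cv.subspace_sum[OF S]) auto
  have fs: "finsum M (\<lambda>k. A k 0 (g x)) {1..r} = g (\<Sum>k\<in>{1..r}. A' k 0 x)"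
    using A[OF E0 x] endoD(2)[OF e[OF E0] x] by (intro finsum_cong) auto
  have ij: "(i, j) \<in> entries r m" if "\<not> (i = 0 \<and> j = 0)" using that i j by (auto simp: entries_def)
  show "complete M r A i j (g x) = g (complete_on r A' i j x)"
    using fs uminus[OF s[OF x]] A[OF ij x] by (simp add: complete_def complete_on_def)
qed

lemma idx_eq:
  assumes fdS: "findim S" and m: "\<And>i. i \<le> r \<Longrightarrow> m i \<le> 1"
    and A: "\<And>i j x. (i, j) \<in> entries r m \<Longrightarrow> x \<in> S \<Longrightarrow> A i j (g x) = g (A' i j x)"
    and e: "\<And>i j. (i, j) \<in> entries r m \<Longrightarrow> endo S (A' i j)"
  shows "idx M r m A = idx_on S r m A'"
proof -
  have "vdim ((End_space (direct_power {..m i} M))\<lparr>carrier := toeplitz_commutant M (m i) (complete M r A i)\<rparr>)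
      = commutant_dim S (m i) (complete_on r A' i)" if i: "i \<le> r" for i
  proof -
    have 1: "endo S (complete_on r A' i j)" if "j \<le> m i" for j
      by (rule endo_complete_on[where m = m, OF S _ i that]) (rule e)
    have 2: "complete M r A i j (g x) = g (complete_on r A' i j x)" if "j \<le> m i" "x \<in> S" for j x
      by (rule complete_eq[where m = m and A = A and A' = A', OF _ _ i that]) (use A e in auto)
    note d = dim_toep_commutant[OF fdS m[OF i] 1]
    show ?thesis using rec_iso.vdim[OF commutant_iso[OF 1 2] d(1)] d(2) by simp
  qed
  then show ?thesis using vdim[OF fdS] by (simp add: idx_def idx_on_def)
qed

section \<open>Quotients by the kernel of a linear map\<close>

lemma coset:
  assumes p: "lin S p" and v: "v \<in> S"
  shows "a_r_coset M (g ` {x \<in> S. p x = 0}) (g v) = g ` {u \<in> S. p u = p v}"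
proof (intro equalityI subsetI)
  fix y assume "y \<in> a_r_coset M (g ` {x \<in> S. p x = 0}) (g v)"
  then obtain q where q: "q \<in> S" "p q = 0" "y = g q \<oplus>\<^bsub>M\<^esub> g v" by (auto simp: a_r_coset_def')
  then show "y \<in> g ` {u \<in> S. p u = p v}"
    using v lin_add[OF p q(1) v] csub_add[OF S q(1) v] by (intro image_eqI[of _ _ "q + v"]) (auto simp: g_add)
next
  fix y assume "y \<in> g ` {u \<in> S. p u = p v}"
  then obtain u where u: "u \<in> S" "p u = p v" "y = g u" by blast
  have "u - v \<in> S" "p (u - v) = 0" using u v csub_diff[OF S] lin_diff[OF p S] by auto
  moreover have "y = g (u - v) \<oplus>\<^bsub>M\<^esub> g v" using u v csub_diff[OF S] by (simp flip: g_add)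
  ultimately show "y \<in> a_r_coset M (g ` {x \<in> S. p x = 0}) (g v)" by (auto simp: a_r_coset_def')
qed

text \<open>The cosets of the kernel are the nonempty fibres of \<open>p\<close>, so the image of
  \<open>p\<close> is a model of the quotient.\<close>

lemma quotient_iso:
  assumes p: "lin S p"
  shows "rec_iso (quotient_space M (g ` {x \<in> S. p x = 0})) (p ` S) (\<lambda>w. g ` {u \<in> S. p u = w})"
proof
  let ?Q = "g ` {x \<in> S. p x = 0}"
  show "csubspace (p ` S)" by (rule csubspace_image[OF S p])
  show "bij_betw (\<lambda>w. g ` {u \<in> S. p u = w}) (p ` S) (carrier (quotient_space M ?Q))"
  proof (rule bij_betwI')
    show "g ` {u \<in> S. p u = w} = g ` {u \<in> S. p u = w'} \<longleftrightarrow> w = w'" if w: "w \<in> p ` S" "w' \<in> p ` S" for w w'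
    proof
      assume eq: "g ` {u \<in> S. p u = w} = g ` {u \<in> S. p u = w'}"
      obtain u where u: "u \<in> S" "p u = w" using w by blast
      then have "g u \<in> g ` {u \<in> S. p u = w'}" using eq by blast
      then obtain u' where u': "u' \<in> S" "p u' = w'" "g u = g u'" by blast
      then show "w = w'" using g_inj u by simp
    qed simp
    show "g ` {u \<in> S. p u = w} \<in> carrier (quotient_space M ?Q)" if "w \<in> p ` S" for w
    proof -
      obtain v where v: "v \<in> S" "w = p v" using \<open>w \<in> p ` S\<close> by blast
      then show ?thesis using coset[OF p v(1)] g_in[OF v(1)]
        by (auto simp: quotient_space_def A_RCOSETS_def')
    qed
    show "\<exists>w\<in>p ` S. Y = g ` {u \<in> S. p u = w}" if Y: "Y \<in> carrier (quotient_space M ?Q)" for Y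
    proof -
      obtain a where a: "a \<in> carrier M" "Y = a_r_coset M ?Q a"
        using Y by (auto simp: quotient_space_def A_RCOSETS_def')
      obtain v where "v \<in> S" "a = g v" using g_surj[OF a(1)] by blast
      then show ?thesis using a coset[OF p] by auto
    qed
  qed
  show "g ` {u \<in> S. p u = x + y} = g ` {u \<in> S. p u = x} \<oplus>\<^bsub>quotient_space M ?Q\<^esub> g ` {u \<in> S. p u = y}"
    if x: "x \<in> p ` S" and y: "y \<in> p ` S" for x y
  proof -
    have "g ` {u \<in> S. p u = x + y} = (\<Union>h\<in>g ` {u \<in> S. p u = x}. \<Union>k\<in>g ` {u \<in> S. p u = y}. {h \<oplus>\<^bsub>M\<^esub> k})"
    proof (intro equalityI subsetI)
      fix z assume "z \<in> g ` {u \<in> S. p u = x + y}"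
      then obtain u where u: "u \<in> S" "p u = x + y" "z = g u" by blast
      obtain v where v: "v \<in> S" "p v = x" using x by blast
      have "u - v \<in> S" "p (u - v) = y" using u v csub_diff[OF S] lin_diff[OF p S] by auto
      moreover have "z = g v \<oplus>\<^bsub>M\<^esub> g (u - v)" using u v csub_diff[OF S] by (simp flip: g_add)
      ultimately show "z \<in> (\<Union>h\<in>g ` {u \<in> S. p u = x}. \<Union>k\<in>g ` {u \<in> S. p u = y}. {h \<oplus>\<^bsub>M\<^esub> k})" using v by blast
    next
      fix z assume "z \<in> (\<Union>h\<in>g ` {u \<in> S. p u = x}. \<Union>k\<in>g ` {u \<in> S. p u = y}. {h \<oplus>\<^bsub>M\<^esub> k})"
      then obtain u v where "u \<in> S" "p u = x" "v \<in> S" "p v = y" "z = g u \<oplus>\<^bsub>M\<^esub> g v" by blast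
      then show "z \<in> g ` {u \<in> S. p u = x + y}" using csub_add[OF S] lin_add[OF p]
        by (intro image_eqI[of _ _ "u + v"]) (auto simp: g_add)
    qed
    then show ?thesis by (simp add: quotient_space_def set_add_def')
  qed
  show "g ` {u \<in> S. p u = c *\<^sub>C x} = c \<odot>\<^bsub>quotient_space M ?Q\<^esub> g ` {u \<in> S. p u = x}" if x: "x \<in> p ` S" for c x
  proof -
    obtain v where v: "v \<in> S" "p v = x" using x by blast
    have "a_r_coset M ?Q (c \<odot>\<^bsub>M\<^esub> g u) = g ` {u \<in> S. p u = c *\<^sub>C x}" if "u \<in> S" "p u = x" for u
      using coset[OF p csub_scale[OF S that(1)], of c] lin_scale[OF p that(1), of c] that by (simp add: g_scale)
    then have "(\<Union>X\<in>g ` {u \<in> S. p u = x}. a_r_coset M ?Q (c \<odot>\<^bsub>M\<^esub> X)) = g ` {u \<in> S. p u = c *\<^sub>C x}"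
      using v by auto
    then show ?thesis by (simp add: quotient_space_def)
  qed
qed (simp add: quotient_space_def)

lemma quotient_map_eq:
  assumes p: "lin S p" and f: "\<And>x. x \<in> S \<Longrightarrow> f (g x) = g (f' x)" "\<And>x. x \<in> S \<Longrightarrow> f' x \<in> S"
    and B: "\<And>x. x \<in> S \<Longrightarrow> B (p x) = p (f' x)" and w: "w \<in> p ` S"
  shows "quotient_map M (g ` {x \<in> S. p x = 0}) f (g ` {u \<in> S. p u = w}) = g ` {u \<in> S. p u = B w}"
proof -
  let ?Q = "g ` {x \<in> S. p x = 0}"
  have c: "g ` {u \<in> S. p u = w} \<in> A_RCOSETS M ?Q"
    using rec_iso.g_in[OF quotient_iso[OF p] w] by (simp add: quotient_space_def)
  obtain v where v: "v \<in> S" "p v = w" using w by blast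
  have "a_r_coset M ?Q (f (g u)) = g ` {u \<in> S. p u = B w}" if "u \<in> S" "p u = w" for u
    using coset[OF p f(2)[OF that(1)]] f(1)[OF that(1)] B[OF that(1)] that by simp
  then have "(\<Union>X\<in>g ` {u \<in> S. p u = w}. a_r_coset M ?Q (f X)) = g ` {u \<in> S. p u = B w}"
    using v by auto
  then show ?thesis using c by (simp add: quotient_map_def)
qed

end

lemma image_eq_preimage:
  assumes "\<And>v. v \<in> X \<Longrightarrow> f v \<in> B \<longleftrightarrow> v \<in> A" "B \<subseteq> f ` X" "A \<subseteq> X"
  shows "B = f ` A"
proof (intro equalityI subsetI)
  fix y assume y: "y \<in> B"
  then obtain v where "v \<in> X" "y = f v" using assms(2) by blast
  then show "y \<in> f ` A" using assms(1) y by blast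
qed (use assms in blast)

section \<open>The middle convolution of a record\<close>

locale mc_rec = R: rec_iso M V g + mc_data V r m A' \<mu>
  for M :: "(complex, 'v) module" and V :: "'a::cvs set" and g :: "'a \<Rightarrow> 'v"
    and r :: nat and m :: "nat \<Rightarrow> nat" and A' :: "nat \<Rightarrow> nat \<Rightarrow> 'a \<Rightarrow> 'a" and \<mu> :: complex +
  fixes A :: "nat \<Rightarrow> nat \<Rightarrow> 'v \<Rightarrow> 'v"
  assumes A_g: "\<And>i j x. (i, j) \<in> entries r m \<Longrightarrow> x \<in> V \<Longrightarrow> A i j (g x) = g (A' i j x)"
begin

definition GE :: "(nat \<times> nat \<Rightarrow> 'a) \<Rightarrow> nat \<times> nat \<Rightarrow> 'v" where
  "GE v = (\<lambda>k\<in>E. g (v k))"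

lemma GE_iso: "rec_iso (conv_space M r m) X GE"
  using R.direct_power[of E] by (simp add: conv_space_def X_def GE_def[abs_def])

sublocale C: rec_iso "conv_space M r m" X GE
  by (rule GE_iso)

lemma GE_apply: "k \<in> E \<Longrightarrow> GE v k = g (v k)"
  by (simp add: GE_def)

lemma conv_sum_eq: "v \<in> X \<Longrightarrow> conv_sum M r m A (GE v) = g (csum v)"
  unfolding conv_sum_def csum_def
proof (rule R.finsum_cong[OF finite_entries])
  fix k assume v: "v \<in> X" and k: "k \<in> E"
  then have k': "(fst k, snd k) \<in> E" by simp
  show "A' (fst k) (snd k) (v k) \<in> V" by (rule endoD(2)[OF A[OF k'] X_in[OF v]])
  show "A (fst k) (snd k) (GE v k) = g (A' (fst k) (snd k) (v k))"
    using A_g[OF k' X_in[OF v]] k by (simp add: GE_apply)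
qed

lemma conv_tuple_eq:
  assumes v: "v \<in> X" and ij: "(i, j) \<in> E"
  shows "conv_tuple M r m A \<mu> i j (GE v) = GE (conv i j v)"
proof
  fix k :: "nat \<times> nat"
  obtain a b where k: "k = (a, b)" by (cases k)
  have i: "i \<le> r" using ij by (auto simp: entries_def)
  show "conv_tuple M r m A \<mu> i j (GE v) k = GE (conv i j v) k"
  proof (cases "k \<in> E")
    case False
    then show ?thesis using C.g_in[OF v] by (simp add: conv_tuple_def GE_def)
  next
    case True
    have L: "conv_tuple M r m A \<mu> i j (GE v) k = (if a \<noteq> i \<or> b < j then \<zero>\<^bsub>M\<^esub>
        else if j < b then \<mu> \<odot>\<^bsub>M\<^esub> GE v (i, b - j)
        else if i = 0 then conv_sum M r m A (GE v)
        else \<mu> \<odot>\<^bsub>M\<^esub> GE v (i, 0) \<oplus>\<^bsub>M\<^esub> conv_sum M r m A (GE v))"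
      using C.g_in[OF v] True by (simp add: conv_tuple_def k)
    have R: "GE (conv i j v) k = g (if a \<noteq> i \<or> b < j then 0
        else if j < b then \<mu> *\<^sub>C v (i, b - j)
        else if i = 0 then csum v else \<mu> *\<^sub>C v (i, 0) + csum v)"
    proof -
      have c: "(k \<notin> E \<or> fst k \<noteq> i \<or> snd k < j) = (a \<noteq> i \<or> b < j)" using True by (simp add: k)
      show ?thesis unfolding GE_apply[OF True] conv_def c by (simp only: k snd_conv)
    qed
    have Eb: "(i, b - j) \<in> E" if "a = i" "j < b" using True that by (auto simp: entries_def k)
    have E0i: "(i, 0) \<in> E" if "i \<noteq> 0" using i that Ei0[of i] by simp
    consider "a \<noteq> i \<or> b < j" | "a = i" "j < b" | "a = i" "b = j" "i = 0" | "a = i" "b = j" "i \<noteq> 0"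
      by linarith
    then show ?thesis
    proof cases
      case 1
      then show ?thesis unfolding L R by (simp add: R.g_0)
    next
      case 2
      then show ?thesis unfolding L R
        using Eb R.g_scale[OF X_in[OF v]] by (simp add: GE_apply)
    next
      case 3
      then show ?thesis unfolding L R by (simp add: conv_sum_eq[OF v])
    next
      case 4
      then show ?thesis unfolding L R
        using E0i R.g_scale[OF X_in[OF v]] R.g_add[OF csub_scale[OF sub X_in[OF v]] csum_in[OF v]]
        by (simp add: GE_apply conv_sum_eq[OF v])
    qed
  qed
qed

text \<open>The single condition v (0, 1) = 0 expresses K^(0) = 0 also when m_0 = 0, because
  elements of \<open>X\<close> vanish outside the entries.\<close>

definition KK :: "(nat \<times> nat \<Rightarrow> 'a) set" where
  "KK = {v \<in> X. v (0, 1) = 0 \<and> (\<forall>i\<in>{1..r}. a1 i (v (i, 0)) = 0 \<and> A' i 0 (v (i, 0)) + a1 i (v (i, 1)) = 0)}"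

definition LL :: "(nat \<times> nat \<Rightarrow> 'a) set" where
  "LL = {v \<in> X. if \<mu> = 0 then csum v = 0 else
     (\<exists>l\<in>V. (\<forall>i\<in>{1..r}. v (i, 1) = 0 \<and> v (i, 0) = - l) \<and> a1 0 l = 0 \<and> a00 l - \<mu> *\<^sub>C l + a1 0 (v (0, 1)) = 0)}"

text \<open>Both K and L(\<mu>) are given by columns annihilated by a Toeplitz matrix; this is that
  condition written out in blocks.\<close>

lemma toeplitz_zero:
  assumes m1: "m' \<le> 1" and B: "\<And>j. j \<le> m' \<Longrightarrow> endo V (B' j)" "\<And>j x. j \<le> m' \<Longrightarrow> x \<in> V \<Longrightarrow> B j (g x) = g (B' j x)"
    and w: "\<And>j. j \<le> m' \<Longrightarrow> w j \<in> V"
  shows "toeplitz M m' B (\<lambda>j\<in>{..m'}. g (w j)) = \<zero>\<^bsub>direct_power {..m'} M\<^esub> \<longleftrightarrow>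
    (if m' = 0 then B' 0 (w 0) = 0 else B' 1 (w 0) = 0 \<and> B' 0 (w 0) + B' 1 (w 1) = 0)"
proof -
  interpret G: rec_iso "direct_power {..m'} M" "fun_space {..m'} (\<lambda>_. V)" "R.G m'" by (rule R.G_iso)
  define w' where "w' = (\<lambda>j. if j \<le> m' then w j else 0)"
  have w': "w' \<in> fun_space {..m'} (\<lambda>_. V)" using w by (auto simp: w'_def fun_space_def)
  have e: "(\<lambda>j\<in>{..m'}. g (w j)) = R.G m' w'" by (auto simp: R.G_def w'_def fun_eq_iff restrict_def)
  have "toeplitz M m' B (\<lambda>j\<in>{..m'}. g (w j)) = \<zero>\<^bsub>direct_power {..m'} M\<^esub> \<longleftrightarrow> toep m' B' w' = 0"
    unfolding e using R.toeplitz_G[OF B w'] G.g_0 G.g_inj[OF toep_in[OF sub B(1) w'] csub_0[OF G.S]] by simp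
  also have "\<dots> \<longleftrightarrow> (if m' = 0 then B' 0 (w 0) = 0 else B' 1 (w 0) = 0 \<and> B' 0 (w 0) + B' 1 (w 1) = 0)"
  proof (cases "m' = 0")
    case True
    then show ?thesis by (auto simp: toep_0 w'_def fun_eq_iff)
  next
    case False
    then have m': "m' = 1" using m1 by simp
    have t: "toep m' B' w' j = (if j = 0 then B' 1 (w 0) else if j = 1 then B' 0 (w 0) + B' 1 (w 1) else 0)" for j
      unfolding m' toep_1 by (simp add: w'_def m')
    show ?thesis
    proof
      assume "toep m' B' w' = 0"
      then show "if m' = 0 then B' 0 (w 0) = 0 else B' 1 (w 0) = 0 \<and> B' 0 (w 0) + B' 1 (w 1) = 0"
        using t[of 0] t[of 1] m' by simp
    next
      assume "if m' = 0 then B' 0 (w 0) = 0 else B' 1 (w 0) = 0 \<and> B' 0 (w 0) + B' 1 (w 1) = 0"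
      then show "toep m' B' w' = 0" unfolding fun_eq_iff t using m' by simp
    qed
  qed
  finally show ?thesis .
qed

lemma conv_K_eq: "conv_K M r m A = GE ` KK"
proof -
  have "GE v \<in> conv_K M r m A \<longleftrightarrow> v \<in> KK" if v: "v \<in> X" for v
  proof -
    have 1: "(\<forall>j\<in>{1..m 0}. GE v (0, j) = \<zero>\<^bsub>M\<^esub>) \<longleftrightarrow> v (0, 1) = 0"
    proof (cases "m 0 = 1")
      case True
      then have "GE v (0, 1) = g (v (0, 1))" using E0 by (simp add: GE_apply)
      then show ?thesis using True R.g_0 R.g_inj[OF X_in[OF v] csub_0[OF sub]] by simp
    next
      case False
      then have "m 0 = 0" "v (0, 1) = 0" using m[of 0] X_out[OF v] E0 by auto
      then show ?thesis by simp
    qed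
    have 2: "toeplitz M (m i) (A i) (\<lambda>j\<in>{..m i}. GE v (i, j)) = \<zero>\<^bsub>direct_power {..m i} M\<^esub> \<longleftrightarrow>
       a1 i (v (i, 0)) = 0 \<and> A' i 0 (v (i, 0)) + a1 i (v (i, 1)) = 0" if i: "i \<in> {1..r}" for i
    proof -
      have ij: "(i, j) \<in> E" if "j \<le> m i" for j using i that by (auto simp: entries_def)
      have e: "(\<lambda>j\<in>{..m i}. GE v (i, j)) = (\<lambda>j\<in>{..m i}. g (v (i, j)))"
        using ij by (auto simp: GE_apply fun_eq_iff restrict_def)
      have mi: "m i \<le> 1" using m[of i] i by simp
      have "toeplitz M (m i) (A i) (\<lambda>j\<in>{..m i}. GE v (i, j)) = \<zero>\<^bsub>direct_power {..m i} M\<^esub> \<longleftrightarrow>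
        (if m i = 0 then A' i 0 (v (i, 0)) = 0 else A' i 1 (v (i, 0)) = 0 \<and> A' i 0 (v (i, 0)) + A' i 1 (v (i, 1)) = 0)"
        unfolding e by (rule toeplitz_zero[OF mi A[OF ij] A_g[OF ij] X_in[OF v]])
      then show ?thesis using mi by (auto simp: a1_def)
    qed
    show ?thesis using C.g_in[OF v] v 1 2 by (simp add: conv_K_def KK_def)
  qed
  moreover have "conv_K M r m A \<subseteq> carrier (conv_space M r m)" by (auto simp: conv_K_def)
  moreover have "KK \<subseteq> X" by (auto simp: KK_def)
  ultimately show ?thesis unfolding C.carrier_eq by (rule image_eq_preimage)
qed

lemma conv_L_eq: "conv_L M r m A \<mu> = GE ` LL"
proof -
  have "GE v \<in> conv_L M r m A \<mu> \<longleftrightarrow> v \<in> LL" if v: "v \<in> X" for v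
  proof (cases "\<mu> = 0")
    case True
    have "conv_sum M r m A (GE v) = \<zero>\<^bsub>M\<^esub> \<longleftrightarrow> csum v = 0"
      using conv_sum_eq[OF v] R.g_0 R.g_inj[OF csum_in[OF v] csub_0[OF sub]] by simp
    moreover have "LL = {v \<in> X. csum v = 0}" unfolding LL_def using True by simp
    ultimately show ?thesis using C.g_in[OF v] v True by (simp add: conv_L_def)
  next
    case False
    have eqv: "((\<forall>(i, j)\<in>entries r m. i \<noteq> 0 \<and> j \<noteq> 0 \<longrightarrow> GE v (i, j) = \<zero>\<^bsub>M\<^esub>) \<and>
        (\<forall>i\<in>{1..r}. GE v (i, 0) = \<ominus>\<^bsub>M\<^esub> g l) \<and>
        toeplitz M (m 0)
          ((complete M r A 0)(0 := \<lambda>x. complete M r A 0 0 x \<ominus>\<^bsub>M\<^esub> \<mu> \<odot>\<^bsub>M\<^esub> x))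
          (\<lambda>j\<in>{..m 0}. if j = 0 then g l else GE v (0, j))
        = \<zero>\<^bsub>direct_power {..m 0} M\<^esub>) \<longleftrightarrow>
      (\<forall>i\<in>{1..r}. v (i, 1) = 0 \<and> v (i, 0) = - l) \<and> a1 0 l = 0 \<and> a00 l - \<mu> *\<^sub>C l + a1 0 (v (0, 1)) = 0"
      (is "?P1 \<and> ?P2 \<and> ?P3 \<longleftrightarrow> _") if l: "l \<in> V" for l
    proof -
      have zero: "GE v k = \<zero>\<^bsub>M\<^esub> \<longleftrightarrow> v k = 0" if "k \<in> E" for k
        using that R.g_0 R.g_inj[OF X_in[OF v] csub_0[OF sub]] by (simp add: GE_apply)
      have P1: "?P1 \<longleftrightarrow> (\<forall>i\<in>{1..r}. v (i, 1) = 0)"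
      proof
        assume P: ?P1
        show "\<forall>i\<in>{1..r}. v (i, 1) = 0"
        proof
          fix i assume i: "i \<in> {1..r}"
          show "v (i, 1) = 0"
          proof (cases "(i, 1) \<in> E")
            case True
            then show ?thesis using P i zero[OF True] by auto
          qed (rule X_out[OF v])
        qed
      next
        assume P: "\<forall>i\<in>{1..r}. v (i, 1) = 0"
        show ?P1
        proof (rule ballI)
          fix k assume k: "k \<in> E"
          obtain i j where ij: "k = (i, j)" by (cases k)
          have "GE v (i, j) = \<zero>\<^bsub>M\<^esub>" if "i \<noteq> 0" "j \<noteq> 0"
          proof -
            have "i \<in> {1..r}" "j = 1" using E_cases[OF k] that by (auto simp: ij)
            then show ?thesis using P zero[OF k] by (simp add: ij)
          qed
          then show "case k of (i, j) \<Rightarrow> i \<noteq> 0 \<and> j \<noteq> 0 \<longrightarrow> GE v (i, j) = \<zero>\<^bsub>M\<^esub>" by (simp add: ij)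
        qed
      qed
      have P2: "?P2 \<longleftrightarrow> (\<forall>i\<in>{1..r}. v (i, 0) = - l)"
        using Ei0 R.uminus[OF l] R.g_inj[OF X_in[OF v] csub_neg[OF sub l]] by (simp add: GE_apply)
      \<comment> \<open>The blocks of the matrix in L(\<mu>), with \<mu> already subtracted from the
        one of subscript 0.\<close>
      define B' where "B' = (\<lambda>j. if j = 0 then (\<lambda>x. a00 x - \<mu> *\<^sub>C x) else A' 0 j)"
      have c0: "complete M r A 0 j (g x) = g (complete_on r A' 0 j x)" if "j \<le> m 0" "x \<in> V" for j x
        by (rule R.complete_eq[where m = m and A = A and A' = A', OF _ _ _ that]) (use A_g A in auto)
      have B1: "endo V (B' j)" if "j \<le> m 0" for j
        using endo_a0[of 0] A[of 0 j] that by (cases "j = 0") (auto simp: B'_def a0_def[abs_def] entries_def)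
      have B2: "((complete M r A 0)(0 := \<lambda>x. complete M r A 0 0 x \<ominus>\<^bsub>M\<^esub> \<mu> \<odot>\<^bsub>M\<^esub> x)) j (g x) = g (B' j x)"
        if "j \<le> m 0" "x \<in> V" for j x
      proof (cases "j = 0")
        case True
        have "complete M r A 0 0 (g x) = g (a00 x)"
          using c0[of 0 x] that by (simp add: complete_on_def a00_def)
        then show ?thesis
          using True R.diff[OF a00_in[OF that(2)] csub_scale[OF sub that(2)], of \<mu>] R.g_scale[OF that(2), of \<mu>]
          by (simp add: B'_def)
      next
        case False
        then show ?thesis using c0[OF that] by (simp add: B'_def complete_on_def)
      qed
      define w where "w = (\<lambda>j. if j = 0 then l else v (0, j))"
      have wV: "w j \<in> V" for j using l X_in[OF v] by (simp add: w_def)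
      have e: "(\<lambda>j\<in>{..m 0}. if j = 0 then g l else GE v (0, j)) = (\<lambda>j\<in>{..m 0}. g (w j))"
      proof
        fix j
        have "j \<noteq> 0 \<Longrightarrow> j \<le> m 0 \<Longrightarrow> (0, j) \<in> E" by (auto simp: entries_def)
        then show "(\<lambda>j\<in>{..m 0}. if j = 0 then g l else GE v (0, j)) j = (\<lambda>j\<in>{..m 0}. g (w j)) j"
          by (auto simp: w_def GE_apply restrict_def)
      qed
      have "?P3 \<longleftrightarrow> (if m 0 = 0 then B' 0 (w 0) = 0 else B' 1 (w 0) = 0 \<and> B' 0 (w 0) + B' 1 (w 1) = 0)"
        unfolding e by (rule toeplitz_zero[OF m[of 0] B1 B2 wV]) auto
      also have "\<dots> \<longleftrightarrow> a1 0 l = 0 \<and> a00 l - \<mu> *\<^sub>C l + a1 0 (v (0, 1)) = 0"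
        using m[of 0] by (auto simp: B'_def w_def a1_def)
      finally show ?thesis using P1 P2 by blast
    qed
    note b = bex_cong[OF refl, of V, OF eqv]
    have im: "(\<exists>l\<in>g ` V. \<phi> l) \<longleftrightarrow> (\<exists>l\<in>V. \<phi> (g l))" for \<phi> by blast
    show ?thesis
      by (simp only: conv_L_def LL_def False if_False mem_Collect_eq R.carrier_eq im b C.g_in[OF v] v simp_thms)
  qed
  moreover have "conv_L M r m A \<mu> \<subseteq> carrier (conv_space M r m)" by (auto simp: conv_L_def)
  moreover have "LL \<subseteq> X" by (auto simp: LL_def)
  ultimately show ?thesis unfolding C.carrier_eq by (rule image_eq_preimage)
qed

text \<open>If \<mu> = 0, then K lies in L(0), since \<open>csum\<close> adds up rows of the kernel
  equations. If \<mu> \<noteq> 0, the L(\<mu>)-part of v carries - l at every (i, 0) and v (0, 1) at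
  (0, 1), and the remainder lies in K.\<close>

lemma KL_QQ: "{k + l | k l. k \<in> KK \<and> l \<in> LL} = QQ"
proof (cases "\<mu> = 0")
  case True
  have L: "LL = {v \<in> X. csum v = 0}" and Q: "QQ = {v \<in> X. csum v = 0}"
    unfolding LL_def QQ_def using True by simp_all
  have sL: "csubspace LL" unfolding L by (rule csubspace_kernel[OF subX lin_csum])
  have KL: "KK \<subseteq> LL" unfolding L
  proof
    fix v assume v: "v \<in> KK"
    then have vX: "v \<in> X" by (simp add: KK_def)
    have "csum v = 0" unfolding csum_eq[OF vX] using v z(1)[of 0] by (simp add: KK_def)
    then show "v \<in> {v \<in> X. csum v = 0}" using vX by simp
  qed
  have "0 \<in> KK" using csub_0[OF subX] z by (simp add: KK_def)
  moreover have "k + l \<in> LL" if "k \<in> KK" "l \<in> LL" for k l using that KL csub_add[OF sL] by blast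
  ultimately have "{k + l | k l. k \<in> KK \<and> l \<in> LL} = LL"
  proof (intro equalityI subsetI)
    fix l assume "0 \<in> KK" "l \<in> LL"
    then show "l \<in> {k + l | k l. k \<in> KK \<and> l \<in> LL}"
      by (intro CollectI exI[of _ 0] exI[of _ l]) simp
  qed blast
  then show ?thesis using L Q by simp
next
  case False
  have L: "v \<in> LL \<longleftrightarrow> v \<in> X \<and> (\<exists>l\<in>V. (\<forall>i\<in>{1..r}. v (i, 1) = 0 \<and> v (i, 0) = - l) \<and> a1 0 l = 0 \<and>
      a00 l - \<mu> *\<^sub>C l + a1 0 (v (0, 1)) = 0)" for v
    unfolding LL_def using False by simp
  have Q: "v \<in> QQ \<longleftrightarrow> v \<in> X \<and> (\<exists>l\<in>V. a1 0 l = 0 \<and> a00 l - \<mu> *\<^sub>C l + a1 0 (v (0, 1)) = 0 \<and>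
       (\<forall>i\<in>{1..r}. a1 i (v (i, 0) + l) = 0 \<and> A' i 0 (v (i, 0) + l) + a1 i (v (i, 1)) = 0))" for v
    unfolding QQ_def using False by simp
  show ?thesis
  proof (intro equalityI subsetI)
    fix v assume "v \<in> {k + l | k l. k \<in> KK \<and> l \<in> LL}"
    then obtain k u where k: "k \<in> KK" and u: "u \<in> LL" and v: "v = k + u" by blast
    obtain l where l: "l \<in> V" "\<And>i. i \<in> {1..r} \<Longrightarrow> u (i, 1) = 0 \<and> u (i, 0) = - l" "a1 0 l = 0"
      "a00 l - \<mu> *\<^sub>C l + a1 0 (u (0, 1)) = 0" using u L by blast
    have "v \<in> X" using k u L csub_add[OF subX] v by (auto simp: KK_def)
    moreover have "a1 i (v (i, 0) + l) = 0 \<and> A' i 0 (v (i, 0) + l) + a1 i (v (i, 1)) = 0" if "i \<in> {1..r}" for i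
      using k l(2)[OF that] that by (simp add: v KK_def)
    moreover have "v (0, 1) = u (0, 1)" using k by (simp add: v KK_def)
    ultimately show "v \<in> QQ" unfolding Q using l by auto
  next
    fix v assume "v \<in> QQ"
    then obtain l where v: "v \<in> X" and l: "l \<in> V" "a1 0 l = 0" "a00 l - \<mu> *\<^sub>C l + a1 0 (v (0, 1)) = 0"
      and lk: "\<And>i. i \<in> {1..r} \<Longrightarrow> a1 i (v (i, 0) + l) = 0 \<and> A' i 0 (v (i, 0) + l) + a1 i (v (i, 1)) = 0"
      unfolding Q by blast
    define u where "u = (\<lambda>k :: nat \<times> nat. if fst k \<in> {1..r} \<and> snd k = 0 then - l else if k = (0, 1) then v (0, 1) else 0)"
    have uX: "u \<in> X"
    proof (rule X_I)
      show "u k \<in> V" for k using csub_neg[OF sub l(1)] X_in[OF v] csub_0[OF sub] by (simp add: u_def)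
      show "u k = 0" if "k \<notin> E" for k
      proof -
        have "\<not> (fst k \<in> {1..r} \<and> snd k = 0)" using Ei0[of "fst k"] that by (metis prod.collapse)
        then show ?thesis using X_out[OF v that] by (auto simp: u_def)
      qed
    qed
    have u01: "u (0, 1) = v (0, 1)" and u0: "i \<in> {1..r} \<Longrightarrow> u (i, 0) = - l" and u1: "i \<in> {1..r} \<Longrightarrow> u (i, 1) = 0" for i
      by (auto simp: u_def)
    have "u \<in> LL" unfolding L using uX l u01 u0 u1 by auto
    moreover have "v - u \<in> KK"
      using csub_diff[OF subX v uX] lk u01 u0 u1 by (simp add: KK_def)
    ultimately show "v \<in> {k + l | k l. k \<in> KK \<and> l \<in> LL}"
      by (intro CollectI exI[of _ "v - u"] exI[of _ u]) simp
  qed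
qed

lemma conv_KL_eq: "conv_KL M r m A \<mu> = GE ` QQ"
proof -
  have X: "KK \<subseteq> X" "LL \<subseteq> X" by (auto simp: KK_def LL_def)
  have "conv_KL M r m A \<mu> = {GE k \<oplus>\<^bsub>conv_space M r m\<^esub> GE l | k l. k \<in> KK \<and> l \<in> LL}"
    unfolding conv_KL_def set_add_def' conv_K_eq conv_L_eq by blast
  also have "\<dots> = {GE (k + l) | k l. k \<in> KK \<and> l \<in> LL}"
    using C.g_add X by (metis (no_types, lifting) subset_iff)
  also have "\<dots> = GE ` {k + l | k l. k \<in> KK \<and> l \<in> LL}" by blast
  finally show ?thesis by (simp add: KL_QQ)
qed

end

section \<open>The theorem for complex coordinate spaces\<close>

lemma findim_complex: "findim (UNIV :: complex set)"
proof -
  have "x \<in> cspan {1}" for x :: complex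
    using cv.span_scale[OF cv.span_base[of 1 "{1 :: complex}"], of x] by (simp add: cscale_complex_def)
  then show ?thesis unfolding findim_def by (intro conjI exI[of _ "{1}"]) (auto intro: cv.subspace_UNIV)
qed

lemma C_space_iso: "rec_iso (C_space n) (fun_space {..<n} (\<lambda>_. UNIV :: complex set)) (vec n)"
proof
  show "csubspace (fun_space {..<n} (\<lambda>_. UNIV :: complex set))"
    by (intro csubspace_fun_space findim_sub[OF findim_complex])
  show "bij_betw (vec n) (fun_space {..<n} (\<lambda>_. UNIV :: complex set)) (carrier (C_space n))"
  proof (rule bij_betwI')
    show "vec n f = vec n h \<longleftrightarrow> f = h" if "f \<in> fun_space {..<n} (\<lambda>_. UNIV)" "h \<in> fun_space {..<n} (\<lambda>_. UNIV)" for f h :: "nat \<Rightarrow> complex"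
    proof
      assume eq: "vec n f = vec n h"
      show "f = h"
      proof
        fix i
        show "f i = h i"
          using arg_cong[OF eq, of "\<lambda>v. v $ i"] that by (cases "i < n") (auto simp: fun_space_def)
      qed
    qed simp
    show "vec n f \<in> carrier (C_space n)" for f by (simp add: module_vec_def)
    show "\<exists>f\<in>fun_space {..<n} (\<lambda>_. UNIV). y = vec n f" if "y \<in> carrier (C_space n)" for y
      using that by (intro bexI[of _ "\<lambda>i. if i < n then y $ i else 0"]) (auto simp: module_vec_def fun_space_def)
  qed
qed (auto simp: module_vec_def cscale_complex_def)

theorem proposition4p2:
  fixes r n :: nat
    and m :: "nat \<Rightarrow> nat"
    and A :: "nat \<Rightarrow> nat \<Rightarrow> complex vec \<Rightarrow> complex vec"
    and \<mu> :: complex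
  assumes r: "1 \<le> r"
    and endo: "\<forall>(i, j)\<in>entries r m. is_endo (C_space n) (A i j)"
    and m_le_1: "\<forall>i\<le>r. m i \<le> 1"
    and semisimple: "\<forall>i\<le>r. m i = 1 \<longrightarrow> semisimple_endo (C_space n) (A i 1)"
    and irreducible: "irreducible_tuple (C_space n) r m A"
    and mc_nonzero: "carrier (mc_space (C_space n) r m A \<mu>) \<noteq> {\<zero>\<^bsub>mc_space (C_space n) r m A \<mu>\<^esub>}"
  shows "idx (mc_space (C_space n) r m A \<mu>) r m (mc_tuple (C_space n) r m A \<mu>)
         = idx (C_space n) r m A"
proof -
  define V where "V = fun_space {..<n} (\<lambda>_. UNIV :: complex set)"
  interpret g: rec_iso "C_space n" V "vec n" unfolding V_def by (rule C_space_iso)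
  have V: "findim V" unfolding V_def using dim_fun_space[of "{..<n}" "\<lambda>_. UNIV :: complex set"] findim_complex by simp
  define A' where "A' = (\<lambda>i j. g.pull (A i j))"
  have is_endo: "is_endo (C_space n) (A i j)" if "(i, j) \<in> entries r m" for i j using endo that by blast
  interpret mc: mc_rec "C_space n" V "vec n" r m A' \<mu> A
  proof
    show "endo V (A' i j)" if "(i, j) \<in> entries r m" for i j
      using g.pull(2)[OF is_endo[OF that]] by (simp add: A'_def)
    show "A i j (vec n x) = vec n (A' i j x)" if "(i, j) \<in> entries r m" "x \<in> V" for i j x
      using g.pull(3)[OF is_endo[OF that(1)] that(2)] by (simp add: A'_def)
  qed (use V r m_le_1 in auto)
  have nz: "mc.QQ \<noteq> mc.X"
  proof
    assume eq: "mc.QQ = mc.X"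
    \<comment> \<open>If \<open>QQ\<close> is everything it is the kernel of the zero map, whose
      image {0} is then a model of the middle convolution, against
      \<open>mc_nonzero\<close>.\<close>
    have z: "{x \<in> mc.X. (0 :: complex) = 0} = mc.QQ" using eq by simp
    note q = mc.C.quotient_iso[OF lin_zero, where ?'b = complex, unfolded z, folded mc.conv_KL_eq mc_space_def]
    have "mc.X \<noteq> {}" using csub_0[OF mc.subX] by blast
    then have im: "(\<lambda>x. 0) ` mc.X = {0 :: complex}" by auto
    have "carrier (mc_space (C_space n) r m A \<mu>) = {\<zero>\<^bsub>mc_space (C_space n) r m A \<mu>\<^esub>}"
      unfolding rec_iso.carrier_eq[OF q] rec_iso.g_0[OF q] im by simp
    then show False using mc_nonzero by simp
  qed
  interpret mc_irr V r m A' \<mu>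
  proof
    show "A' i 1 x = 0" if i: "i \<le> r" "m i = 1" and x: "x \<in> V" "A' i 1 (A' i 1 x) = 0" for i x
    proof -
      have iE: "(i, 1) \<in> entries r m" using mc.Ei1[OF i(1)] i(2) by simp
      define T where "T = A' i 1"
      have T: "endo V T" using mc.A[OF iE] by (simp add: T_def)
      have AT: "A i 1 (vec n y) = vec n (T y)" if "y \<in> V" for y using mc.A_g[OF iE that] by (simp add: T_def)
      \<comment> \<open>Semisimplicity provides an invariant complement W' of this kernel. With x =
        u + u', the vector T x = T u' lies in W', and in the kernel when T (T x) = 0; hence it
        vanishes.\<close>
      define U where "U = {y \<in> V. T y = 0}"
      have U: "csubspace U" "U \<subseteq> V" unfolding U_def using csubspace_kernel[OF mc.sub endoD(1)[OF T]] by auto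
      have sW: "is_subspace (vec n ` U) (C_space n)" by (rule g.is_subspace_image[OF U])
      have iW: "A i 1 ` vec n ` U \<subseteq> vec n ` U"
      proof clarify
        fix y assume "y \<in> U"
        then have "A i 1 (vec n y) = vec n 0" using AT by (simp add: U_def)
        then show "A i 1 (vec n y) \<in> vec n ` U" using csub_0[OF U(1)] by simp
      qed
      have "semisimple_endo (C_space n) (A i 1)" using semisimple i by blast
      then obtain W' where W': "is_subspace W' (C_space n)" "A i 1 ` W' \<subseteq> W'"
        "vec n ` U \<inter> W' = {\<zero>\<^bsub>C_space n\<^esub>}" "set_add (C_space n) (vec n ` U) W' = carrier (C_space n)"
        using sW iW unfolding semisimple_endo_def by meson
      obtain U' where U': "csubspace U'" "U' \<subseteq> V" "W' = vec n ` U'" by (rule g.subspace_preimage[OF W'(1)])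
      have "vec n x \<in> set_add (C_space n) (vec n ` U) W'" using W'(4) g.g_in[OF x(1)] by simp
      then obtain u u' where u: "u \<in> U" "u' \<in> U'" "vec n x = vec n u \<oplus>\<^bsub>C_space n\<^esub> vec n u'"
        unfolding set_add_def' U'(3) by blast
      have uV: "u \<in> V" "u' \<in> V" using u U U' by auto
      have "x = u + u'" using u(3) g.g_inj[OF x(1) csub_add[OF mc.sub uV]] g.g_add[OF uV] by simp
      then have Tx: "T x = T u'" using lin_add[OF endoD(1)[OF T] uV] u(1) by (simp add: U_def)
      have Tu: "T u' \<in> V" using endoD(2)[OF T uV(2)] .
      have "A i 1 (vec n u') \<in> W'" using W'(2) u(2) U'(3) by blast
      then have "vec n (T u') \<in> W'" using AT[OF uV(2)] by simp
      moreover have "T u' \<in> U" using Tu x(2) Tx by (simp add: U_def T_def)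
      ultimately have "vec n (T u') \<in> vec n ` U \<inter> W'" by blast
      then have "vec n (T u') = vec n 0" unfolding W'(3) g.g_0 by simp
      then have "T u' = 0" using g.g_inj[OF Tu csub_0[OF mc.sub]] by simp
      then show ?thesis using Tx by (simp add: T_def)
    qed
    show "U = {0} \<or> U = V" if U: "csubspace U" "U \<subseteq> V" and inv: "\<And>i j x. (i, j) \<in> entries r m \<Longrightarrow> x \<in> U \<Longrightarrow> A' i j x \<in> U" for U
    proof -
      have "is_subspace (vec n ` U) (C_space n)" by (rule g.is_subspace_image[OF U])
      moreover have "\<forall>(i, j)\<in>entries r m. A i j ` vec n ` U \<subseteq> vec n ` U"
      proof clarify
        fix i j y assume ij: "(i, j) \<in> entries r m" and y: "y \<in> U"
        have "A i j (vec n y) = vec n (A' i j y)" using mc.A_g[OF ij] y U(2) by blast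
        then show "A i j (vec n y) \<in> vec n ` U" using inv[OF ij y] by simp
      qed
      ultimately have "vec n ` U = {\<zero>\<^bsub>C_space n\<^esub>} \<or> vec n ` U = carrier (C_space n)"
        using irreducible unfolding irreducible_tuple_def by blast
      then have "vec n ` U = vec n ` {0} \<or> vec n ` U = vec n ` V"
        using g.g_0 g.carrier_eq by simp
      moreover have "inj_on (vec n) V" using g.g_bij by (simp add: bij_betw_def)
      ultimately show ?thesis
        using U(2) csub_0[OF mc.sub] inj_on_image_eq_iff[of "vec n" V U "{0}"] inj_on_image_eq_iff[of "vec n" V U V] by auto
    qed
  qed (rule nz)
  obtain q where q: "lin UNIV q" "\<And>x. q x \<in> mc.QQ" "\<And>x. x \<in> mc.QQ \<Longrightarrow> q x = x"
    by (rule lin_projection[OF subQ]) blast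
  \<comment> \<open>The projection along \<open>QQ\<close>: its kernel is \<open>QQ\<close>, and its
    image is a complement in V' that models the quotient.\<close>
  define p where "p = (\<lambda>v. v - q v)"
  have lp: "lin mc.X p" unfolding p_def by (intro lin_minus lin_id lin_subset[OF q(1)]) simp
  have p0: "p v = 0 \<longleftrightarrow> v \<in> mc.QQ" for v
    using q(2)[of v] q(3)[of v] by (auto simp: p_def)
  have pX: "p v \<in> mc.X" if "v \<in> mc.X" for v
    using csub_diff[OF mc.subX that] q(2)[of v] QX by (auto simp: p_def)
  have K: "{x \<in> mc.X. p x = 0} = mc.QQ" using p0 QX by auto
  \<comment> \<open>The compression of the convolution to that complement. It is the induced
    operator because \<open>conv_Q\<close> makes \<open>p\<close> insensitive to the discarded
    component.\<close>
  define B where "B = (\<lambda>i j w. p (mc.conv i j w))"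
  have Bp: "B i j (p v) = p (mc.conv i j v)" if ij: "(i, j) \<in> entries r m" and v: "v \<in> mc.X" for i j v
  proof -
    have i: "i \<le> r" using ij by (auto simp: entries_def)
    have qX: "q v \<in> mc.X" using q(2) QX by blast
    have "mc.conv i j (p v) = mc.conv i j v - mc.conv i j (q v)"
      unfolding p_def by (rule lin_diff[OF mc.lin_conv mc.subX v qX])
    then have "B i j (p v) = p (mc.conv i j v) - p (mc.conv i j (q v))"
      using lin_diff[OF lp mc.subX mc.conv_X[OF i v] mc.conv_X[OF i qX]] by (simp add: B_def)
    then show ?thesis using p0 conv_Q[OF ij q(2)] by simp
  qed
  note W = mc.C.quotient_iso[OF lp, unfolded K, folded mc.conv_KL_eq mc_space_def]
  have "idx (mc_space (C_space n) r m A \<mu>) r m (mc_tuple (C_space n) r m A \<mu>) = idx_on (p ` mc.X) r m B"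
  proof (rule rec_iso.idx_eq[OF W])
    show "findim (p ` mc.X)" by (rule rank_nullity(2)[OF mc.fdX lp])
    show "m i \<le> 1" if "i \<le> r" for i using m_le_1 that by blast
    fix i j assume ij: "(i, j) \<in> entries r m"
    then have i: "i \<le> r" by (auto simp: entries_def)
    show "mc_tuple (C_space n) r m A \<mu> i j (mc.GE ` {u \<in> mc.X. p u = x}) = mc.GE ` {u \<in> mc.X. p u = B i j x}"
      if x: "x \<in> p ` mc.X" for x
      unfolding mc_tuple_def mc.conv_KL_eq K[symmetric]
      by (rule mc.C.quotient_map_eq[where f' = "mc.conv i j" and B = "B i j", OF lp _ _ _ x];
        rule mc.conv_tuple_eq[OF _ ij] mc.conv_X[OF i] Bp[OF ij]; assumption)
    have "lin (p ` mc.X) (B i j)"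
      unfolding B_def
      by (rule lin_comp[of _ "mc.conv i j" mc.X p]) (use pX mc.conv_X[OF i] lp in \<open>auto intro: lin_subset[OF mc.lin_conv]\<close>)
    moreover have "B i j x \<in> p ` mc.X" if "x \<in> p ` mc.X" for x
      using that pX mc.conv_X[OF i] by (auto simp: B_def)
    ultimately show "endo (p ` mc.X) (B i j)" by (simp add: endo_def)
  qed
  also have "\<dots> = idx_on V r m A'"
    by (rule idx_on_conv[where B = B, OF lp p0]) (rule Bp)
  also have "\<dots> = idx (C_space n) r m A"
    by (rule g.idx_eq[where A' = A', symmetric, OF V]) (use m_le_1 mc.A_g mc.A in auto)
  finally show ?thesis .
qed

end
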